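(* Consider a real massless scalar field on a background geometry which describes the formation of a quasi-stationary black hole, and the linear map $T(\rho)=\mathrm{Tr}_{H^+}[S\rho S^\dagger]$ from density matrices on $\mathcal F_{\mathcal I^-(v>v_0)}$ to density matrices on $\mathcal F(\mathcal H_{\mathcal I^+})$ (all objects as specified in the context). Then $$T\big(\rho_{th}(\beta_{BH},\Omega_{BH})\big)=\tilde\rho_{th}(\beta_{BH},\Omega_{BH}),$$ where $$\rho_{th}(\beta_{BH},\Omega_{BH})=Z^{-1}\sum_{\{n_{{}_i\gamma}\}}e^{-\beta_{BH}\sum_i n_{{}_i\gamma}(\omega_i-\Omega_{BH}m_i)}\,|\{n_{{}_i\gamma}\}\rangle\langle\{n_{{}_i\gamma}\}|,$$ $$\tilde\rho_{th}(\beta_{BH},\Omega_{BH})=Z^{-1}\sum_{\{n_{{}_i\rho}\}}e^{-\beta_{BH}\sum_i n_{{}_i\rho}(\omega_i-\Omega_{BH}m_i)}\,|\{n_{{}_i\rho}\}\rangle\langle\{n_{{}_i\rho}\}|,$$ $$Z=\sum_{\{j_i\}}e^{-\beta_{BH}\sum_i j_i(\omega_i-\Omega_{BH}m_i)}.$$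
   Context: Geometry. $\mathcal I^-$ and $\mathcal I^+$ are past and future null infinity, $H^+$ is the future event horizon, formed at $v=v_0$ ($v$ the advanced null coordinate). $\Omega_{BH}$ and $\kappa$ are the angular velocity and surface gravity of the black hole, and $\beta_{BH}=2\pi/\kappa$. Modes. Modes are labelled by $i=1,2,\dots$; $\omega_i$ and $m_i$ are the frequency and azimuthal angular momentum quantum number of mode $i$, and $x_i=\exp(-\pi(\omega_i-\Omega_{BH}m_i)/\kappa)$. $t_i,T_i$ are the transmission and $r_i,R_i$ the reflection coefficients of mode $i$ (on the Schwarzschild metric), satisfying $|t_i|^2+|r_i|^2=|T_i|^2+|R_i|^2=1$, $t_i=T_i$, $r_i=-R_i^*T_i/T_i^*$. Spaces. $\mathcal H_{\mathcal I^\pm}$ and $\mathcal H_{H^+}$ are the Hilbert spaces of positive-frequency mode functions at $\mathcal I^\pm$ and on $H^+$. $\mathcal F(\mathcal H)$ is the symmetric Fock space over $\mathcal H$, with vacuum $|0\rangle$ and creation operators $a^\dagger(\cdot)$; $(\cdots)_{sym}$ denotes symmetrization. ${}_i\rho\in\mathcal H_{\mathcal I^+}$ and ${}_i\sigma,{}_i\tau\in\mathcal H_{H^+}$ are orthonormal wave-packet modes; the ${}_i\rho$ generate $\mathcal H_{\mathcal I^+}$ and the ${}_i\sigma,{}_i\tau$ together generate $\mathcal H_{H^+}$. In $\mathcal H_{\mathcal I^+}\oplus\mathcal H_{H^+}$, ${}_i\gamma=T_i\,{}_i\sigma+R_i\,{}_i\rho$ and ${}_i\lambda=t_i\,{}_i\rho+r_i\,{}_i\sigma$.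 $A$ is the Bogoliubov transformation from $\mathcal H_{\mathcal I^+}\oplus\mathcal H_{H^+}$ to $\mathcal H_{\mathcal I^-}$, and $A\,{}_i\gamma$ is a wave packet peaked on $\mathcal I^-$ at $v>v_0$. $\mathcal F_{\mathcal I^-(v>v_0)}\subset\mathcal F(\mathcal H_{\mathcal I^-})$ is the subspace of states with no excitation of modes located at $v<v_0$. Number states. For sets of non-negative integers, $|\{n_{{}_i\gamma}\}\rangle=\prod_i\frac{1}{\sqrt{n_{{}_i\gamma}!}}(a^\dagger(A\,{}_i\gamma))^{n_{{}_i\gamma}}|0\rangle$, and the set of all these generates $\mathcal F_{\mathcal I^-(v>v_0)}$; $|\{n_{{}_i\rho}\}\rangle=\prod_i\frac{1}{\sqrt{n_{{}_i\rho}!}}(a^\dagger({}_i\rho))^{n_{{}_i\rho}}|0\rangle$, and the set of all these generates $\mathcal F(\mathcal H_{\mathcal I^+})$. S-matrix. $S$ describes the evolution from $\mathcal F_{\mathcal I^-(v>v_0)}$ to $\mathcal F(\mathcal H_{\mathcal I^+})\otimes\mathcal F(\mathcal H_{H^+})$ and is given by $S|0\rangle=N\sum_{n=0}^\infty\frac{\sqrt{(2n)!}}{2^n n!}(\otimes^n\epsilon)_{sym}$ and $S\,a^\dagger(A\,{}_i\gamma)\,S^{-1}=R_i\,a^\dagger({}_i\rho)+T_i\,a^\dagger({}_i\sigma)$, where $\epsilon=2\sum_i x_i({}_i\lambda\otimes{}_i\tau)_{sym}$ and $N$ is the normalization constant making $S|0\rangle$ a unit vector. Evolution map. $T(\rho)=\mathrm{Tr}_{H^+}[S\rho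 S^\dagger]$, where $\mathrm{Tr}_{H^+}$ is the partial trace over $\mathcal F(\mathcal H_{H^+})$. *)

theory Defs
  imports "HOL-Analysis.Analysis" "HOL-Combinatorics.Permutations"
begin

section \<open>Square-summable functions\<close>

(* Every complex Hilbert space is isometrically isomorphic to 'i ell2 for some index set 'i, so an
   arbitrary index type together with an arbitrary orthonormal basis of 'i ell2 renders a
   Hilbert space with a distinguished orthonormal basis. *)
definition square_summable :: "('i \<Rightarrow> complex) \<Rightarrow> bool" where
  "square_summable f \<longleftrightarrow> (\<lambda>i. (cmod (f i))\<^sup>2) summable_on UNIV"

lemma square_summable_zero: "square_summable (\<lambda>_. 0)"
  by (simp add: square_summable_def)

lemma square_summable_scale:
  assumes "square_summable f"
  shows "square_summable (\<lambda>i. c * f i)"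
proof -
  have "(\<lambda>i. (cmod c)\<^sup>2 * (cmod (f i))\<^sup>2) summable_on UNIV"
    using assms unfolding square_summable_def by (rule summable_on_cmult_right)
  then show ?thesis
    unfolding square_summable_def by (simp only: norm_mult power_mult_distrib)
qed

lemma square_summable_dominated:
  assumes "g summable_on UNIV" "\<And>i. (cmod (f i))\<^sup>2 \<le> g i"
  shows "square_summable f"
  unfolding square_summable_def by (rule summable_on_comparison_test[OF assms(1)]) (auto simp: assms(2))

lemma square_summable_add:
  assumes "square_summable f" "square_summable g"
  shows "square_summable (\<lambda>i. f i + g i)"
proof (rule square_summable_dominated)
  show "(\<lambda>i. 2 * (cmod (f i))\<^sup>2 + 2 * (cmod (g i))\<^sup>2) summable_on UNIV"
    using assms unfolding square_summable_def
    by (intro summable_on_add summable_on_cmult_right)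
  fix i
  have "(cmod (f i + g i))\<^sup>2 \<le> (cmod (f i) + cmod (g i))\<^sup>2"
    by (simp add: norm_triangle_ineq power_mono)
  also have "\<dots> \<le> 2 * (cmod (f i))\<^sup>2 + 2 * (cmod (g i))\<^sup>2"
    using zero_le_power2[of "cmod (f i) - cmod (g i)"] by (simp add: power2_eq_square algebra_simps)
  finally show "(cmod (f i + g i))\<^sup>2 \<le> 2 * (cmod (f i))\<^sup>2 + 2 * (cmod (g i))\<^sup>2" .
qed

lemma square_summable_single: "square_summable (\<lambda>i. if i = a then c else 0)"
proof -
  have "(\<lambda>i. (cmod (if i = a then c else 0))\<^sup>2) summable_on {a}"
    by simp
  then show ?thesis
    unfolding square_summable_def
    by (rule summable_on_cong_neutral[THEN iffD1, rotated -1]) auto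
qed

lemma square_summable_comp_inj:
  assumes "square_summable f" "inj_on h A" "\<And>i. i \<notin> A \<Longrightarrow> g i = 0" "\<And>i. i \<in> A \<Longrightarrow> g i = f (h i)"
  shows "square_summable g"
proof -
  have "(\<lambda>i. (cmod (f i))\<^sup>2) summable_on h ` A"
    using assms(1) summable_on_subset_banach unfolding square_summable_def by blast
  then have "(\<lambda>i. (cmod (f (h i)))\<^sup>2) summable_on A"
    by (simp add: summable_on_reindex[OF assms(2)] comp_def)
  then show ?thesis
    unfolding square_summable_def
    by (rule summable_on_cong_neutral[THEN iffD1, rotated -1]) (auto simp: assms(3,4))
qed

lemma summable_on_mult_square_summable:
  assumes "square_summable f" "square_summable g"
  shows "(\<lambda>i. cnj (f i) * g i) summable_on UNIV"
proof (rule abs_summable_summable, rule abs_summable_product)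
  show "(\<lambda>i. norm (cnj (f i) * cnj (f i))) summable_on UNIV" "(\<lambda>i. norm (g i * g i)) summable_on UNIV"
    using assms unfolding square_summable_def by (simp_all add: norm_mult power2_eq_square)
qed

typedef 'i ell2 = "{f :: 'i \<Rightarrow> complex. square_summable f}"
  morphisms coord Abs_ell2
  using square_summable_zero by blast

setup_lifting type_definition_ell2

lemma square_summable_coord [simp]: "square_summable (coord x)"
  using coord by blast

lift_definition scaleC :: "complex \<Rightarrow> 'i ell2 \<Rightarrow> 'i ell2" (infixr "*\<^sub>C" 75)
  is "\<lambda>c f i. c * f i"
  by (rule square_summable_scale)

(* Antilinear in the first argument. *)
lift_definition cinner :: "'i ell2 \<Rightarrow> 'i ell2 \<Rightarrow> complex"
  is "\<lambda>f g. \<Sum>\<^sub>\<infinity>i. cnj (f i) * g i" .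

lemma ell2_eq_iff: "x = y \<longleftrightarrow> (\<forall>i. coord x i = coord y i)"
  using coord_inject by (auto simp: fun_eq_iff)

lemma cinner_self: "cinner x x = complex_of_real (\<Sum>\<^sub>\<infinity>i. (cmod (coord x i))\<^sup>2)"
proof -
  have "((\<lambda>i. (cmod (coord x i))\<^sup>2) has_sum (\<Sum>\<^sub>\<infinity>i. (cmod (coord x i))\<^sup>2)) UNIV"
    using square_summable_coord[of x] unfolding square_summable_def by (rule has_sum_infsum)
  then have "((\<lambda>i. complex_of_real ((cmod (coord x i))\<^sup>2)) has_sum
      complex_of_real (\<Sum>\<^sub>\<infinity>i. (cmod (coord x i))\<^sup>2)) UNIV"
    by (simp only: has_sum_of_real_iff)
  then show ?thesis
    unfolding cinner.rep_eq complex_norm_square by (simp add: mult.commute infsumI)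
qed

lift_definition ket :: "'i \<Rightarrow> 'i ell2" is "\<lambda>a i. if i = a then 1 else 0"
  by (rule square_summable_single)

instantiation ell2 :: (type) real_inner
begin

lift_definition zero_ell2 :: "'a ell2" is "\<lambda>_. 0"
  by (rule square_summable_zero)

lift_definition plus_ell2 :: "'a ell2 \<Rightarrow> 'a ell2 \<Rightarrow> 'a ell2" is "\<lambda>f g i. f i + g i"
  by (rule square_summable_add)

lift_definition uminus_ell2 :: "'a ell2 \<Rightarrow> 'a ell2" is "\<lambda>f i. - f i"
  by (simp add: square_summable_def)

lift_definition minus_ell2 :: "'a ell2 \<Rightarrow> 'a ell2 \<Rightarrow> 'a ell2" is "\<lambda>f g i. f i - g i"
proof -
  fix f g :: "'a \<Rightarrow> complex"
  assume "square_summable f" "square_summable g"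
  then have "square_summable (\<lambda>i. f i + (- 1) * g i)"
    by (intro square_summable_add square_summable_scale)
  then show "square_summable (\<lambda>i. f i - g i)" by simp
qed

lift_definition scaleR_ell2 :: "real \<Rightarrow> 'a ell2 \<Rightarrow> 'a ell2" is "\<lambda>r f i. complex_of_real r * f i"
  by (rule square_summable_scale)

definition inner_ell2 :: "'a ell2 \<Rightarrow> 'a ell2 \<Rightarrow> real" where "inner_ell2 x y = Re (cinner x y)"
definition norm_ell2 :: "'a ell2 \<Rightarrow> real" where "norm_ell2 x = sqrt (Re (cinner x x))"
definition sgn_ell2 :: "'a ell2 \<Rightarrow> 'a ell2" where "sgn_ell2 x = inverse (norm x) *\<^sub>R x"
definition dist_ell2 :: "'a ell2 \<Rightarrow> 'a ell2 \<Rightarrow> real" where "dist_ell2 x y = norm (x - y)"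
definition uniformity_ell2 :: "('a ell2 \<times> 'a ell2) filter" where
  "uniformity_ell2 = (INF e\<in>{0<..}. principal {(x, y). dist x y < e})"
definition open_ell2 :: "'a ell2 set \<Rightarrow> bool" where
  "open_ell2 U \<longleftrightarrow> (\<forall>x\<in>U. \<forall>\<^sub>F (x', y) in uniformity. x' = x \<longrightarrow> y \<in> U)"

instance
proof
  fix x y z :: "'a ell2" and a b :: real
  show "x + y + z = x + (y + z)" "x + y = y + x" "0 + x = x" "- x + x = 0" "x - y = x + - y"
    "a *\<^sub>R (x + y) = a *\<^sub>R x + a *\<^sub>R y" "(a + b) *\<^sub>R x = a *\<^sub>R x + b *\<^sub>R x"
    "a *\<^sub>R b *\<^sub>R x = (a * b) *\<^sub>R x" "1 *\<^sub>R x = x"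
    by (simp_all add: ell2_eq_iff zero_ell2.rep_eq plus_ell2.rep_eq uminus_ell2.rep_eq
        minus_ell2.rep_eq scaleR_ell2.rep_eq algebra_simps)
  show "sgn x = inverse (norm x) *\<^sub>R x" "dist x y = norm (x - y)" "norm x = sqrt (inner x x)"
    by (simp_all add: sgn_ell2_def dist_ell2_def norm_ell2_def inner_ell2_def)
  show "uniformity = (INF e\<in>{0<..}. principal {(x::'a ell2, y). dist x y < e})"
    by (rule uniformity_ell2_def)
  show "open U \<longleftrightarrow> (\<forall>x\<in>U. \<forall>\<^sub>F (x', y) in uniformity. x' = x \<longrightarrow> y \<in> U)" for U :: "'a ell2 set"
    by (rule open_ell2_def)
  have "cinner y x = cnj (cinner x y)"
    unfolding cinner.rep_eq infsum_cnj[symmetric] by (simp add: mult.commute)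
  then show "inner x y = inner y x"
    by (simp add: inner_ell2_def)
  have "cinner (x + y) z = cinner x z + cinner y z"
    unfolding cinner.rep_eq plus_ell2.rep_eq
    by (simp add: distrib_right infsum_add summable_on_mult_square_summable)
  then show "inner (x + y) z = inner x z + inner y z"
    by (simp add: inner_ell2_def)
  have "cinner (a *\<^sub>R x) y = a * cinner x y"
    unfolding cinner.rep_eq scaleR_ell2.rep_eq by (simp add: mult.assoc infsum_cmult_right')
  then show "inner (a *\<^sub>R x) y = a * inner x y"
    by (simp add: inner_ell2_def)
  have sq: "cinner x x = complex_of_real (\<Sum>\<^sub>\<infinity>i. (cmod (coord x i))\<^sup>2)"
    by (rule cinner_self)
  show "0 \<le> inner x x"
    by (simp add: inner_ell2_def sq infsum_nonneg)
  show "inner x x = 0 \<longleftrightarrow> x = 0"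
  proof
    assume "inner x x = 0"
    then have "(\<Sum>\<^sub>\<infinity>i. (cmod (coord x i))\<^sup>2) = 0"
      by (simp add: inner_ell2_def sq)
    moreover have "(\<lambda>i. (cmod (coord x i))\<^sup>2) summable_on UNIV"
      using square_summable_coord[of x] unfolding square_summable_def .
    ultimately have "(cmod (coord x i))\<^sup>2 = 0" for i
      using nonneg_infsum_le_0D[of "\<lambda>i. (cmod (coord x i))\<^sup>2" UNIV i] by simp
    then show "x = 0"
      by (simp add: ell2_eq_iff zero_ell2.rep_eq)
  qed (simp add: inner_ell2_def cinner.rep_eq zero_ell2.rep_eq)
qed

end

lemma norm_ell2_power2: "(norm x)\<^sup>2 = (\<Sum>\<^sub>\<infinity>i. (cmod (coord x i))\<^sup>2)" for x :: "'a ell2"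
  by (simp add: norm_ell2_def cinner_self infsum_nonneg)

lemma sum_coord_le_norm: "finite F \<Longrightarrow> (\<Sum>i\<in>F. (cmod (coord x i))\<^sup>2) \<le> (norm x)\<^sup>2" for x :: "'a ell2"
  unfolding norm_ell2_power2
  by (rule finite_sum_le_infsum) (use square_summable_coord[of x] in \<open>auto simp: square_summable_def\<close>)

instance ell2 :: (type) complete_space
proof
  fix X :: "nat \<Rightarrow> 'a ell2"
  assume X: "Cauchy X"
  have coord_le: "cmod (coord x i) \<le> norm x" for x :: "'a ell2" and i
    using sum_coord_le_norm[of "{i}" x] by (simp add: power2_le_iff_abs_le)
  have "Cauchy (\<lambda>n. coord (X n) i)" for i
  proof (rule metric_CauchyI)
    fix e :: real assume "e > 0"
    then obtain M where M: "dist (X m) (X n) < e" if "m \<ge> M" "n \<ge> M" for m n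
      using metric_CauchyD[OF X] by blast
    show "\<exists>M. \<forall>m\<ge>M. \<forall>n\<ge>M. dist (coord (X m) i) (coord (X n) i) < e"
      using M coord_le[of "X _ - X _" i]
      by (intro exI[of _ M]) (simp add: dist_norm minus_ell2.rep_eq, meson le_less_trans)
  qed
  then have "\<exists>l. (\<lambda>n. coord (X n) i) \<longlonglongrightarrow> l" for i
    using Cauchy_convergent convergent_def by blast
  then obtain f where f: "(\<lambda>n. coord (X n) i) \<longlonglongrightarrow> f i" for i
    by metis
  have close: "(\<Sum>i\<in>F. (cmod (f i - coord (X n) i))\<^sup>2) \<le> e\<^sup>2"
    if "\<And>m. m \<ge> M \<Longrightarrow> dist (X m) (X n) < e" "finite F" for F n M e
  proof (rule LIMSEQ_le_const2)
    show "(\<lambda>m. \<Sum>i\<in>F. (cmod (coord (X m) i - coord (X n) i))\<^sup>2)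
        \<longlonglongrightarrow> (\<Sum>i\<in>F. (cmod (f i - coord (X n) i))\<^sup>2)"
      by (intro tendsto_intros f)
    have "(\<Sum>i\<in>F. (cmod (coord (X m) i - coord (X n) i))\<^sup>2) \<le> e\<^sup>2" if "m \<ge> M" for m
      using sum_coord_le_norm[OF \<open>finite F\<close>, of "X m - X n"] that(1)[THEN \<open>\<And>m. m \<ge> M \<Longrightarrow> dist (X m) (X n) < e\<close>]
      by (smt (verit) dist_norm minus_ell2.rep_eq norm_ge_zero power_mono sum.cong)
    then show "\<exists>M. \<forall>m\<ge>M. (\<Sum>i\<in>F. (cmod (coord (X m) i - coord (X n) i))\<^sup>2) \<le> e\<^sup>2"
      by blast
  qed
  have summ: "square_summable (\<lambda>i. f i - coord (X n) i)"
    if "\<And>m. m \<ge> M \<Longrightarrow> dist (X m) (X n) < e" for n M e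
    unfolding square_summable_def
    by (rule nonneg_bdd_above_summable_on) (use close[OF that] in \<open>auto intro!: bdd_aboveI2\<close>)
  obtain M1 where M1: "dist (X m) (X n) < 1" if "m \<ge> M1" "n \<ge> M1" for m n
    using metric_CauchyD[OF X, of 1] by auto
  have "square_summable (\<lambda>i. (f i - coord (X M1) i) + coord (X M1) i)"
    by (intro square_summable_add summ[of M1 _ 1]) (use M1 in auto)
  then have sf: "square_summable f"
    by simp
  define L where "L = Abs_ell2 f"
  have L: "coord L = f"
    using sf by (simp add: L_def Abs_ell2_inverse)
  have "X \<longlonglongrightarrow> L"
  proof (rule metric_LIMSEQ_I)
    fix r :: real assume r: "r > 0"
    then obtain M where M: "dist (X m) (X n) < r / 2" if "m \<ge> M" "n \<ge> M" for m n
      using metric_CauchyD[OF X, of "r / 2"] by auto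
    have "dist (X n) L < r" if "n \<ge> M" for n
    proof -
      have *: "\<And>m. m \<ge> M \<Longrightarrow> dist (X m) (X n) < r / 2"
        using M that by blast
      have "(norm (L - X n))\<^sup>2 \<le> (r / 2)\<^sup>2"
        unfolding norm_ell2_power2 minus_ell2.rep_eq L
        by (rule infsum_le_finite_sums)
           (use summ[OF *] close[OF *] in \<open>auto simp: square_summable_def\<close>)
      then have "norm (L - X n) \<le> r / 2"
        using r by (simp add: power2_le_iff_abs_le)
      then show ?thesis
        using r by (simp add: dist_norm norm_minus_commute)
    qed
    then show "\<exists>no. \<forall>n\<ge>no. dist (X n) L < r"
      by blast
  qed
  then show "convergent X"
    by (auto simp: convergent_def)
qed

global_interpretation complex_ell2: vector_space "scaleC :: complex \<Rightarrow> 'i ell2 \<Rightarrow> 'i ell2"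
  by unfold_locales (simp_all add: ell2_eq_iff plus_ell2.rep_eq scaleC.rep_eq algebra_simps)

definition closed_cspan :: "'i ell2 set \<Rightarrow> 'i ell2 set" where
  "closed_cspan B = closure (complex_ell2.span B)"

definition orthonormal_family :: "('j \<Rightarrow> 'i ell2) \<Rightarrow> bool" where
  "orthonormal_family v \<longleftrightarrow> (\<forall>j k. cinner (v j) (v k) = (if j = k then 1 else 0))"

definition orthonormal_basis :: "('j \<Rightarrow> 'i ell2) \<Rightarrow> bool" where
  "orthonormal_basis v \<longleftrightarrow> orthonormal_family v \<and> closed_cspan (range v) = UNIV"

definition clinear_on :: "'i ell2 set \<Rightarrow> ('i ell2 \<Rightarrow> 'j ell2) \<Rightarrow> bool" where
  "clinear_on V f \<longleftrightarrow> (\<forall>x\<in>V. \<forall>y\<in>V. f (x + y) = f x + f y) \<and> (\<forall>c. \<forall>x\<in>V. f (c *\<^sub>C x) = c *\<^sub>C f x)"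

(* The adjoint of a bounded operator defined on a closed subspace V, as an operator into V. *)
definition adjoint_on :: "'i ell2 set \<Rightarrow> ('i ell2 \<Rightarrow> 'j ell2) \<Rightarrow> 'j ell2 \<Rightarrow> 'i ell2" where
  "adjoint_on V f y = (THE x. x \<in> V \<and> (\<forall>z\<in>V. cinner x z = cinner y (f z)))"

section \<open>Direct sums, tensor products and the partial trace\<close>

lift_definition direct_sum :: "'a ell2 \<Rightarrow> 'b ell2 \<Rightarrow> ('a + 'b) ell2"
  is "\<lambda>f g. case_sum f g"
proof -
  fix f :: "'a \<Rightarrow> complex" and g :: "'b \<Rightarrow> complex"
  assume fg: "square_summable f" "square_summable g"
  from fg(1) have "square_summable (\<lambda>s. case s of Inl a \<Rightarrow> f a | Inr b \<Rightarrow> 0)"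
    by (rule square_summable_comp_inj[of f projl "range Inl"])
       (auto intro!: inj_onI split: sum.splits)
  moreover from fg(2)
  have "square_summable (\<lambda>s. case s of Inl a \<Rightarrow> 0 | Inr b \<Rightarrow> g b)"
    by (rule square_summable_comp_inj[of g projr "range Inr"])
       (auto intro!: inj_onI split: sum.splits)
  ultimately have "square_summable (\<lambda>s. (case s of Inl a \<Rightarrow> f a | Inr b \<Rightarrow> 0)
      + (case s of Inl a \<Rightarrow> 0 | Inr b \<Rightarrow> g b))"
    by (rule square_summable_add)
  also have "(\<lambda>s. (case s of Inl a \<Rightarrow> f a | Inr b \<Rightarrow> 0)
      + (case s of Inl a \<Rightarrow> 0 | Inr b \<Rightarrow> g b)) = case_sum f g"
    by (auto split: sum.splits)
  finally show "square_summable (case_sum f g)" .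
qed

lemma square_summable_times:
  assumes "square_summable f" "square_summable g"
  shows "square_summable (\<lambda>(i, j). f i * g j)"
proof -
  let ?G = "\<Sum>\<^sub>\<infinity>j. (cmod (g j))\<^sup>2"
  have "(\<lambda>p. (cmod ((\<lambda>(i, j). f i * g j) p))\<^sup>2) summable_on Sigma UNIV (\<lambda>_. UNIV)"
  proof (rule summable_on_SigmaI[where g = "\<lambda>i. (cmod (f i))\<^sup>2 * ?G"])
    show "((\<lambda>j. (cmod ((\<lambda>(i, j). f i * g j) (i, j)))\<^sup>2) has_sum (cmod (f i))\<^sup>2 * ?G) UNIV" for i
      using has_sum_cmult_right[OF has_sum_infsum, of "\<lambda>j. (cmod (g j))\<^sup>2" UNIV "(cmod (f i))\<^sup>2"] assms(2)
      by (simp add: square_summable_def norm_mult power_mult_distrib)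
    show "(\<lambda>i. (cmod (f i))\<^sup>2 * ?G) summable_on UNIV"
      using assms(1) by (auto simp: square_summable_def intro: summable_on_cmult_left)
  qed auto
  then show ?thesis by (simp add: square_summable_def)
qed

lift_definition tensor_pair :: "'a ell2 \<Rightarrow> 'b ell2 \<Rightarrow> ('a \<times> 'b) ell2"
  is "\<lambda>f g (a, b). f a * g b"
  by (rule square_summable_times)

lift_definition slice_snd :: "'b \<Rightarrow> ('a \<times> 'b) ell2 \<Rightarrow> 'a ell2" is "\<lambda>b f a. f (a, b)"
proof -
  fix b :: 'b and f :: "'a \<times> 'b \<Rightarrow> complex"
  assume "square_summable f"
  then show "square_summable (\<lambda>a. f (a, b))"
    by (rule square_summable_comp_inj[of f "\<lambda>a. (a, b)" UNIV]) (auto intro: inj_onI)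
qed

(* slice_snd b contracts the second tensor factor with the basis bra of b, so this is the sum over
   an orthonormal basis of the second factor. *)
definition partial_trace_snd :: "(('a \<times> 'b) ell2 \<Rightarrow> ('a \<times> 'b) ell2) \<Rightarrow> 'a ell2 \<Rightarrow> 'a ell2" where
  "partial_trace_snd Q \<psi> = (\<Sum>\<^sub>\<infinity>b. slice_snd b (Q (tensor_pair \<psi> (ket b))))"

section \<open>Fock space\<close>

(* The full Fock space, i.e. the Hilbert sum over n of the n-th tensor powers of 'i ell2, is
   'i list ell2: the value at a list of length n is a coefficient of the n-particle component.
   The symmetric Fock space is the closed subspace of vectors with symmetric components.
   Operators on the symmetric Fock space are represented on 'i list ell2 and vanish on its
   orthogonal complement, so that traces may be taken over the basis of all lists. *)

lemma square_summable_symmetrize: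
  assumes "square_summable f"
  shows "square_summable
    (\<lambda>l. (\<Sum>p | p permutes {..<length l}. f (permute_list p l)) / fact (length l))"
proof (rule square_summable_dominated)
  let ?P = "\<lambda>l::'a list. {p. p permutes {..<length l}}"
  let ?h = "\<lambda>(l, p). (cmod (f l))\<^sup>2 / fact (length l)"
  let ?k = "\<lambda>(l, p). (cmod (f (permute_list p l)))\<^sup>2 / fact (length l)"
  have fin: "finite (?P l)" and card: "card (?P l) = fact (length l)" for l
    by (auto simp: finite_permutations card_permutations)
  have "?h summable_on Sigma UNIV ?P"
  proof (rule summable_on_SigmaI)
    show "((\<lambda>p. ?h (l, p)) has_sum (cmod (f l))\<^sup>2) (?P l)" for l
      using has_sum_finite[OF fin, of "\<lambda>p. ?h (l, p)" l] by (simp add: card)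
  qed (use assms in \<open>auto simp: square_summable_def\<close>)
  moreover have "bij_betw (\<lambda>(l, p). (permute_list p l, p)) (Sigma UNIV ?P) (Sigma UNIV ?P)"
    by (rule bij_betw_byWitness[where f' = "\<lambda>(l, p). (permute_list (inv p) l, p)"])
       (auto simp: permutes_inv permutes_inv_o simp flip: permute_list_compose)
  ultimately have "(\<lambda>x. ?h ((\<lambda>(l, p). (permute_list p l, p)) x)) summable_on Sigma UNIV ?P"
    by (subst summable_on_reindex_bij_betw)
  then have "?k summable_on Sigma UNIV ?P"
    by (rule summable_on_cong[THEN iffD1, rotated]) auto
  from summable_on_SigmaD[OF this summable_on_finite[OF fin]]
  show "(\<lambda>l. (\<Sum>p\<in>?P l. (cmod (f (permute_list p l)))\<^sup>2) / fact (length l)) summable_on UNIV"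
    by (simp add: fin sum_divide_distrib)
  fix l :: "'a list"
  let ?s = "\<Sum>p\<in>?P l. cmod (f (permute_list p l))"
  have "(cmod (\<Sum>p\<in>?P l. f (permute_list p l)))\<^sup>2 \<le> ?s\<^sup>2"
    by (intro power_mono sum_norm_le) auto
  also have "\<dots> \<le> (\<Sum>p\<in>?P l. (cmod (f (permute_list p l)))\<^sup>2) * fact (length l)"
    using sum_squared_le_sum_of_squares[of "\<lambda>p. cmod (f (permute_list p l))" "?P l"]
    by (simp add: card mult.commute)
  finally show "(cmod ((\<Sum>p\<in>?P l. f (permute_list p l)) / fact (length l)))\<^sup>2
      \<le> (\<Sum>p\<in>?P l. (cmod (f (permute_list p l)))\<^sup>2) / fact (length l)"
    by (simp add: norm_divide power_divide field_simps power2_eq_square)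
qed

lift_definition symmetrize :: "'i list ell2 \<Rightarrow> 'i list ell2"
  is "\<lambda>f l. (\<Sum>p | p permutes {..<length l}. f (permute_list p l)) / fact (length l)"
  by (rule square_summable_symmetrize)

definition fock_space :: "'i list ell2 set" where
  "fock_space = {\<Psi>. symmetrize \<Psi> = \<Psi>}"

definition vacuum :: "'i list ell2" where
  "vacuum = ket []"

lift_definition one_particle :: "'i ell2 \<Rightarrow> 'i list ell2"
  is "\<lambda>f l. if length l = 1 then f (hd l) else 0"
proof -
  fix f :: "'i \<Rightarrow> complex"
  assume "square_summable f"
  then show "square_summable (\<lambda>l. if length l = 1 then f (hd l) else 0)"
    by (rule square_summable_comp_inj[of f hd "{l. length l = 1}"])
       (auto intro!: inj_onI simp: length_Suc_conv)
qed

(* The unsymmetrized tensor product of the p-particle component of the first argument with the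
   second argument. *)
lift_definition tensor_product :: "nat \<Rightarrow> 'i list ell2 \<Rightarrow> 'i list ell2 \<Rightarrow> 'i list ell2"
  is "\<lambda>p f g l. if p \<le> length l then f (take p l) * g (drop p l) else 0"
proof -
  fix p and f g :: "'i list \<Rightarrow> complex"
  assume "square_summable f" "square_summable g"
  then have "square_summable (\<lambda>(k, l). f k * g l)"
    by (rule square_summable_times)
  moreover have "inj_on (\<lambda>l. (take p l, drop p l)) {l::'i list. p \<le> length l}"
    by (rule inj_onI) (metis append_take_drop_id prod.inject)
  ultimately show "square_summable (\<lambda>l. if p \<le> length l then f (take p l) * g (drop p l) else 0)"
    by (rule square_summable_comp_inj) auto
qed

primrec two_particle_power :: "'i list ell2 \<Rightarrow> nat \<Rightarrow> 'i list ell2" where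
  "two_particle_power \<epsilon> 0 = vacuum"
| "two_particle_power \<epsilon> (Suc n) = tensor_product 2 \<epsilon> (two_particle_power \<epsilon> n)"

(* On an n-particle vector, creation of \<phi> is sqrt (n + 1) times the symmetrized tensor product
   with \<phi>. It is unbounded; creation \<phi> \<Psi> is meaningful only for \<Psi> in creation_domain \<phi>. *)
definition creation_coord :: "'i ell2 \<Rightarrow> 'i list ell2 \<Rightarrow> 'i list \<Rightarrow> complex" where
  "creation_coord \<phi> \<Psi> l =
     sqrt (length l) * coord (symmetrize (tensor_product 1 (one_particle \<phi>) \<Psi>)) l"

definition creation_domain :: "'i ell2 \<Rightarrow> 'i list ell2 set" where
  "creation_domain \<phi> = {\<Psi> \<in> fock_space. square_summable (creation_coord \<phi> \<Psi>)}"

definition creation :: "'i ell2 \<Rightarrow> 'i list ell2 \<Rightarrow> 'i list ell2" where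
  "creation \<phi> \<Psi> = Abs_ell2 (creation_coord \<phi> \<Psi>)"

(* Only finitely many excited modes: otherwise the product of creation operators is undefined. *)
definition occupation_numbers :: "(nat \<Rightarrow> nat) set" where
  "occupation_numbers = {n. finite {i. n i \<noteq> 0}}"

(* The creation operators commute, so the increasing order of the modes is immaterial. *)
definition number_state :: "(nat \<Rightarrow> 'i ell2) \<Rightarrow> (nat \<Rightarrow> nat) \<Rightarrow> 'i list ell2" where
  "number_state \<phi> n =
     foldr (\<lambda>i \<Psi>. (1 / sqrt (fact (n i))) *\<^sub>C (creation (\<phi> i) ^^ n i) \<Psi>)
       (sorted_list_of_set {i. n i \<noteq> 0}) vacuum"

definition lefts :: "('a + 'b) list \<Rightarrow> 'a list" where
  "lefts l = map projl (filter isl l)"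

definition rights :: "('a + 'b) list \<Rightarrow> 'b list" where
  "rights l = map projr (filter (\<lambda>s. \<not> isl s) l)"

lemma finite_lefts_rights:
  "finite {l. lefts l = xs \<and> rights l = ys}"
  "card {l. lefts l = xs \<and> rights l = ys} \<le> (length xs + length ys) choose length xs"
proof -
  have sub: "{l. lefts l = xs \<and> rights l = ys} \<subseteq> shuffles (map Inl xs) (map Inr ys)"
  proof safe
    fix l :: "('a + 'b) list"
    have "map Inl (lefts l) = filter isl l" "map Inr (rights l) = filter (\<lambda>s. \<not> isl s) l"
      by (auto simp: lefts_def rights_def o_def intro!: map_idI)
    then show "l \<in> shuffles (map Inl (lefts l)) (map Inr (rights l))"
      by (metis partition_in_shuffles)
  qed
  then show "finite {l. lefts l = xs \<and> rights l = ys}"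
    using finite_shuffles finite_subset by blast
  have "card {l. lefts l = xs \<and> rights l = ys} \<le> card (shuffles (map Inl xs) (map Inr ys))"
    using sub finite_shuffles card_mono by blast
  also have "\<dots> = (length xs + length ys) choose length xs"
    by (subst card_disjoint_shuffles) auto
  finally show "card {l. lefts l = xs \<and> rights l = ys} \<le> (length xs + length ys) choose length xs" .
qed

lemma length_lefts_rights: "length (lefts l) + length (rights l) = length l"
  by (simp add: lefts_def rights_def sum_length_filter_compl)

lemma square_summable_merge:
  fixes f :: "'a list \<times> 'b list \<Rightarrow> complex"
  assumes "square_summable f"
  shows "square_summable
    (\<lambda>l. f (lefts l, rights l) / complex_of_real (sqrt (length l choose length (lefts l))))"
proof -
  let ?C = "\<lambda>(xs::'a list) (ys::'b list). (length xs + length ys) choose length xs"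
  let ?L = "\<lambda>p::'a list \<times> 'b list. {l. lefts l = fst p \<and> rights l = snd p}"
  let ?g = "\<lambda>p. (cmod (f p))\<^sup>2 / ?C (fst p) (snd p)"
  have "(\<lambda>(p, l). ?g p) summable_on Sigma UNIV ?L"
  proof (rule summable_on_SigmaI)
    show "((\<lambda>l. (\<lambda>(p, l). ?g p) (p, l)) has_sum real (card (?L p)) * ?g p) (?L p)" for p
      using has_sum_finite[OF finite_lefts_rights(1), of "\<lambda>_. ?g p" "fst p" "snd p"] by simp
    show "(\<lambda>p. real (card (?L p)) * ?g p) summable_on UNIV"
    proof (rule summable_on_comparison_test)
      show "(\<lambda>p. (cmod (f p))\<^sup>2) summable_on UNIV"
        using assms by (simp add: square_summable_def)
      fix p
      have "real (card (?L p)) \<le> real (?C (fst p) (snd p))"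
        using finite_lefts_rights(2)[of "fst p" "snd p"] of_nat_le_iff by blast
      moreover have "?C (fst p) (snd p) > 0"
        by simp
      ultimately show "real (card (?L p)) * ?g p \<le> (cmod (f p))\<^sup>2"
        by (simp add: divide_simps mult_left_mono mult.commute del: zero_less_binomial_iff)
    qed simp
  qed auto
  moreover have "bij_betw (\<lambda>l. ((lefts l, rights l), l)) UNIV (Sigma UNIV ?L)"
    by (rule bij_betw_byWitness[where f' = snd]) auto
  ultimately have "(\<lambda>l. (\<lambda>(p, l). ?g p) ((lefts l, rights l), l)) summable_on UNIV"
    by (subst summable_on_reindex_bij_betw)
  then show ?thesis
    by (simp add: square_summable_def norm_divide power_divide length_lefts_rights)
qed

(* The canonical isometric identification of the tensor product of two Fock spaces with the Fock
   space over the direct sum: for an n-particle and an m-particle vector it is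
   sqrt ((n + m) choose n) times the symmetrized tensor product. It takes vacuum times vacuum to
   the vacuum, and creation \<phi> on the first (second) factor to creation (direct_sum \<phi> 0)
   (creation (direct_sum 0 \<phi>)). *)
lift_definition fock_merge :: "('a list \<times> 'b list) ell2 \<Rightarrow> ('a + 'b) list ell2"
  is "\<lambda>f l. f (lefts l, rights l) / complex_of_real (sqrt (length l choose length (lefts l)))"
  by (rule square_summable_merge)

section \<open>Thermal states and the evolution map\<close>

definition boltzmann ::
  "real \<Rightarrow> real \<Rightarrow> (nat \<Rightarrow> real) \<Rightarrow> (nat \<Rightarrow> int) \<Rightarrow> (nat \<Rightarrow> nat) \<Rightarrow> real" where
  "boltzmann \<beta> \<Omega> \<omega> m n = exp (- \<beta> * (\<Sum>i | n i \<noteq> 0. n i * (\<omega> i - \<Omega> * m i)))"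

definition partition_function :: "real \<Rightarrow> real \<Rightarrow> (nat \<Rightarrow> real) \<Rightarrow> (nat \<Rightarrow> int) \<Rightarrow> real" where
  "partition_function \<beta> \<Omega> \<omega> m = (\<Sum>\<^sub>\<infinity>j\<in>occupation_numbers. boltzmann \<beta> \<Omega> \<omega> m j)"

(* The operator series is taken in the strong sense, i.e. applied to a vector. *)
definition thermal_state ::
  "real \<Rightarrow> real \<Rightarrow> (nat \<Rightarrow> real) \<Rightarrow> (nat \<Rightarrow> int) \<Rightarrow> (nat \<Rightarrow> 'i ell2) \<Rightarrow> 'i list ell2 \<Rightarrow> 'i list ell2"
where
  "thermal_state \<beta> \<Omega> \<omega> m \<phi> \<Psi> =
     (1 / partition_function \<beta> \<Omega> \<omega> m) *\<^sub>C
     (\<Sum>\<^sub>\<infinity>n\<in>occupation_numbers.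
        (boltzmann \<beta> \<Omega> \<omega> m n * cinner (number_state \<phi> n) \<Psi>) *\<^sub>C number_state \<phi> n)"

(* The map taking D to the partial trace of S D S*, for S defined on the closed subspace V. *)
definition evolution_map ::
  "'c ell2 set \<Rightarrow> ('c ell2 \<Rightarrow> ('a \<times> 'b) ell2) \<Rightarrow> ('c ell2 \<Rightarrow> 'c ell2) \<Rightarrow> 'a ell2 \<Rightarrow> 'a ell2" where
  "evolution_map V S D = partial_trace_snd (\<lambda>\<Phi>. S (D (adjoint_on V S \<Phi>)))"

end

theory Submission
  imports Defs
begin

text \<open>
  For the out-state of a number state with occupation numbers n, let A n l denote its matrix element
  with the annihilation operators of the out-modes in the list l. The equation for S on the vacuum
  and the intertwining relation become relations for removing the first entry of l: removing a mode
  \<open>\<gamma>\<close> lowers n, whereas removing \<open>\<Lambda>\<close> creates the partner \<open>\<tau>\<close> with weight x, and conversely.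

  Cyclicity of the partial trace over the horizon modes turns these relations into the KMS condition
  at weight x^2 for the reduced state: for both \<open>\<gamma>\<close> and \<open>\<Lambda>\<close>, hence (the pair being a unitary
  rotation of \<open>\<rho>\<close> and \<open>\<sigma>\<close>) also for \<open>\<rho>\<close>, an annihilation operator is moved through the state at
  the cost of a factor x^2. The KMS condition determines an operator on the Fock space at infinity up
  to a scalar and holds for the thermal state, and the scalar is one because S is an isometry and
  therefore the traces agree.
\<close>

section \<open>Hilbert space preliminaries\<close>

text \<open>Creation operators are unbounded, and annihilated vectors are not formed as elements of
  Fock space. Operators are therefore replaced by amplitudes on lists of modes, and cyclicity of the
  trace becomes a rearrangement of sums over lists. Its absolute convergence rests on the domain
  conditions for the out-states, since membership in the domain of a creation operator also bounds
  the corresponding annihilation. The KMS relation for \<open>\<Lambda>\<close> holds for each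
  number state separately. The one for \<open>\<gamma>\<close> appears only after summation over n,
  the shift of n by one quantum costing x^2, which is the Boltzmann factor of that quantum because
  beta is 2 pi / kappa. Both relations contain a contribution of \<open>\<sigma>\<close> whose
  weighted sum is not known to converge, so the elimination works with a multiple of it that does
  converge. The in-modes \<open>A (\<gamma> i)\<close> are not assumed orthonormal: orthonormality
  is proved for the out-states and pulled back along S.\<close>

instance ell2 :: (type) banach ..

lemma cinner_has_sum: "((\<lambda>i. cnj (coord x i) * coord y i) has_sum cinner x y) UNIV"
  unfolding cinner.rep_eq
  by (rule has_sum_infsum) (simp add: summable_on_mult_square_summable)

lemma cinner_commute: "cinner y x = cnj (cinner x y)"
  unfolding cinner.rep_eq infsum_cnj[symmetric] by (simp add: mult.commute)

lemma cinner_add_right: "cinner x (y + z) = cinner x y + cinner x z"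
  unfolding cinner.rep_eq plus_ell2.rep_eq
  by (simp add: distrib_left infsum_add summable_on_mult_square_summable)

lemma cinner_add_left: "cinner (x + y) z = cinner x z + cinner y z"
  unfolding cinner.rep_eq plus_ell2.rep_eq
  by (simp add: distrib_right infsum_add summable_on_mult_square_summable)

lemma cinner_scaleC_right: "cinner x (c *\<^sub>C y) = c * cinner x y"
  unfolding cinner.rep_eq scaleC.rep_eq by (simp only: mult.left_commute[of _ c] infsum_cmult_right')

lemma cinner_scaleC_left: "cinner (c *\<^sub>C x) y = cnj c * cinner x y"
  unfolding cinner.rep_eq scaleC.rep_eq by (simp add: mult.assoc infsum_cmult_right')

lemma cinner_zero_right [simp]: "cinner x 0 = 0"
  by (simp add: cinner.rep_eq zero_ell2.rep_eq)

lemma cinner_zero_left [simp]: "cinner 0 x = 0"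
  by (simp add: cinner.rep_eq zero_ell2.rep_eq)

lemma cinner_sum_right: "cinner x (\<Sum>j\<in>A. f j) = (\<Sum>j\<in>A. cinner x (f j))"
  by (induction A rule: infinite_finite_induct) (simp_all add: cinner_add_right)

lemma cinner_sum_left: "cinner (\<Sum>j\<in>A. f j) x = (\<Sum>j\<in>A. cinner (f j) x)"
  by (induction A rule: infinite_finite_induct) (simp_all add: cinner_add_left)

lemma scaleR_eq_scaleC: "a *\<^sub>R x = complex_of_real a *\<^sub>C x" for x :: "'a ell2"
  by (simp add: ell2_eq_iff scaleR_ell2.rep_eq scaleC.rep_eq)

lemma minus_eq_scaleC: "x - y = x + (- 1) *\<^sub>C y" for x :: "'a ell2"
  by (simp add: ell2_eq_iff minus_ell2.rep_eq plus_ell2.rep_eq scaleC.rep_eq)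

lemma cinner_minus_right: "cinner x (y - z) = cinner x y - cinner x z"
  unfolding minus_eq_scaleC cinner_add_right cinner_scaleC_right by simp

lemma cinner_minus_left: "cinner (x - y) z = cinner x z - cinner y z"
  unfolding minus_eq_scaleC cinner_add_left cinner_scaleC_left by simp

lemma cinner_self_norm: "cinner x x = complex_of_real ((norm x)\<^sup>2)"
  by (simp add: norm_ell2_power2 cinner_self)

lemma norm_eq_1I: "cinner x x = 1 \<Longrightarrow> norm x = 1"
  by (simp add: norm_ell2_def)

lemma cnj_mult_self: "cnj z * z = complex_of_real ((cmod z)\<^sup>2)"
  using complex_norm_square[of z] by (simp add: mult.commute)

lemma norm_scaleC: "norm (c *\<^sub>C x) = cmod c * norm x"
proof -
  have "complex_of_real ((norm (c *\<^sub>C x))\<^sup>2) = complex_of_real ((cmod c * norm x)\<^sup>2)"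
    unfolding cinner_self_norm[symmetric] cinner_scaleC_left cinner_scaleC_right
    by (simp only: power_mult_distrib of_real_mult cnj_mult_self[symmetric] cinner_self_norm mult_ac)
  then show ?thesis
    unfolding of_real_eq_iff by (rule power2_eq_imp_eq) simp_all
qed

lemma cinner_Cauchy_Schwarz: "cmod (cinner x y) \<le> norm x * norm y"
proof (cases "cinner x y = 0")
  case False
  define c where "c = cnj (sgn (cinner x y))"
  have c: "c * cinner x y = cmod (cinner x y)"
    unfolding c_def sgn_eq using False by (simp add: cnj_mult_self power2_eq_square)
  have "cmod (cinner x y) = Re (cinner x (c *\<^sub>C y))"
    by (simp add: cinner_scaleC_right c)
  also have "\<dots> = inner x (c *\<^sub>C y)"
    by (simp add: inner_ell2_def)
  also have "\<dots> \<le> norm x * norm (c *\<^sub>C y)"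
    by (rule norm_cauchy_schwarz)
  also have "\<dots> = norm x * norm y"
    using False by (simp add: norm_scaleC c_def norm_sgn)
  finally show ?thesis .
qed auto

lemma bounded_linear_cinner_right: "bounded_linear (cinner x)"
proof (rule bounded_linear_intro[where K = "norm x"])
  show "norm (cinner x y) \<le> norm y * norm x" for y
    using cinner_Cauchy_Schwarz[of x y] by (simp only: mult.commute)
qed (simp_all add: cinner_add_right scaleR_eq_scaleC cinner_scaleC_right scaleR_conv_of_real)

lemma bounded_linear_cinner_left: "bounded_linear (\<lambda>x. cinner x y)"
  by (rule bounded_linear_intro[where K = "norm y"])
     (simp_all add: cinner_add_left scaleR_eq_scaleC cinner_scaleC_left cinner_Cauchy_Schwarz scaleR_conv_of_real)

lemma bounded_linear_scaleC: "bounded_linear (\<lambda>x. c *\<^sub>C x)"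
  by (rule bounded_linear_intro[where K = "cmod c"])
     (simp_all add: complex_ell2.scale_right_distrib scaleR_eq_scaleC norm_scaleC mult.commute)

lemma has_sum_scaleC: "(f has_sum s) A \<Longrightarrow> ((\<lambda>j. c *\<^sub>C f j) has_sum c *\<^sub>C s) A"
  using has_sum_bounded_linear[OF bounded_linear_scaleC] by (auto simp: o_def)

lemma has_sum_cinner_right: "(f has_sum s) A \<Longrightarrow> ((\<lambda>j. cinner x (f j)) has_sum cinner x s) A"
  using has_sum_bounded_linear[OF bounded_linear_cinner_right] by (auto simp: o_def)

lemma cinner_ket: "cinner (ket a) x = coord x a"
proof -
  have "((\<lambda>i. cnj (coord (ket a) i) * coord x i) has_sum coord x a) {a}"
    using has_sum_finite[of "{a}" "\<lambda>i. cnj (coord (ket a) i) * coord x i"] by (simp add: ket.rep_eq)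
  then have "((\<lambda>i. cnj (coord (ket a) i) * coord x i) has_sum coord x a) UNIV"
    by (rule has_sum_cong_neutral[THEN iffD1, rotated -1]) (auto simp: ket.rep_eq)
  then show ?thesis
    using cinner_has_sum has_sum_unique by blast
qed

section \<open>Orthonormal families\<close>

text \<open>Completeness by orthogonality: in this form it passes to product states and direct sums
  without approximation by spans.\<close>

definition total_family :: "('j \<Rightarrow> 'i ell2) \<Rightarrow> bool" where
  "total_family v \<longleftrightarrow> (\<forall>x. (\<forall>j. cinner (v j) x = 0) \<longrightarrow> x = 0)"

lemma total_familyD: "total_family v \<Longrightarrow> (\<And>j. cinner (v j) x = cinner (v j) y) \<Longrightarrow> x = y"
  unfolding total_family_def by (metis cinner_minus_right diff_eq_diff_eq diff_self)

lemma orthonormal_familyD: "orthonormal_family v \<Longrightarrow> cinner (v j) (v k) = (if j = k then 1 else 0)"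
  by (simp add: orthonormal_family_def)

text \<open>Relative to an index set: a function with infinite support has an empty sorted list of
  modes, so its \<open>number_state\<close> is the vacuum, and orthonormality can hold on
  \<open>\<N>\<close> only.\<close>

definition orthonormal_on :: "'j set \<Rightarrow> ('j \<Rightarrow> 'i ell2) \<Rightarrow> bool" where
  "orthonormal_on A v \<longleftrightarrow> (\<forall>j\<in>A. \<forall>k\<in>A. cinner (v j) (v k) = (if j = k then 1 else 0))"

lemma orthonormal_on_UNIV: "orthonormal_on UNIV v \<longleftrightarrow> orthonormal_family v"
  by (simp add: orthonormal_on_def orthonormal_family_def)

lemma orthonormal_basis_total:
  assumes "orthonormal_basis v"
  shows "total_family v"
  unfolding total_family_def
proof (intro allI impI)
  fix x
  assume x: "\<forall>j. cinner (v j) x = 0"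
  have "cinner y x = 0" if "y \<in> complex_ell2.span (range v)" for y
    using that
    by (induction rule: complex_ell2.span_induct_alt)
       (use x in \<open>auto simp: cinner_add_left cinner_scaleC_left\<close>)
  then have "closure (complex_ell2.span (range v)) \<subseteq> {y. cinner y x = 0}"
    by (intro closure_minimal)
       (auto intro!: closed_Collect_eq continuous_intros linear_continuous_on bounded_linear_cinner_left)
  then have "cinner x x = 0"
    using assms unfolding orthonormal_basis_def closed_cspan_def by blast
  then show "x = 0"
    by (simp add: cinner_self_norm)
qed

lemma norm_orthogonal_sum:
  assumes v: "orthonormal_on A v" and F: "finite F" "F \<subseteq> A"
  shows "(norm (\<Sum>j\<in>F. c j *\<^sub>C v j))\<^sup>2 = (\<Sum>j\<in>F. (cmod (c j))\<^sup>2)"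
proof -
  let ?y = "\<Sum>j\<in>F. c j *\<^sub>C v j"
  have yv: "cinner ?y (v k) = cnj (c k)" if "k \<in> F" for k
  proof -
    have "cinner ?y (v k) = (\<Sum>j\<in>F. cnj (c j) * (if j = k then 1 else 0))"
      unfolding cinner_sum_left cinner_scaleC_left
      by (intro sum.cong refl) (use v F(2) that in \<open>simp add: orthonormal_on_def subset_iff\<close>)
    then show ?thesis
      using that F by (simp add: mult_delta_right sum.delta)
  qed
  have "cinner ?y ?y = (\<Sum>k\<in>F. c k * cinner ?y (v k))"
    unfolding cinner_sum_right cinner_scaleC_right ..
  also have "\<dots> = (\<Sum>k\<in>F. cnj (c k) * c k)"
    by (intro sum.cong refl) (simp add: yv)
  also have "\<dots> = complex_of_real (\<Sum>j\<in>F. (cmod (c j))\<^sup>2)"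
    by (simp only: cnj_mult_self of_real_sum)
  finally show ?thesis
    unfolding cinner_self_norm using of_real_eq_iff by blast
qed

text \<open>An orthogonal series need not converge absolutely, so comparing norms does not help. The
  partial sums form a Cauchy filter because, by Pythagoras, their differences are controlled by
  tails of the sum of squares.\<close>

lemma summable_on_orthogonal:
  assumes v: "orthonormal_on A v" and c: "(\<lambda>j. (cmod (c j))\<^sup>2) summable_on A"
  shows "(\<lambda>j. c j *\<^sub>C v j) summable_on A"
proof -
  let ?f = "\<lambda>j. c j *\<^sub>C v j"
  have "\<exists>P. eventually P (finite_subsets_at_top A) \<and>
          (\<forall>F F'. P F \<and> P F' \<longrightarrow> dist (sum ?f F) (sum ?f F') < e)" if "e > 0" for e
  proof -
    define d where "d = (e / 2)\<^sup>2"
    have "d > 0" using that by (simp add: d_def)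
    obtain F0 where F0: "finite F0" "F0 \<subseteq> A"
      "dist (sum (\<lambda>j. (cmod (c j))\<^sup>2) F0) (infsum (\<lambda>j. (cmod (c j))\<^sup>2) A) < d"
      using infsum_finite_approximation[OF c, of "d / 2"] \<open>d > 0\<close> by (auto simp: dist_commute) 
    have less: "norm (sum ?f X) < e / 2" if X: "finite X" "X \<subseteq> A" "X \<inter> F0 = {}" for X
    proof -
      have "sum (\<lambda>j. (cmod (c j))\<^sup>2) (X \<union> F0) \<le> infsum (\<lambda>j. (cmod (c j))\<^sup>2) A"
        by (rule finite_sum_le_infsum) (use X F0 c in auto)
      then have "sum (\<lambda>j. (cmod (c j))\<^sup>2) X < d"
        using F0(1,3) X by (simp add: sum.union_disjoint dist_real_def)
      then have "(norm (sum ?f X))\<^sup>2 < (e / 2)\<^sup>2"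
        using norm_orthogonal_sum[OF v X(1,2), of c] by (simp add: d_def)
      then show ?thesis
        by (rule power2_less_imp_less) (use \<open>e > 0\<close> in simp)
    qed
    have "dist (sum ?f F) (sum ?f F') < e"
      if F: "finite F" "F0 \<subseteq> F" "F \<subseteq> A" and F': "finite F'" "F0 \<subseteq> F'" "F' \<subseteq> A" for F F'
    proof -
      have "sum ?f F = sum ?f (F - F0) + sum ?f F0" "sum ?f F' = sum ?f (F' - F0) + sum ?f F0"
        using F F' by (simp_all add: sum.subset_diff)
      then have "dist (sum ?f F) (sum ?f F') = norm (sum ?f (F - F0) - sum ?f (F' - F0))"
        by (simp add: dist_norm)
      also have "\<dots> \<le> norm (sum ?f (F - F0)) + norm (sum ?f (F' - F0))"
        by (rule norm_triangle_ineq4)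
      also have "\<dots> < e / 2 + e / 2"
        by (intro add_strict_mono less) (use F F' in auto)
      finally show ?thesis by simp
    qed
    then show ?thesis
      using F0(1,2)
      by (intro exI[of _ "\<lambda>F. finite F \<and> F0 \<subseteq> F \<and> F \<subseteq> A"])
         (auto simp: eventually_finite_subsets_at_top)
  qed
  then have "cauchy_filter (filtermap (sum ?f) (finite_subsets_at_top A))"
    by (simp add: cauchy_filter_metric_filtermap)
  then obtain L where "(sum ?f \<longlongrightarrow> L) (finite_subsets_at_top A)"
    using cauchy_filter_convergent[of "filtermap (sum ?f) (finite_subsets_at_top A)"]
    by (auto simp: convergent_filter_iff filterlim_def)
  then show ?thesis
    unfolding summable_on_def has_sum_def by blast
qed

lemma Bessel_sum:
  assumes v: "orthonormal_on A v" and F: "finite F" "F \<subseteq> A"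
  shows "(\<Sum>j\<in>F. (cmod (cinner (v j) x))\<^sup>2) \<le> (norm x)\<^sup>2"
proof -
  let ?y = "\<Sum>j\<in>F. cinner (v j) x *\<^sub>C v j"
  let ?s = "\<Sum>j\<in>F. (cmod (cinner (v j) x))\<^sup>2"
  have yx: "cinner ?y x = ?s"
    by (simp only: cinner_sum_left cinner_scaleC_left cnj_mult_self of_real_sum)
  have xy: "cinner x ?y = ?s"
    unfolding cinner_commute[of x ?y] yx by (rule complex_cnj_complex_of_real)
  have yy: "cinner ?y ?y = ?s"
    unfolding cinner_self_norm norm_orthogonal_sum[OF v F] by simp
  have "complex_of_real ((norm (x - ?y))\<^sup>2) = complex_of_real ((norm x)\<^sup>2 - ?s)"
    unfolding cinner_self_norm[symmetric] cinner_minus_left cinner_minus_right yx yy xy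
    by (simp add: cinner_self_norm)
  then have "(norm (x - ?y))\<^sup>2 = (norm x)\<^sup>2 - ?s"
    using of_real_eq_iff by blast
  then show ?thesis
    using zero_le_power2[of "norm (x - ?y)"] by linarith
qed

lemma Bessel_summable:
  assumes "orthonormal_on A v"
  shows "(\<lambda>j. (cmod (cinner (v j) x))\<^sup>2) summable_on A"
  by (rule nonneg_bdd_above_summable_on)
     (auto intro!: bdd_aboveI2[where M = "(norm x)\<^sup>2"] Bessel_sum[OF assms])

lemma orthonormal_expansion:
  assumes "orthonormal_family v" "total_family v"
  shows "((\<lambda>j. cinner (v j) x *\<^sub>C v j) has_sum x) UNIV"
proof -
  let ?f = "\<lambda>j. cinner (v j) x *\<^sub>C v j"
  have sum: "(?f has_sum infsum ?f UNIV) UNIV"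
    using assms(1) by (intro has_sum_infsum summable_on_orthogonal Bessel_summable) (simp_all add: orthonormal_on_UNIV)
  have "infsum ?f UNIV = x"
  proof (rule total_familyD[OF assms(2)])
    fix k
    have "((\<lambda>j. cinner (v k) (?f j)) has_sum cinner (v k) (infsum ?f UNIV)) UNIV"
      by (rule has_sum_cinner_right[OF sum])
    moreover have "((\<lambda>j. cinner (v k) (?f j)) has_sum cinner (v k) x) UNIV"
      using has_sum_finite[of "{k}" "\<lambda>j. cinner (v k) (?f j)"]
      by (subst has_sum_cong_neutral[where T = "{k}" and g = "\<lambda>j. cinner (v k) (?f j)"])
         (auto simp: cinner_scaleC_right orthonormal_familyD[OF assms(1)])
    ultimately show "cinner (v k) (infsum ?f UNIV) = cinner (v k) x"
      by (rule has_sum_unique)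
  qed
  with sum show ?thesis by simp
qed

lemma Parseval:
  assumes "orthonormal_family v" "total_family v"
  shows "((\<lambda>j. cinner x (v j) * cinner (v j) y) has_sum cinner x y) UNIV"
  using has_sum_cinner_right[OF orthonormal_expansion[OF assms], of x y]
  by (simp add: cinner_scaleC_right mult.commute)

lemma Parseval_norm:
  assumes "orthonormal_family v" "total_family v"
  shows "((\<lambda>j. (cmod (cinner (v j) x))\<^sup>2) has_sum (norm x)\<^sup>2) UNIV"
proof -
  have "((\<lambda>j. complex_of_real ((cmod (cinner (v j) x))\<^sup>2)) has_sum complex_of_real ((norm x)\<^sup>2)) UNIV"
    using Parseval[OF assms, of x x]
    by (simp add: cinner_self_norm complex_norm_square cinner_commute[of x] mult.commute flip: of_real_power)
  then show ?thesis
    by (simp only: has_sum_of_real_iff)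
qed

section \<open>Contractions and product states\<close>

lemma has_sum_norm_power2: "((\<lambda>i. (cmod (coord x i))\<^sup>2) has_sum (norm x)\<^sup>2) UNIV"
  unfolding norm_ell2_power2
  by (rule has_sum_infsum) (use square_summable_coord[of x] in \<open>simp add: square_summable_def\<close>)

lemma has_sum_norm_slice_snd: "((\<lambda>b. (norm (slice_snd b g))\<^sup>2) has_sum (norm g)\<^sup>2) UNIV"
proof -
  have "((\<lambda>(b, a). (cmod (coord g (a, b)))\<^sup>2) has_sum (norm g)\<^sup>2) (UNIV \<times> UNIV)"
    using has_sum_norm_power2[of g]
    by (subst has_sum_swap) (simp add: case_prod_unfold)
  then show ?thesis
    by (rule has_sum_SigmaD)
       (use has_sum_norm_power2[of "slice_snd _ g"] in \<open>simp add: slice_snd.rep_eq\<close>)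
qed

text \<open>The adjoint of tensoring with \<open>f\<close> in the first factor; it is antilinear in
  \<open>f\<close>.\<close>

definition contract_fst :: "'a ell2 \<Rightarrow> ('a \<times> 'b) ell2 \<Rightarrow> 'b ell2" where
  "contract_fst f g = Abs_ell2 (\<lambda>b. cinner f (slice_snd b g))"

lemma coord_contract_fst: "coord (contract_fst f g) b = cinner f (slice_snd b g)"
proof -
  have "square_summable (\<lambda>b. cinner f (slice_snd b g))"
  proof (rule square_summable_dominated)
    show "(\<lambda>b. (norm f)\<^sup>2 * (norm (slice_snd b g))\<^sup>2) summable_on UNIV"
      using has_sum_norm_slice_snd[of g] by (intro summable_on_cmult_right) (auto simp: summable_on_def)
    show "(cmod (cinner f (slice_snd b g)))\<^sup>2 \<le> (norm f)\<^sup>2 * (norm (slice_snd b g))\<^sup>2" for b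
      using power_mono[OF cinner_Cauchy_Schwarz[of f "slice_snd b g"], of 2] by (simp add: power_mult_distrib)
  qed
  then show ?thesis
    by (simp add: contract_fst_def Abs_ell2_inverse)
qed

lemma cinner_tensor_pair: "cinner (tensor_pair f h) g = cinner h (contract_fst f g)"
proof -
  let ?F = "\<lambda>b a. cnj (coord h b) * (cnj (coord f a) * coord g (a, b))"
  have "((\<lambda>(a, b). ?F b a) has_sum cinner (tensor_pair f h) g) (UNIV \<times> UNIV)"
    using cinner_has_sum[of "tensor_pair f h" g]
    by (simp add: tensor_pair.rep_eq case_prod_unfold mult_ac)
  then have "((\<lambda>(b, a). ?F b a) has_sum cinner (tensor_pair f h) g) (UNIV \<times> UNIV)"
    by (subst has_sum_swap) simp
  then have "((\<lambda>b. cnj (coord h b) * cinner f (slice_snd b g)) has_sum cinner (tensor_pair f h) g) UNIV"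
    by (rule has_sum_SigmaD)
       (use has_sum_cmult_right[OF cinner_has_sum[of f "slice_snd _ g"]] in \<open>simp add: slice_snd.rep_eq\<close>)
  moreover have "((\<lambda>b. cnj (coord h b) * cinner f (slice_snd b g)) has_sum cinner h (contract_fst f g)) UNIV"
    using cinner_has_sum[of h "contract_fst f g"] by (simp add: coord_contract_fst)
  ultimately show ?thesis
    by (rule has_sum_unique)
qed

lift_definition cons_split :: "'i list ell2 \<Rightarrow> ('i \<times> 'i list) ell2" is "\<lambda>f (a, l). f (a # l)"
proof -
  fix f :: "'i list \<Rightarrow> complex"
  assume "square_summable f"
  then show "square_summable (\<lambda>(a, l). f (a # l))"
    by (rule square_summable_comp_inj[where A = UNIV and h = "\<lambda>(a, l). a # l"]) (auto intro: inj_onI)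
qed

text \<open>The free annihilation operator, adjoint to tensoring with \<open>f\<close> on the left.
  The bosonic square root is absent here and enters through \<open>amp\<close>.\<close>

definition contract :: "'i ell2 \<Rightarrow> 'i list ell2 \<Rightarrow> 'i list ell2" where
  "contract f \<Psi> = contract_fst f (cons_split \<Psi>)"

lemma coord_tensor_one_particle:
  "coord (tensor_product 1 (one_particle f) x) l = (case l of [] \<Rightarrow> 0 | a # l' \<Rightarrow> coord f a * coord x l')"
  by (auto simp: tensor_product.rep_eq one_particle.rep_eq split: list.splits)

lemma cinner_tensor_one_particle:
  "cinner (tensor_product 1 (one_particle f) x) y = cinner x (contract f y)"
proof -
  let ?F = "\<lambda>l. cnj (coord (tensor_product 1 (one_particle f) x) l) * coord y l"
  have "(?F has_sum cinner (tensor_product 1 (one_particle f) x) y) (range (\<lambda>(a, l). a # l))"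
    using cinner_has_sum[of "tensor_product 1 (one_particle f) x" y]
    by (rule has_sum_cong_neutral[THEN iffD1, rotated -1])
       (auto simp: coord_tensor_one_particle image_iff simp del: One_nat_def split: list.splits)
  then have "((\<lambda>p. cnj (coord (tensor_pair f x) p) * coord (cons_split y) p) has_sum
      cinner (tensor_product 1 (one_particle f) x) y) UNIV"
    by (subst (asm) has_sum_reindex)
       (auto intro!: inj_onI simp: o_def case_prod_unfold coord_tensor_one_particle
         tensor_pair.rep_eq cons_split.rep_eq simp del: One_nat_def)
  then have "cinner (tensor_product 1 (one_particle f) x) y = cinner (tensor_pair f x) (cons_split y)"
    using cinner_has_sum has_sum_unique by blast
  then show ?thesis
    by (simp add: cinner_tensor_pair contract_def)
qed

lemma coord_contract: "coord (contract f \<Psi>) l = cinner f (slice_snd l (cons_split \<Psi>))"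
  by (simp add: contract_def coord_contract_fst)

primrec product_state :: "'i ell2 list \<Rightarrow> 'i list ell2" where
  "product_state [] = vacuum"
| "product_state (f # fs) = tensor_product 1 (one_particle f) (product_state fs)"

lemma coord_product_state:
  "coord (product_state fs) l =
     (if length l = length fs then \<Prod>i<length fs. coord (fs ! i) (l ! i) else 0)"
proof (induction fs arbitrary: l)
  case Nil
  then show ?case by (simp add: vacuum_def ket.rep_eq)
next
  case (Cons f fs)
  then show ?case
    by (cases l) (simp_all add: coord_tensor_one_particle prod.lessThan_Suc_shift del: One_nat_def prod.lessThan_Suc)
qed

lemma cinner_product_state_Cons: "cinner (product_state (f # fs)) \<Psi> = cinner (product_state fs) (contract f \<Psi>)"
  by (simp only: product_state.simps cinner_tensor_one_particle)

lemma contract_tensor: "contract f (tensor_product 1 (one_particle g) x) = cinner f g *\<^sub>C x"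
proof -
  have "slice_snd l (cons_split (tensor_product 1 (one_particle g) x)) = coord x l *\<^sub>C g" for l
    by (simp add: ell2_eq_iff slice_snd.rep_eq cons_split.rep_eq scaleC.rep_eq
        coord_tensor_one_particle del: One_nat_def)
  then show ?thesis
    by (simp add: ell2_eq_iff[of "contract _ _"] coord_contract scaleC.rep_eq cinner_scaleC_right del: One_nat_def)
qed

lemma cinner_product_state_Nil: "cinner (product_state []) \<Psi> = coord \<Psi> []"
  by (simp add: vacuum_def cinner_ket)

lemma cinner_product_state_tensor:
  "cinner (product_state (f # fs)) (tensor_product 1 (one_particle g) x)
    = cinner f g * cinner (product_state fs) x"
  by (simp only: cinner_product_state_Cons contract_tensor cinner_scaleC_right)

lemma orthonormal_product_state:
  assumes "orthonormal_family e"
  shows "orthonormal_family (\<lambda>q. product_state (map e q))"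
  unfolding orthonormal_family_def
proof (intro allI)
  fix p q
  show "cinner (product_state (map e p)) (product_state (map e q)) = (if p = q then 1 else 0)"
  proof (induction p arbitrary: q)
    case Nil
    then show ?case by (simp add: vacuum_def cinner_ket ket.rep_eq coord_product_state flip: vacuum_def)
        (auto simp: vacuum_def ket.rep_eq cinner_ket coord_product_state)
  next
    case (Cons i p)
    show ?case
    proof (cases q)
      case Nil
      then show ?thesis
        using cinner_product_state_Nil[of "product_state (map e (i # p))"]
          cinner_commute[of "product_state (map e q)" "product_state (map e (i # p))"]
        by (simp add: coord_product_state del: product_state.simps)
    next
      case (Cons j q')
      have "cinner (product_state (map e (i # p))) (product_state (map e (j # q')))
          = cinner (e i) (e j) * cinner (product_state (map e p)) (product_state (map e q'))"
        using cinner_product_state_tensor by simp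
      then show ?thesis
        using Cons Cons.IH[of q'] orthonormal_familyD[OF assms, of i j] by auto
    qed
  qed
qed

text \<open>The coordinates refer to the standard basis, not to \<open>e\<close>. Contracting with
  \<open>e j\<close> shortens the lists by one, so the induction hypothesis makes each slice
  orthogonal to all \<open>e j\<close>, hence zero.\<close>

lemma total_product_state:
  assumes "total_family e"
  shows "total_family (\<lambda>q. product_state (map e q))"
  unfolding total_family_def
proof (intro allI impI)
  fix \<Psi>
  assume "\<forall>q. cinner (product_state (map e q)) \<Psi> = 0"
  then have "coord \<Psi> l = 0" for l
  proof (induction l arbitrary: \<Psi>)
    case Nil
    then show ?case
      using cinner_product_state_Nil[of \<Psi>] by (metis list.simps(8))
  next
    case (Cons a l)
    have "coord (contract (e j) \<Psi>) l = 0" for j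
      by (rule Cons.IH) (metis Cons.prems cinner_product_state_Cons list.simps(9))
    then have "slice_snd l (cons_split \<Psi>) = 0"
      using assms by (simp add: total_family_def coord_contract)
    then have "coord (slice_snd l (cons_split \<Psi>)) a = 0"
      by (simp add: zero_ell2.rep_eq)
    then show ?case
      by (simp add: slice_snd.rep_eq cons_split.rep_eq)
  qed
  then show "\<Psi> = 0"
    by (simp add: ell2_eq_iff zero_ell2.rep_eq)
qed

section \<open>Sums over removals and over permutations of a list\<close>

(* Sums F y r over the entries y of l, r being the list of the other entries. *)
primrec sum_picks :: "'a list \<Rightarrow> ('a \<Rightarrow> 'a list \<Rightarrow> 'b) \<Rightarrow> 'b::comm_monoid_add" where
  "sum_picks [] F = 0"
| "sum_picks (x # xs) F = F x xs + sum_picks xs (\<lambda>y r. F y (x # r))"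

lemma sum_picks_index:
  "sum_picks l F = (\<Sum>k<length l. F (l ! k) (take k l @ drop (Suc k) l))"
  by (induction l arbitrary: F) (simp_all add: sum.lessThan_Suc_shift del: sum.lessThan_Suc)

lemma sum_picks_cong:
  assumes "\<And>y r. mset l = add_mset y (mset r) \<Longrightarrow> F y r = G y r"
  shows "sum_picks l F = sum_picks l G"
  using assms
proof (induction l arbitrary: F G)
  case (Cons x xs)
  have "sum_picks xs (\<lambda>y r. F y (x # r)) = sum_picks xs (\<lambda>y r. G y (x # r))"
    by (rule Cons.IH) (use Cons.prems in auto)
  then show ?case
    using Cons.prems by simp
qed simp

lemma sum_picks_zero: "sum_picks l (\<lambda>y r. 0) = 0"
  by (induction l) auto

lemma sum_picks_add: "sum_picks l (\<lambda>y r. F y r + G y r) = sum_picks l F + sum_picks l G"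
  by (induction l arbitrary: F G) (auto simp: ac_simps)

lemma sum_picks_cmult: "sum_picks l (\<lambda>y r. c * F y r) = c * sum_picks l F" for c :: "'b::semiring_0"
  by (induction l arbitrary: F) (auto simp: distrib_left)

lemma cnj_sum_picks: "cnj (sum_picks l F) = sum_picks l (\<lambda>y r. cnj (F y r))"
  by (induction l arbitrary: F) auto

lemma sum_picks_append:
  "sum_picks (p @ q) F = sum_picks p (\<lambda>y r. F y (r @ q)) + sum_picks q (\<lambda>y r. F y (p @ r))"
  by (induction p arbitrary: F) (auto simp: ac_simps)

lemma sum_picks_map: "sum_picks (map f l) F = sum_picks l (\<lambda>y r. F (f y) (map f r))"
  by (induction l arbitrary: F) auto

text \<open>Both sides run over ordered pairs of distinct positions of \<open>l\<close>, and the
  remaining list does not depend on the order of removal. Commutativity of creation operators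
  reduces to this.\<close>

lemma sum_picks_swap:
  "sum_picks l (\<lambda>y r. sum_picks r (\<lambda>z s. H y z s)) = sum_picks l (\<lambda>y r. sum_picks r (\<lambda>z s. H z y s))"
proof (induction l arbitrary: H)
  case (Cons x xs)
  have "sum_picks xs (\<lambda>y r. sum_picks r (\<lambda>z s. H y z (x # s))) = sum_picks xs (\<lambda>y r. sum_picks r (\<lambda>z s. H z y (x # s)))"
    by (rule Cons.IH)
  then show ?case
    by (simp add: sum_picks_add ac_simps)
qed simp

definition permsum :: "('a list \<Rightarrow> 'b) \<Rightarrow> 'a list \<Rightarrow> 'b::comm_monoid_add" where
  "permsum G l = (\<Sum>p | p permutes {..<length l}. G (permute_list p l))"

lemma permsum_mset:
  assumes "mset l = mset l'"
  shows "permsum G l = permsum G l'"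
proof -
  obtain p where p: "p permutes {..<length l'}" "permute_list p l' = l"
    using mset_eq_permutation[OF assms] .
  have len: "length l = length l'"
    using assms by (rule mset_eq_length)
  have "permsum G l = (\<Sum>q | q permutes {..<length l'}. G (permute_list (p \<circ> q) l'))"
    unfolding permsum_def len
    by (intro sum.cong refl) (simp add: permute_list_compose p(2))
  also have "\<dots> = permsum G l'"
    unfolding permsum_def
    by (rule setum_permutations_compose_left[OF p(1), of "\<lambda>q. G (permute_list q l')", symmetric])
  finally show ?thesis .
qed

lemma permsum_Nil: "permsum G [] = G []"
  by (simp add: permsum_def)

lemma permsum_cong: "(\<And>t. mset t = mset l \<Longrightarrow> G t = H t) \<Longrightarrow> permsum G l = permsum H l"
  unfolding permsum_def by (intro sum.cong refl) auto

lemma permsum_invariant: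
  assumes "\<And>l'. mset l' = mset l \<Longrightarrow> G l' = G l"
  shows "permsum G l = of_nat (fact (length l)) * (G l :: 'b::comm_semiring_1)"
proof -
  have "permsum G l = permsum (\<lambda>_. G l) l"
    by (rule permsum_cong) (rule assms)
  then show ?thesis
    by (simp add: permsum_def card_permutations)
qed

lemma permsum_cmult: "permsum (\<lambda>t. c * G t) l = c * permsum G l" for c :: "'b::semiring_0"
  by (simp add: permsum_def sum_distrib_left)

text \<open>The permutations are sorted by the entry that they put first: each is a transposition of
  position 0 with some \<open>b\<close>, composed with a permutation of the positions above
  0.\<close>

lemma permsum_rec: "permsum G (x # xs) = sum_picks (x # xs) (\<lambda>y r. permsum (\<lambda>t. G (y # t)) r)"
proof -
  define l where "l = x # xs"
  define n where "n = length xs"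
  define S where "S = Suc ` {..<n}"
  have S: "{..<length l} = insert 0 S" "finite S" "0 \<notin> S"
    by (auto simp: S_def l_def n_def lessThan_Suc_eq_insert_0)
  have bij: "bij_betw (\<lambda>\<pi> i. if i \<in> S then Suc (\<pi> (inv_into {..<n} Suc i)) else i)
      {\<pi>. \<pi> permutes {..<n}} {\<pi>. \<pi> permutes S}"
    by (rule bij_betw_permutations) (auto simp: S_def bij_betw_def)
  have inner: "(\<Sum>q | q permutes S. G (permute_list (Transposition.transpose 0 b \<circ> q) l))
      = permsum (\<lambda>t. G (l ! b # t)) (take b l @ drop (Suc b) l)" if b: "b < length l" for b
  proof -
    let ?t = "Transposition.transpose 0 b"
    have t: "?t permutes {..<length l}"
      using b by (intro permutes_swap_id) (auto simp: l_def)
    obtain y r where yr: "permute_list ?t l = y # r"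
      by (cases "permute_list ?t l") (auto simp: l_def dest: arg_cong[where f = length])
    have len: "length r = n"
      using arg_cong[OF yr, of length] by (simp add: l_def n_def)
    have y: "y = l ! b"
      using permute_list_nth[OF t, of 0] yr by (simp add: l_def)
    have "mset (y # r) = mset l"
      unfolding yr[symmetric] using t by (rule mset_permute_list)
    also have "mset l = mset (take b l @ l ! b # drop (Suc b) l)"
      using id_take_nth_drop[OF b] by simp
    \<comment> \<open>The transposition may leave the other entries in an order different from that
      of \<open>take b l @ drop (Suc b) l\<close>; only their multiset matters to
      \<open>permsum\<close>.\<close>
    finally have r: "mset r = mset (take b l @ drop (Suc b) l)"
      by (simp add: y)
    have "(\<Sum>q | q permutes S. G (permute_list (?t \<circ> q) l)) = (\<Sum>q | q permutes S. G (permute_list q (y # r)))"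
    proof (intro sum.cong refl)
      fix q assume "q \<in> {q. q permutes S}"
      then have "q permutes {..<length l}"
        using permutes_subset[of q S "{..<length l}"] unfolding S(1) by blast
      then show "G (permute_list (?t \<circ> q) l) = G (permute_list q (y # r))"
        by (simp only: permute_list_compose yr)
    qed
    also have "\<dots> = (\<Sum>\<pi> | \<pi> permutes {..<n}. G (permute_list
        (\<lambda>i. if i \<in> S then Suc (\<pi> (inv_into {..<n} Suc i)) else i) (y # r)))"
      by (rule sum.reindex_bij_betw[OF bij, symmetric])
    also have "\<dots> = permsum (\<lambda>t. G (y # t)) r"
      unfolding permsum_def len
      by (intro sum.cong refl arg_cong[where f = G])
         (auto simp: permute_list_def len map_upt_Suc S_def simp del: upt_Suc)
    also have "\<dots> = permsum (\<lambda>t. G (l ! b # t)) (take b l @ drop (Suc b) l)"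
      unfolding y using r by (rule permsum_mset)
    finally show ?thesis .
  qed
  have "permsum G l = (\<Sum>b\<in>insert 0 S. \<Sum>q | q permutes S. G (permute_list (Transposition.transpose 0 b \<circ> q) l))"
    unfolding permsum_def S(1) by (rule sum_over_permutations_insert[OF S(2,3)])
  also have "\<dots> = (\<Sum>b<length l. permsum (\<lambda>t. G (l ! b # t)) (take b l @ drop (Suc b) l))"
    unfolding S(1)[symmetric] by (intro sum.cong refl inner) auto
  finally show ?thesis
    unfolding l_def sum_picks_index .
qed

section \<open>Symmetrization\<close>

lemma coord_symmetrize: "coord (symmetrize \<Psi>) l = permsum (coord \<Psi>) l / fact (length l)"
  by (simp add: symmetrize.rep_eq permsum_def)

lemma symmetrize_in_fock_space: "symmetrize \<Psi> \<in> fock_space"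
proof -
  have "coord (symmetrize (symmetrize \<Psi>)) l = coord (symmetrize \<Psi>) l" for l
  proof -
    have "permsum (coord (symmetrize \<Psi>)) l = of_nat (fact (length l)) * coord (symmetrize \<Psi>) l"
      by (rule permsum_invariant) (metis coord_symmetrize mset_eq_length permsum_mset)
    then show ?thesis
      by (simp add: coord_symmetrize[of "symmetrize \<Psi>"])
  qed
  then show ?thesis
    by (simp add: fock_space_def ell2_eq_iff)
qed

lemma fock_space_coord_mset:
  assumes "\<Psi> \<in> fock_space" "mset l = mset l'"
  shows "coord \<Psi> l = coord \<Psi> l'"
proof -
  have "symmetrize \<Psi> = \<Psi>"
    using assms(1) by (simp add: fock_space_def)
  then show ?thesis
    using coord_symmetrize[of \<Psi> l] coord_symmetrize[of \<Psi> l'] permsum_mset[OF assms(2), of "coord \<Psi>"]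
      mset_eq_length[OF assms(2)] by simp
qed

lemma has_sum_sum:
  fixes f :: "'a \<Rightarrow> 'b \<Rightarrow> 'c::topological_comm_monoid_add"
  shows "(\<And>p. p \<in> P \<Longrightarrow> (f p has_sum s p) A) \<Longrightarrow> ((\<lambda>x. \<Sum>p\<in>P. f p x) has_sum (\<Sum>p\<in>P. s p)) A"
  by (induction P rule: infinite_finite_induct) (auto intro: has_sum_add)

lemma product_state_permute_list:
  assumes p: "p permutes {..<length fs}" and l: "length l = length fs"
  shows "coord (product_state (permute_list p fs)) (permute_list p l) = coord (product_state fs) l"
proof -
  have "(\<Prod>i<length fs. coord (permute_list p fs ! i) (permute_list p l ! i))
      = (\<Prod>i<length fs. coord (fs ! p i) (l ! p i))"
    using p l by (intro prod.cong refl) (simp add: permute_list_nth)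
  also have "\<dots> = (\<Prod>i<length fs. coord (fs ! i) (l ! i))"
    using p by (intro prod.reindex_bij_betw) (rule permutes_imp_bij)
  finally show ?thesis
    using l by (simp add: coord_product_state)
qed

lemma has_sum_cinner_product_state:
  "((\<lambda>l. cnj (coord (product_state fs) l) * coord \<Psi> l) has_sum cinner (product_state fs) \<Psi>)
     {l. length l = length fs}"
  using cinner_has_sum[of "product_state fs" \<Psi>]
  by (rule has_sum_cong_neutral[THEN iffD1, rotated -1]) (auto simp: coord_product_state)

text \<open>Reindexing the lists moves a permutation from the coordinates of \<open>\<Psi>\<close>
  to the factors of the product state; this is the self-adjointness of symmetrization.\<close>

lemma cinner_product_state_symmetrize:
  "cinner (product_state fs) (symmetrize \<Psi>) = permsum (\<lambda>t. cinner (product_state t) \<Psi>) fs / fact (length fs)"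
proof -
  let ?L = "{l. length l = length fs}" and ?P = "{p. p permutes {..<length fs}}"
  have fin: "finite ?P" by (simp add: finite_permutations)
  have *: "((\<lambda>l. cnj (coord (product_state fs) l) * coord \<Psi> (permute_list p l)) has_sum
      cinner (product_state (permute_list p fs)) \<Psi>) ?L" if p: "p \<in> ?P" for p
  proof -
    have pp: "p permutes {..<length fs}" using p by simp
    have bij: "bij_betw (permute_list p) ?L ?L"
      by (rule bij_betw_byWitness[where f' = "permute_list (inv p)"])
         (use pp in \<open>auto simp: permutes_inv permutes_inv_o simp flip: permute_list_compose\<close>)
    have "((\<lambda>l. cnj (coord (product_state (permute_list p fs)) (permute_list p l)) * coord \<Psi> (permute_list p l))
       has_sum cinner (product_state (permute_list p fs)) \<Psi>) ?L"
      using has_sum_cinner_product_state[of "permute_list p fs" \<Psi>]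
      by (subst has_sum_reindex_bij_betw[OF bij]) simp
    then show ?thesis
      by (rule has_sum_cong[THEN iffD1, rotated]) (simp add: product_state_permute_list[OF pp])
  qed
  have "((\<lambda>l. \<Sum>p\<in>?P. cnj (coord (product_state fs) l) * coord \<Psi> (permute_list p l)) has_sum
      permsum (\<lambda>t. cinner (product_state t) \<Psi>) fs) ?L"
    unfolding permsum_def by (rule has_sum_sum) (rule *)
  then have "((\<lambda>l. (\<Sum>p\<in>?P. cnj (coord (product_state fs) l) * coord \<Psi> (permute_list p l)) / fact (length fs)) has_sum
      permsum (\<lambda>t. cinner (product_state t) \<Psi>) fs / fact (length fs)) ?L"
    using has_sum_cmult_left[where c = "inverse (fact (length fs))"] by (simp add: divide_inverse)
  then have "((\<lambda>l. cnj (coord (product_state fs) l) * coord (symmetrize \<Psi>) l) has_sum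
      permsum (\<lambda>t. cinner (product_state t) \<Psi>) fs / fact (length fs)) ?L"
    by (rule has_sum_cong[THEN iffD1, rotated]) (simp add: symmetrize.rep_eq sum_distrib_left)
  then show ?thesis
    using has_sum_cinner_product_state has_sum_unique by blast
qed

lemma cinner_product_state_mset:
  assumes "\<Psi> \<in> fock_space" "mset fs = mset gs"
  shows "cinner (product_state fs) \<Psi> = cinner (product_state gs) \<Psi>"
proof -
  have "symmetrize \<Psi> = \<Psi>"
    using assms(1) by (simp add: fock_space_def)
  then show ?thesis
    using cinner_product_state_symmetrize[of fs \<Psi>] cinner_product_state_symmetrize[of gs \<Psi>]
      permsum_mset[OF assms(2), of "\<lambda>t. cinner (product_state t) \<Psi>"]
      mset_eq_length[OF assms(2)] by simp
qed

section \<open>Creation operators in terms of amplitudes\<close>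

(* The matrix element of a(f1) ... a(fk) between the vacuum and \<Psi>, for symmetric \<Psi>. *)
definition amp :: "'i list ell2 \<Rightarrow> 'i ell2 list \<Rightarrow> complex" where
  "amp \<Psi> fs = sqrt (fact (length fs)) * cinner (product_state fs) \<Psi>"

lemma amp_mset: "\<Psi> \<in> fock_space \<Longrightarrow> mset fs = mset gs \<Longrightarrow> amp \<Psi> fs = amp \<Psi> gs"
  unfolding amp_def using cinner_product_state_mset mset_eq_length by metis

lemma amp_scaleC: "amp (c *\<^sub>C \<Psi>) fs = c * amp \<Psi> fs"
  by (simp add: amp_def cinner_scaleC_right)

lemma amp_add: "amp (\<Psi> + \<Phi>) fs = amp \<Psi> fs + amp \<Phi> fs"
  by (simp add: amp_def cinner_add_right distrib_left)

lemma amp_vacuum: "amp vacuum fs = (if fs = [] then 1 else 0)"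
proof (cases fs)
  case (Cons f gs)
  have "coord (product_state fs) [] = 0"
    unfolding coord_product_state by (simp add: Cons)
  then have "cinner vacuum (product_state fs) = 0"
    by (simp add: vacuum_def cinner_ket)
  then show ?thesis
    using cinner_commute[of "product_state fs" vacuum] Cons by (simp add: amp_def del: product_state.simps)
qed (simp add: amp_def vacuum_def cinner_ket ket.rep_eq)

lemma contract_add_left: "contract (f + g) \<Psi> = contract f \<Psi> + contract g \<Psi>"
  by (simp add: ell2_eq_iff coord_contract plus_ell2.rep_eq cinner_add_left)

lemma contract_scaleC_left: "contract (c *\<^sub>C f) \<Psi> = cnj c *\<^sub>C contract f \<Psi>"
  by (simp add: ell2_eq_iff coord_contract scaleC.rep_eq cinner_scaleC_left)

lemma amp_Cons_add: "amp \<Psi> ((f + g) # fs) = amp \<Psi> (f # fs) + amp \<Psi> (g # fs)"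
  unfolding amp_def cinner_product_state_Cons by (simp add: contract_add_left cinner_add_right distrib_left)

lemma amp_Cons_scaleC: "amp \<Psi> ((c *\<^sub>C f) # fs) = cnj c * amp \<Psi> (f # fs)"
  unfolding amp_def cinner_product_state_Cons by (simp add: contract_scaleC_left cinner_scaleC_right)

lemma fock_spaceI:
  assumes "\<And>l l'. mset l = mset l' \<Longrightarrow> coord \<Psi> l = coord \<Psi> l'"
  shows "\<Psi> \<in> fock_space"
proof -
  have "coord (symmetrize \<Psi>) l = coord \<Psi> l" for l
    unfolding coord_symmetrize by (subst permsum_invariant) (auto intro: assms)
  then show ?thesis
    by (simp add: fock_space_def ell2_eq_iff)
qed

lemma fock_space_scaleC: "\<Psi> \<in> fock_space \<Longrightarrow> c *\<^sub>C \<Psi> \<in> fock_space"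
  by (rule fock_spaceI) (metis fock_space_coord_mset scaleC.rep_eq)

lemma vacuum_in_fock_space: "vacuum \<in> fock_space"
  by (rule fock_spaceI) (auto simp: vacuum_def ket.rep_eq)

lemma coord_creation:
  assumes "\<Psi> \<in> creation_domain \<phi>"
  shows "coord (creation \<phi> \<Psi>) l =
    sqrt (length l) * coord (symmetrize (tensor_product 1 (one_particle \<phi>) \<Psi>)) l"
  using assms by (simp add: creation_domain_def creation_def Abs_ell2_inverse creation_coord_def)

lemma creation_in_fock_space:
  assumes "\<Psi> \<in> creation_domain \<phi>"
  shows "creation \<phi> \<Psi> \<in> fock_space"
proof (rule fock_spaceI)
  fix l l' :: "'a list"
  assume "mset l = mset l'"
  then show "coord (creation \<phi> \<Psi>) l = coord (creation \<phi> \<Psi>) l'"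
    unfolding coord_creation[OF assms]
    using fock_space_coord_mset[OF symmetrize_in_fock_space] mset_eq_length by metis
qed

text \<open>The canonical commutation relations in Leibniz form: exactly one of the annihilators in
  \<open>fs\<close> is contracted with \<open>\<phi>\<close>. The factor
  \<open>sqrt (fact (length fs))\<close> in \<open>amp\<close> is what keeps this rule free of
  square roots.\<close>

lemma amp_creation:
  assumes "\<Psi> \<in> creation_domain \<phi>"
  shows "amp (creation \<phi> \<Psi>) fs = sum_picks fs (\<lambda>y r. cinner y \<phi> * amp \<Psi> r)"
proof (cases fs)
  case Nil
  show ?thesis
    unfolding Nil amp_def cinner_product_state_Nil coord_creation[OF assms] by simp
next
  case (Cons x xs)
  let ?T = "tensor_product 1 (one_particle \<phi>) \<Psi>"
  define n where "n = length xs"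
  have len: "length fs = Suc n"
    by (simp add: Cons n_def)
  have \<Psi>: "\<Psi> \<in> fock_space"
    using assms by (simp add: creation_domain_def)
  have "((\<lambda>l. sqrt (Suc n) * (cnj (coord (product_state fs) l) * coord (symmetrize ?T) l)) has_sum
      cinner (product_state fs) (creation \<phi> \<Psi>)) {l. length l = length fs}"
    using has_sum_cinner_product_state[of fs "creation \<phi> \<Psi>"]
    by (rule has_sum_cong[THEN iffD1, rotated])
       (simp add: coord_creation[OF assms] len del: One_nat_def)
  then have "cinner (product_state fs) (creation \<phi> \<Psi>) = sqrt (Suc n) * cinner (product_state fs) (symmetrize ?T)"
    by (rule has_sum_unique) (intro has_sum_cmult_right has_sum_cinner_product_state)
  also have "cinner (product_state fs) (symmetrize ?T)
      = sum_picks fs (\<lambda>y r. permsum (\<lambda>t. cinner (product_state (y # t)) ?T) r) / fact (Suc n)"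
    unfolding cinner_product_state_symmetrize Cons permsum_rec by (simp add: n_def)
  also have "sum_picks fs (\<lambda>y r. permsum (\<lambda>t. cinner (product_state (y # t)) ?T) r)
      = sum_picks fs (\<lambda>y r. fact n / sqrt (fact n) * (cinner y \<phi> * amp \<Psi> r))"
  proof (rule sum_picks_cong)
    fix y r
    assume "mset fs = add_mset y (mset r)"
    then have "length r = n"
      using len by (metis Suc_inject size_add_mset size_mset)
    moreover have "permsum (\<lambda>t. cinner (product_state t) \<Psi>) r = of_nat (fact (length r)) * cinner (product_state r) \<Psi>"
      by (rule permsum_invariant) (rule cinner_product_state_mset[OF \<Psi>])
    ultimately show "permsum (\<lambda>t. cinner (product_state (y # t)) ?T) r
        = fact n / sqrt (fact n) * (cinner y \<phi> * amp \<Psi> r)"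
      by (simp add: cinner_product_state_tensor permsum_cmult amp_def del: product_state.simps One_nat_def)
  qed
  finally have "amp (creation \<phi> \<Psi>) fs = complex_of_real (sqrt (fact (Suc n)) * sqrt (Suc n) / fact (Suc n)
      * (fact n / sqrt (fact n))) * sum_picks fs (\<lambda>y r. cinner y \<phi> * amp \<Psi> r)"
    unfolding amp_def[of "creation _ _"] len sum_picks_cmult by (simp add: mult_ac del: fact_Suc of_nat_Suc)
  also have "sqrt (fact (Suc n)) * sqrt (Suc n) / fact (Suc n) * (fact n / sqrt (fact n)) = 1"
    by (simp add: real_sqrt_mult)
  finally show ?thesis by simp
qed

section \<open>Number states\<close>

abbreviation \<N> :: "(nat \<Rightarrow> nat) set" where "\<N> \<equiv> occupation_numbers"

text \<open>A definite particle number makes the square root in \<open>creation_coord\<close>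
  constant on the support, so such a vector lies in every creation domain although creation is
  unbounded.\<close>

definition particle_state :: "'i list ell2 \<Rightarrow> bool" where
  "particle_state \<Psi> \<longleftrightarrow> \<Psi> \<in> fock_space \<and> (\<exists>N. \<forall>l. length l \<noteq> N \<longrightarrow> coord \<Psi> l = 0)"

lemma particle_state_vacuum: "particle_state vacuum"
  unfolding particle_state_def
  by (intro conjI exI[of _ 0] vacuum_in_fock_space) (auto simp: vacuum_def ket.rep_eq)

lemma particle_state_scaleC: "particle_state \<Psi> \<Longrightarrow> particle_state (c *\<^sub>C \<Psi>)"
  unfolding particle_state_def by (auto simp: fock_space_scaleC scaleC.rep_eq)

lemma coord_symmetrize_tensor_zero:
  assumes "\<And>l. length l \<noteq> N \<Longrightarrow> coord \<Psi> l = 0" "length l \<noteq> Suc N"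
  shows "coord (symmetrize (tensor_product 1 (one_particle \<phi>) \<Psi>)) l = 0"
proof -
  have "permsum (coord (tensor_product 1 (one_particle \<phi>) \<Psi>)) l = permsum (\<lambda>_. 0) l"
  proof (rule permsum_cong)
    fix t assume "mset t = mset l"
    then have "length t \<noteq> Suc N"
      using assms(2) by (metis size_mset)
    then show "coord (tensor_product 1 (one_particle \<phi>) \<Psi>) t = 0"
      by (auto simp: coord_tensor_one_particle assms(1) simp del: One_nat_def split: list.splits)
  qed
  then show ?thesis
    by (simp add: coord_symmetrize permsum_def)
qed

lemma particle_state_creation:
  assumes "particle_state \<Psi>"
  shows "\<Psi> \<in> creation_domain \<phi>" "particle_state (creation \<phi> \<Psi>)"
proof -
  obtain N where N: "\<And>l. length l \<noteq> N \<Longrightarrow> coord \<Psi> l = 0"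
    using assms unfolding particle_state_def by blast
  note zero = coord_symmetrize_tensor_zero[of N, OF N]
  let ?X = "complex_of_real (sqrt (Suc N)) *\<^sub>C symmetrize (tensor_product 1 (one_particle \<phi>) \<Psi>)"
  have "creation_coord \<phi> \<Psi> l = coord ?X l" for l
    using zero[of l] by (cases "length l = Suc N") (simp_all add: creation_coord_def scaleC.rep_eq)
  then have "creation_coord \<phi> \<Psi> = coord ?X"
    by blast
  then show dom: "\<Psi> \<in> creation_domain \<phi>"
    using assms by (simp add: creation_domain_def particle_state_def)
  show "particle_state (creation \<phi> \<Psi>)"
    unfolding particle_state_def
    by (intro conjI exI[of _ "Suc N"] creation_in_fock_space[OF dom])
       (simp add: coord_creation[OF dom] zero del: One_nat_def)
qed

lemma symmetrize_scaleC: "symmetrize (c *\<^sub>C \<Psi>) = c *\<^sub>C symmetrize \<Psi>"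
  by (simp add: ell2_eq_iff symmetrize.rep_eq scaleC.rep_eq sum_distrib_left)

lemma tensor_product_scaleC: "tensor_product p x (c *\<^sub>C y) = c *\<^sub>C tensor_product p x y"
  by (simp add: ell2_eq_iff tensor_product.rep_eq scaleC.rep_eq)

lemma creation_scaleC:
  assumes "particle_state \<Psi>"
  shows "creation \<phi> (c *\<^sub>C \<Psi>) = c *\<^sub>C creation \<phi> \<Psi>"
proof -
  have "c *\<^sub>C \<Psi> \<in> creation_domain \<phi>" "\<Psi> \<in> creation_domain \<phi>"
    using assms particle_state_scaleC particle_state_creation(1) by blast+
  then show ?thesis
    by (simp add: ell2_eq_iff coord_creation scaleC.rep_eq tensor_product_scaleC symmetrize_scaleC)
qed

lemma particle_state_number_state: "particle_state (number_state \<phi> n)"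
proof -
  have pow: "particle_state ((creation f ^^ k) \<Psi>)" if "particle_state \<Psi>" for f :: "'a ell2" and k \<Psi>
    by (induction k) (auto simp: that particle_state_creation)
  have "particle_state (foldr (\<lambda>i \<Psi>. (1 / sqrt (fact (n i))) *\<^sub>C (creation (\<phi> i) ^^ n i) \<Psi>) is vacuum)" for "is"
    by (induction "is") (simp_all add: particle_state_vacuum particle_state_scaleC pow)
  then show ?thesis
    unfolding number_state_def .
qed

lemma occupation_numbers_upd: "n \<in> \<N> \<Longrightarrow> n(i := k) \<in> \<N>"
  unfolding occupation_numbers_def
  by (auto intro: finite_subset[of _ "insert i {i. n i \<noteq> 0}"])

lemma zero_occupation_numbers: "(\<lambda>_. 0) \<in> \<N>"
  by (simp add: occupation_numbers_def)

lemma number_state_zero: "number_state \<phi> (\<lambda>_. 0) = vacuum"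
  by (simp add: number_state_def)

text \<open>\<open>foldr\<close> applies the creation of the lowest occupied mode last, so quanta
  can be split off directly only from a mode below which nothing is occupied.\<close>

lemma number_state_split:
  assumes n: "n \<in> \<N>" and i: "\<And>j. j < i \<Longrightarrow> n j = 0"
  shows "number_state \<phi> n = (1 / sqrt (fact (n i))) *\<^sub>C (creation (\<phi> i) ^^ n i) (number_state \<phi> (n(i := 0)))"
proof (cases "n i = 0")
  case True
  then have "n(i := 0) = n" by auto
  then show ?thesis using True by simp
next
  case False
  let ?A = "{j. n j \<noteq> 0}"
  have fin: "finite ?A" and iA: "i \<in> ?A"
    using n False by (auto simp: occupation_numbers_def)
  have min: "Min ?A = i"
    by (rule Min_eqI) (use fin iA i in \<open>auto simp: not_less[symmetric]\<close>)
  have "sorted_list_of_set ?A = i # sorted_list_of_set (?A - {i})"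
    using sorted_list_of_set_nonempty[OF fin] iA min by auto
  moreover have "{j. (n(i := 0)) j \<noteq> 0} = ?A - {i}"
    by auto
  moreover have "foldr (\<lambda>j \<Psi>. (1 / sqrt (fact (n j))) *\<^sub>C (creation (\<phi> j) ^^ n j) \<Psi>) (sorted_list_of_set (?A - {i})) vacuum
    = foldr (\<lambda>j \<Psi>. (1 / sqrt (fact ((n(i := 0)) j))) *\<^sub>C (creation (\<phi> j) ^^ (n(i := 0)) j) \<Psi>) (sorted_list_of_set (?A - {i})) vacuum"
    by (rule foldr_cong) (use fin in auto)
  ultimately show ?thesis
    by (simp add: number_state_def)
qed

lemma number_state_Suc:
  assumes n: "n \<in> \<N>" and i: "\<And>j. j < i \<Longrightarrow> n j = 0"
  shows "creation (\<phi> i) (number_state \<phi> n) = sqrt (Suc (n i)) *\<^sub>C number_state \<phi> (n(i := Suc (n i)))"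
proof -
  define k where "k = n i"
  define Y where "Y = (creation (\<phi> i) ^^ k) (number_state \<phi> (n(i := 0)))"
  have Y: "particle_state Y"
    unfolding Y_def by (induction k) (auto simp: particle_state_creation particle_state_number_state)
  have 1: "number_state \<phi> n = (1 / sqrt (fact k)) *\<^sub>C Y"
    using number_state_split[OF n, of i \<phi>, OF i] by (simp add: k_def Y_def)
  have "number_state \<phi> (n(i := Suc k)) = (1 / sqrt (fact (Suc k))) *\<^sub>C creation (\<phi> i) Y"
    using number_state_split[OF occupation_numbers_upd[OF n, of i "Suc k"], of i \<phi>] i by (simp add: Y_def)
  moreover have "sqrt (Suc k) * (1 / sqrt (fact (Suc k))) = 1 / sqrt (fact k)"
    by (simp add: real_sqrt_mult)
  ultimately show ?thesis
    unfolding 1 creation_scaleC[OF Y] k_def[symmetric]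
    by (simp only: complex_ell2.scale_scale of_real_mult[symmetric])
qed

text \<open>Quanta are added from the highest mode downwards, to match the side condition of
  \<open>number_state_Suc\<close>; accordingly the quantum removed in the proof belongs to the least
  occupied mode.\<close>

lemma occupation_induct [consumes 1, case_names zero Suc]:
  assumes "n \<in> \<N>" "P (\<lambda>_. 0)"
    "\<And>n i. n \<in> \<N> \<Longrightarrow> (\<And>j. j < i \<Longrightarrow> n j = 0) \<Longrightarrow> P n \<Longrightarrow> P (n(i := Suc (n i)))"
  shows "P n"
  using assms(1)
proof (induction "\<Sum>i | n i \<noteq> 0. n i" arbitrary: n rule: less_induct)
  case less
  show ?case
  proof (cases "n = (\<lambda>_. 0)")
    case False
    then obtain j where "n j \<noteq> 0" by auto
    define i where "i = (LEAST i. n i \<noteq> 0)"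
    have i: "n i \<noteq> 0"
      unfolding i_def by (rule LeastI) (rule \<open>n j \<noteq> 0\<close>)
    have min: "n j = 0" if "j < i" for j
      using that not_less_Least[of j "\<lambda>i. n i \<noteq> 0"] unfolding i_def by blast
    define n' where "n' = n(i := n i - 1)"
    have n': "n' \<in> \<N>"
      unfolding n'_def by (rule occupation_numbers_upd) (rule less.prems)
    have fin: "finite {i. n i \<noteq> 0}"
      using less.prems by (simp add: occupation_numbers_def)
    have "(\<Sum>i | n' i \<noteq> 0. n' i) = (\<Sum>i | n i \<noteq> 0. n' i)"
      by (rule sum.mono_neutral_left) (use fin in \<open>auto simp: n'_def\<close>)
    also have "\<dots> < (\<Sum>i | n i \<noteq> 0. n i)"
      by (rule sum_strict_mono_ex1) (use fin i in \<open>auto simp: n'_def\<close>)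
    finally have "P n'"
      using less.hyps n' by blast
    then have "P (n'(i := Suc (n' i)))"
      by (intro assms(3) n') (auto simp: n'_def min)
    moreover have "n'(i := Suc (n' i)) = n"
      using i by (auto simp: n'_def)
    ultimately show ?thesis by simp
  qed (use assms(2) in simp)
qed

section \<open>Exponentials of two-particle states\<close>

definition pair_amp :: "'i list ell2 \<Rightarrow> 'i ell2 \<Rightarrow> 'i ell2 \<Rightarrow> complex" where
  "pair_amp \<epsilon> f g = cinner (product_state [f, g]) \<epsilon>"

text \<open>Contraction touches only the first entry, so a proportionality that is uniform in that
  entry survives it.\<close>

lemma coord_contract_nested:
  assumes "\<And>a. coord (cons_split T) (a, l) = c * coord (cons_split U) (a, l')"
  shows "coord (contract f T) l = c * coord (contract f U) l'"
proof -
  have "slice_snd l (cons_split T) = c *\<^sub>C slice_snd l' (cons_split U)"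
    by (simp add: ell2_eq_iff slice_snd.rep_eq scaleC.rep_eq assms)
  then show ?thesis
    by (simp add: coord_contract cinner_scaleC_right)
qed

lemma cinner_product_state_two_particle:
  "cinner (product_state (f # g # t)) (tensor_product 2 \<epsilon> \<Psi>) = pair_amp \<epsilon> f g * cinner (product_state t) \<Psi>"
proof -
  let ?T = "tensor_product 2 \<epsilon> \<Psi>"
  have "coord (contract f ?T) (a # l) = coord \<Psi> l * coord (contract f \<epsilon>) [a]" for a l
    by (rule coord_contract_nested) (simp add: cons_split.rep_eq tensor_product.rep_eq)
  then have "coord (contract g (contract f ?T)) l = coord \<Psi> l * coord (contract g (contract f \<epsilon>)) []" for l
    by (intro coord_contract_nested) (simp add: cons_split.rep_eq)
  then have "contract g (contract f ?T) = pair_amp \<epsilon> f g *\<^sub>C \<Psi>"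
    unfolding pair_amp_def cinner_product_state_Cons cinner_product_state_Nil
    by (simp add: ell2_eq_iff scaleC.rep_eq)
  then show ?thesis
    by (simp add: cinner_product_state_Cons cinner_scaleC_right del: product_state.simps)
qed

lemma cinner_product_state_two_particle_short:
  "cinner (product_state []) (tensor_product 2 \<epsilon> \<Psi>) = 0"
  "cinner (product_state [f]) (tensor_product 2 \<epsilon> \<Psi>) = 0"
proof -
  show "cinner (product_state []) (tensor_product 2 \<epsilon> \<Psi>) = 0"
    unfolding cinner_product_state_Nil by (simp add: tensor_product.rep_eq)
  have "coord (contract f (tensor_product 2 \<epsilon> \<Psi>)) [] = 0 * coord (contract f (tensor_product 2 \<epsilon> \<Psi>)) []"
    by (rule coord_contract_nested) (simp add: cons_split.rep_eq tensor_product.rep_eq)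
  then show "cinner (product_state [f]) (tensor_product 2 \<epsilon> \<Psi>) = 0"
    unfolding cinner_product_state_Cons cinner_product_state_Nil by simp
qed

(* The hafnian of the pair amplitudes, up to a combinatorial factor. *)
definition pair_hafnian :: "'i list ell2 \<Rightarrow> nat \<Rightarrow> 'i ell2 list \<Rightarrow> complex" where
  "pair_hafnian \<epsilon> n = permsum (\<lambda>t. cinner (product_state t) (two_particle_power \<epsilon> n))"

text \<open>The first factor \<open>\<epsilon>\<close> of the power takes the first two entries of
  the permuted list, which can be any ordered pair from \<open>fs\<close>; the remaining entries
  feed the other \<open>n\<close> factors.\<close>

lemma pair_hafnian_Suc:
  "pair_hafnian \<epsilon> (Suc n) fs = sum_picks fs (\<lambda>g r. sum_picks r (\<lambda>h s. pair_amp \<epsilon> g h * pair_hafnian \<epsilon> n s))"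
proof (cases fs)
  case Nil
  then show ?thesis
    using cinner_product_state_two_particle_short(1)
    by (simp add: pair_hafnian_def permsum_Nil del: product_state.simps)
next
  case (Cons f gs)
  have "pair_hafnian \<epsilon> (Suc n) fs = sum_picks fs (\<lambda>g r. permsum (\<lambda>t. cinner (product_state (g # t)) (tensor_product 2 \<epsilon> (two_particle_power \<epsilon> n))) r)"
    unfolding pair_hafnian_def Cons permsum_rec by simp
  also have "\<dots> = sum_picks fs (\<lambda>g r. sum_picks r (\<lambda>h s. pair_amp \<epsilon> g h * pair_hafnian \<epsilon> n s))"
  proof (rule sum_picks_cong)
    fix g r
    show "permsum (\<lambda>t. cinner (product_state (g # t)) (tensor_product 2 \<epsilon> (two_particle_power \<epsilon> n))) r
        = sum_picks r (\<lambda>h s. pair_amp \<epsilon> g h * pair_hafnian \<epsilon> n s)"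
    proof (cases r)
      case Nil
      then show ?thesis
        using cinner_product_state_two_particle_short(2) by (simp add: permsum_Nil del: product_state.simps)
    next
      case (Cons h s)
      show ?thesis
        unfolding Cons permsum_rec
        unfolding cinner_product_state_two_particle permsum_cmult pair_hafnian_def ..
    qed
  qed
  finally show ?thesis .
qed

text \<open>\<open>f\<close> can sit in any of the \<open>n + 1\<close> pairs and in either of the
  two slots, and symmetry of the pair amplitude makes all these contributions equal; hence the
  constant.\<close>

lemma pair_hafnian_rec:
  assumes "\<And>f g. pair_amp \<epsilon> f g = pair_amp \<epsilon> g f"
  shows "pair_hafnian \<epsilon> (Suc n) (f # fs)
    = 2 * of_nat (Suc n) * sum_picks fs (\<lambda>y r. pair_amp \<epsilon> f y * pair_hafnian \<epsilon> n r)"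
proof (induction n arbitrary: fs)
  case 0
  have zero: "pair_hafnian \<epsilon> 0 (f # s) = 0" for s
  proof -
    have "permsum (\<lambda>t. cinner (product_state t) vacuum) (f # s) = permsum (\<lambda>t. 0) (f # s)"
    proof (rule permsum_cong)
      fix t :: "'a ell2 list"
      assume "mset t = mset (f # s)"
      then have "t \<noteq> []" by auto
      then show "cinner (product_state t) vacuum = 0"
        using amp_vacuum[of t] by (simp add: amp_def)
    qed
    then show ?thesis
      by (simp add: pair_hafnian_def permsum_def)
  qed
  have "pair_hafnian \<epsilon> (Suc 0) (f # fs) = sum_picks fs (\<lambda>h s. pair_amp \<epsilon> f h * pair_hafnian \<epsilon> 0 s)
      + sum_picks fs (\<lambda>g r. pair_amp \<epsilon> g f * pair_hafnian \<epsilon> 0 r)"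
    unfolding pair_hafnian_Suc by (simp add: zero sum_picks_add sum_picks_zero)
  then show ?case
    by (simp add: assms[of _ f])
next
  case (Suc n)
  let ?B = "pair_amp \<epsilon>" and ?h = "pair_hafnian \<epsilon>"
  \<comment> \<open>When \<open>f\<close> is not in the first pair, the induction hypothesis finds
    its partner \<open>k\<close> among the later picks; two exchanges of picks bring
    \<open>k\<close> to the outside.\<close>
  have "sum_picks fs (\<lambda>g r. sum_picks r (\<lambda>h s. ?B g h * ?h (Suc n) (f # s)))
      = sum_picks fs (\<lambda>g r. sum_picks r (\<lambda>h s. sum_picks s (\<lambda>k u. 2 * of_nat (Suc n) * (?B g h * ?B f k * ?h n u))))"
    unfolding Suc.IH by (simp add: sum_picks_cmult[symmetric] mult_ac)
  also have "\<dots> = sum_picks fs (\<lambda>g r. sum_picks r (\<lambda>k s. sum_picks s (\<lambda>h u. 2 * of_nat (Suc n) * (?B g h * ?B f k * ?h n u))))"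
    by (subst sum_picks_swap) (rule refl)
  also have "\<dots> = sum_picks fs (\<lambda>k r. sum_picks r (\<lambda>g s. sum_picks s (\<lambda>h u. 2 * of_nat (Suc n) * (?B g h * ?B f k * ?h n u))))"
    by (rule sum_picks_swap)
  also have "\<dots> = 2 * of_nat (Suc n) * sum_picks fs (\<lambda>k r. ?B f k * ?h (Suc n) r)"
    unfolding pair_hafnian_Suc by (simp add: sum_picks_cmult[symmetric] mult_ac)
  finally have "sum_picks fs (\<lambda>g r. sum_picks r (\<lambda>h s. ?B g h * ?h (Suc n) (f # s)))
      = 2 * of_nat (Suc n) * sum_picks fs (\<lambda>k r. ?B f k * ?h (Suc n) r)" .
  moreover have "?h (Suc (Suc n)) (f # fs) = 2 * sum_picks fs (\<lambda>y r. ?B f y * ?h (Suc n) r)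
      + sum_picks fs (\<lambda>g r. sum_picks r (\<lambda>h s. ?B g h * ?h (Suc n) (f # s)))"
    unfolding pair_hafnian_Suc[of _ "Suc n"] by (simp add: sum_picks_add assms[of _ f])
  ultimately show ?case
    by (simp add: distrib_right)
qed

lemma pair_hafnian_eq_0:
  assumes "length fs \<noteq> 2 * n"
  shows "pair_hafnian \<epsilon> n fs = 0"
proof -
  have supp: "coord (two_particle_power \<epsilon> n) l = 0" if "length l \<noteq> 2 * n" for l
    using that by (induction n arbitrary: l) (auto simp: vacuum_def ket.rep_eq tensor_product.rep_eq)
  have "pair_hafnian \<epsilon> n fs = permsum (\<lambda>t. 0) fs"
    unfolding pair_hafnian_def
  proof (rule permsum_cong)
    fix t assume "mset t = mset fs"
    then have "length t \<noteq> 2 * n"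
      using assms by (metis size_mset)
    then have "((\<lambda>l. cnj (coord (product_state t) l) * coord (two_particle_power \<epsilon> n) l) has_sum 0)
        {l. length l = length t}"
      by (intro has_sum_0) (simp add: supp)
    then show "cinner (product_state t) (two_particle_power \<epsilon> n) = 0"
      using has_sum_cinner_product_state has_sum_unique by blast
  qed
  then show ?thesis
    by (simp add: permsum_def)
qed

text \<open>Once \<open>sqrt (fact (2 * n))\<close> is absorbed into \<open>amp\<close>, the
  coefficients N / (2^n n!) are those of an exponential, and the constant 2 (n + 1) of
  \<open>pair_hafnian_rec\<close> is the ratio of consecutive denominators. Annihilating
  \<open>f\<close> thus acts as a derivative of the exponential: it creates the partner of
  \<open>f\<close> in \<open>\<epsilon>\<close>.\<close>

lemma amp_two_particle_exponential:
  fixes N :: complex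
  assumes sum: "((\<lambda>n. (N * sqrt (fact (2 * n)) / (2 ^ n * fact n)) *\<^sub>C symmetrize (two_particle_power \<epsilon> n))
      has_sum \<Psi>) UNIV"
    and sym: "\<And>f g. pair_amp \<epsilon> f g = pair_amp \<epsilon> g f"
  shows "amp \<Psi> (f # fs) = sum_picks fs (\<lambda>y r. pair_amp \<epsilon> f y * amp \<Psi> r)"
proof -
  \<comment> \<open>Only the term whose particle number \<open>2 * n\<close> is
    \<open>length gs\<close> survives. For odd length every term vanishes, so \<open>div\<close>
    gives a formula valid for both parities.\<close>
  have amp: "amp \<Psi> gs = N / (2 ^ k * fact k) * pair_hafnian \<epsilon> k gs" if k: "length gs div 2 = k" for gs k
  proof -
    let ?c = "\<lambda>n. complex_of_real (sqrt (fact (length gs))) *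
      (N * sqrt (fact (2 * n)) / (2 ^ n * fact n) * (pair_hafnian \<epsilon> n gs / fact (length gs)))"
    have "(?c has_sum amp \<Psi> gs) UNIV"
      using has_sum_cmult_right[OF has_sum_cinner_right[OF sum, of "product_state gs"], of "complex_of_real (sqrt (fact (length gs)))"]
      by (simp add: amp_def cinner_scaleC_right cinner_product_state_symmetrize pair_hafnian_def)
    moreover have "(?c has_sum ?c k) UNIV"
      by (rule has_sum_finite_neutralI[of "{k}"]) (use k in \<open>auto intro!: pair_hafnian_eq_0\<close>)
    ultimately have "amp \<Psi> gs = ?c k"
      by (rule has_sum_unique)
    also have "\<dots> = N / (2 ^ k * fact k) * pair_hafnian \<epsilon> k gs"
    proof (cases "length gs = 2 * k")
      case True
      have "complex_of_real (sqrt (fact (2 * k))) * complex_of_real (sqrt (fact (2 * k))) = fact (2 * k)"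
        by (simp flip: of_real_mult)
      then show ?thesis
        unfolding True by (simp add: field_simps)
    qed (simp add: pair_hafnian_eq_0)
    finally show ?thesis .
  qed
  show ?thesis
  proof (cases "even (length fs)")
    case True
    have zero: "pair_hafnian \<epsilon> n (f # fs) = 0" for n
      using True by (intro pair_hafnian_eq_0) (metis even_Suc dvd_triv_left length_Cons)
    have "sum_picks fs (\<lambda>y r. pair_amp \<epsilon> f y * amp \<Psi> r) = sum_picks fs (\<lambda>y r. 0)"
    proof (rule sum_picks_cong)
      fix y r assume "mset fs = add_mset y (mset r)"
      then have "length fs = Suc (length r)" by (metis size_add_mset size_mset)
      then have "pair_hafnian \<epsilon> n r = 0" for n
        using True by (intro pair_hafnian_eq_0) auto
      then show "pair_amp \<epsilon> f y * amp \<Psi> r = 0"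
        using amp[OF refl, of r] by simp
    qed
    then show ?thesis
      using amp[OF refl, of "f # fs"] by (simp add: zero sum_picks_zero)
  next
    case False
    then obtain n where n: "length fs = Suc (2 * n)"
      by (metis oddE Suc_eq_plus1)
    have "amp \<Psi> (f # fs) = N / (2 ^ Suc n * fact (Suc n)) * pair_hafnian \<epsilon> (Suc n) (f # fs)"
      by (rule amp) (simp add: n)
    also have "\<dots> = N / (2 ^ n * fact n) * sum_picks fs (\<lambda>y r. pair_amp \<epsilon> f y * pair_hafnian \<epsilon> n r)"
      unfolding pair_hafnian_rec[OF sym] by (simp add: field_simps del: of_nat_Suc)
    also have "\<dots> = sum_picks fs (\<lambda>y r. pair_amp \<epsilon> f y * amp \<Psi> r)"
      unfolding sum_picks_cmult[symmetric]
    proof (rule sum_picks_cong)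
      fix y r assume "mset fs = add_mset y (mset r)"
      then have "length fs = Suc (length r)" by (metis size_add_mset size_mset)
      then show "N / (2 ^ n * fact n) * (pair_amp \<epsilon> f y * pair_hafnian \<epsilon> n r) = pair_amp \<epsilon> f y * amp \<Psi> r"
        using amp[of r n] n by simp
    qed
    finally show ?thesis .
  qed
qed

text \<open>The factor 2 in \<open>\<epsilon>\<close> cancels the 1/2 of the two-particle
  symmetrization, leaving both assignments of \<open>f\<close> and \<open>g\<close> to
  \<open>\<Lambda> i\<close> and \<open>\<tau> i\<close>.\<close>

lemma has_sum_pair_amp:
  fixes \<epsilon> :: "'a list ell2"
  assumes "((\<lambda>i. (2 * x i) *\<^sub>C symmetrize (tensor_product 1 (one_particle (\<Lambda> i)) (one_particle (\<tau> i)))) has_sum \<epsilon>) UNIV"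
  shows "((\<lambda>i. x i * (cinner f (\<Lambda> i) * cinner g (\<tau> i) + cinner g (\<Lambda> i) * cinner f (\<tau> i)))
    has_sum pair_amp \<epsilon> f g) UNIV"
proof -
  have one: "one_particle h = product_state [h]" for h :: "'a ell2"
  proof -
    have "coord (one_particle h) l = coord (product_state [h]) l" for l
      by (cases l) (simp_all add: one_particle.rep_eq coord_tensor_one_particle vacuum_def ket.rep_eq del: One_nat_def)
    then show ?thesis
      by (simp add: ell2_eq_iff del: product_state.simps)
  qed
  have vac: "cinner (product_state []) (product_state [] :: 'a list ell2) = 1"
    unfolding cinner_product_state_Nil by (simp add: vacuum_def ket.rep_eq)
  have two: "cinner (product_state [f, g]) (product_state [a, b]) = cinner f a * cinner g b" for f g a b :: "'a ell2"
    using cinner_product_state_tensor[of f "[g]" a "product_state [b]"]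
      cinner_product_state_tensor[of g "[]" b "product_state []"] vac by simp
  have sym: "cinner (product_state [f, g]) (symmetrize (tensor_product 1 (one_particle (\<Lambda> i)) (one_particle (\<tau> i))))
      = (cinner f (\<Lambda> i) * cinner g (\<tau> i) + cinner g (\<Lambda> i) * cinner f (\<tau> i)) / 2" for i
  proof -
    have prod: "tensor_product 1 (one_particle (\<Lambda> i)) (one_particle (\<tau> i)) = product_state [\<Lambda> i, \<tau> i]"
      unfolding one[of "\<tau> i"] by simp
    have single: "permsum G [h] = G [h]" for G :: "'a ell2 list \<Rightarrow> complex" and h
      using permsum_rec[of G h "[]"] by (simp add: permsum_Nil)
    have perm: "permsum G [f, g] = G [f, g] + G [g, f]" for G :: "'a ell2 list \<Rightarrow> complex"
      using permsum_rec[of G f "[g]"] by (simp add: single)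
    show ?thesis
      unfolding prod cinner_product_state_symmetrize perm two by simp
  qed
  show ?thesis
    using has_sum_cinner_right[OF assms, of "product_state [f, g]"]
    unfolding cinner_scaleC_right pair_amp_def sym by simp
qed

lemma pair_amp_commute:
  assumes "((\<lambda>i. (2 * x i) *\<^sub>C symmetrize (tensor_product 1 (one_particle (\<Lambda> i)) (one_particle (\<tau> i)))) has_sum \<epsilon>) UNIV"
  shows "pair_amp \<epsilon> f g = pair_amp \<epsilon> g f"
  using has_sum_pair_amp[OF assms, of f g] has_sum_pair_amp[OF assms, of g f]
  by (auto simp: add.commute intro: has_sum_unique)

section \<open>Families generated by creation\<close>

text \<open>The right-hand side of \<open>amp_creation\<close> in abstract form: \<open>c y\<close>
  stands for the overlap of the annihilated mode \<open>y\<close> with the created one.\<close>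

definition create :: "('v \<Rightarrow> complex) \<Rightarrow> ('v list \<Rightarrow> complex) \<Rightarrow> 'v list \<Rightarrow> complex" where
  "create c F l = sum_picks l (\<lambda>y r. c y * F r)"

lemma create_commute: "create c (create d F) = create d (create c F)"
proof
  fix l
  have "create c (create d F) l = sum_picks l (\<lambda>y r. sum_picks r (\<lambda>z s. c y * d z * F s))"
    by (simp add: create_def sum_picks_cmult[symmetric] mult_ac)
  also have "\<dots> = sum_picks l (\<lambda>y r. sum_picks r (\<lambda>z s. c z * d y * F s))"
    by (rule sum_picks_swap)
  also have "\<dots> = create d (create c F) l"
    by (simp add: create_def sum_picks_cmult[symmetric] mult_ac)
  finally show "create c (create d F) l = create d (create c F) l" .
qed

lemma create_Cons: "create c F (f # l) = c f * F l + sum_picks l (\<lambda>y r. c y * F (f # r))"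
  by (simp add: create_def)

lemma create_cmult: "create c (\<lambda>l. a * F l) = (\<lambda>l. a * create c F l)"
  by (auto simp: create_def sum_picks_cmult[symmetric] mult_ac)

text \<open>Only creation in a mode with nothing occupied below it is assumed, as
  \<open>number_state_Suc\<close> supplies it; \<open>create_A\<close> removes the
  restriction.\<close>

locale creation_family =
  fixes A :: "(nat \<Rightarrow> nat) \<Rightarrow> 'v list \<Rightarrow> complex" and c :: "nat \<Rightarrow> 'v \<Rightarrow> complex"
  assumes create_least: "\<And>n i. n \<in> \<N> \<Longrightarrow> (\<And>j. j < i \<Longrightarrow> n j = 0) \<Longrightarrow>
    create (c i) (A n) = (\<lambda>l. sqrt (Suc (n i)) * A (n(i := Suc (n i))) l)"
begin

text \<open>For \<open>i\<close> above \<open>j\<close>, the quantum of the lower mode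
  \<open>j\<close> is written as a creation, \<open>create (c i)\<close> is commuted past it, and
  the nonzero root \<open>?a\<close> is cancelled.\<close>

lemma create_A:
  assumes "n \<in> \<N>"
  shows "create (c i) (A n) = (\<lambda>l. sqrt (Suc (n i)) * A (n(i := Suc (n i))) l)"
  using assms
proof (induction arbitrary: i rule: occupation_induct)
  case zero
  show ?case by (rule create_least) (simp_all add: zero_occupation_numbers)
next
  case (Suc n j)
  show ?case
  proof (cases "i \<le> j")
    case True
    then show ?thesis
      using Suc.hyps by (intro create_least occupation_numbers_upd) auto
  next
    case False
    let ?a = "complex_of_real (sqrt (Suc (n j)))" and ?b = "complex_of_real (sqrt (Suc (n i)))"
    let ?n' = "n(j := Suc (n j))"
    have j: "create (c j) (A n) = (\<lambda>l. ?a * A ?n' l)"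
      using Suc.hyps by (rule create_least)
    have "(\<lambda>l. ?a * create (c i) (A ?n') l) = create (c i) (create (c j) (A n))"
      unfolding j create_cmult ..
    also have "\<dots> = create (c j) (create (c i) (A n))"
      by (rule create_commute)
    also have "\<dots> = (\<lambda>l. ?b * create (c j) (A (n(i := Suc (n i)))) l)"
      unfolding Suc.IH create_cmult ..
    also have "\<dots> = (\<lambda>l. ?b * (?a * A ((n(i := Suc (n i)))(j := Suc (n j))) l))"
      using False Suc.hyps by (subst create_least) (auto intro: occupation_numbers_upd)
    finally have eq: "?a * create (c i) (A ?n') l = ?a * (?b * A ((n(i := Suc (n i)))(j := Suc (n j))) l)" for l
      by (simp add: fun_eq_iff mult_ac)
    have "?a \<noteq> 0" by (simp del: of_nat_Suc)
    then have "create (c i) (A ?n') l = ?b * A ((n(i := Suc (n i)))(j := Suc (n j))) l" for l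
      using eq mult_left_cancel by blast
    then show ?thesis
      using False by (intro ext) (simp add: fun_upd_twist[of i j] fun_upd_other del: fun_upd_apply of_nat_Suc)
  qed
qed

lemma A_Suc_Cons:
  assumes "n \<in> \<N>"
  shows "sqrt (Suc (n i)) * A (n(i := Suc (n i))) (f # l) = c i f * A n l + sum_picks l (\<lambda>y r. c i y * A n (f # r))"
  using create_A[OF assms, of i] create_Cons[of "c i" "A n" f l] by simp

text \<open>An annihilator orthogonal to all created modes commutes with their creation, so a
  relation valid on the vacuum spreads to every \<open>A n\<close>.\<close>

lemma annihilate_orthogonal:
  assumes "n \<in> \<N>" "\<And>i. c i f = 0" "\<And>l. A (\<lambda>_. 0) (f # l) = x * create d (A (\<lambda>_. 0)) l"
  shows "A n (f # l) = x * create d (A n) l"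
  using assms(1)
proof (induction arbitrary: l rule: occupation_induct)
  case (Suc n i)
  let ?a = "complex_of_real (sqrt (Suc (n i)))"
  have "?a * A (n(i := Suc (n i))) (f # l) = sum_picks l (\<lambda>y r. c i y * (x * create d (A n) r))"
    using A_Suc_Cons[OF Suc.hyps(1), of i f l] by (simp add: assms(2) Suc.IH)
  also have "\<dots> = x * create (c i) (create d (A n)) l"
    unfolding create_def[of "c i"] sum_picks_cmult[symmetric] by (simp add: mult_ac)
  also have "\<dots> = ?a * (x * create d (A (n(i := Suc (n i)))) l)"
    unfolding create_commute[of "c i"] create_A[OF Suc.hyps(1)] create_cmult by (simp add: mult_ac)
  finally show ?case
    by (simp del: of_nat_Suc fun_upd_apply)
qed (rule assms(3))

text \<open>Here \<open>f\<close> is dual to mode \<open>j\<close>: commuting its annihilator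
  through the creations leaves one term for each quantum in \<open>j\<close>, and at the end it
  kills the vacuum.\<close>

lemma annihilate_dual:
  assumes "n \<in> \<N>" "\<And>i. c i f = (if i = j then 1 else 0)" "\<And>l. A (\<lambda>_. 0) (f # l) = 0"
  shows "A n (f # l) = sqrt (n j) * A (n(j := n j - 1)) l"
  using assms(1)
proof (induction arbitrary: l rule: occupation_induct)
  case zero
  then show ?case by (simp add: assms(3))
next
  case (Suc n i)
  let ?a = "complex_of_real (sqrt (Suc (n i)))" and ?m = "n(j := n j - 1)"
  have m: "?m \<in> \<N>"
    by (rule occupation_numbers_upd) (rule Suc.hyps)
  have "?a * A (n(i := Suc (n i))) (f # l) = (if i = j then A n l else 0) + sqrt (n j) * create (c i) (A ?m) l"
    using A_Suc_Cons[OF Suc.hyps(1), of i f l]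
    by (simp add: assms(2) Suc.IH create_def sum_picks_cmult[symmetric] mult_ac del: fun_upd_apply)
  also have "\<dots> = ?a * (sqrt ((n(i := Suc (n i))) j) * A ((n(i := Suc (n i)))(j := (n(i := Suc (n i))) j - 1)) l)"
  proof (cases "i = j")
    case True
    \<comment> \<open>For \<open>n j = 0\<close> both sides vanish, so the truncated
      \<open>n j - 1\<close> in \<open>?m\<close> does no harm.\<close>
    have "sqrt (n j) * create (c i) (A ?m) l = n j * A n l"
    proof (cases "n j")
      case (Suc k)
      then have "?m(j := Suc (?m j)) = n" by auto
      then show ?thesis
        using True Suc fun_cong[OF create_A[OF m, of j], of l]
        by (simp add: mult.assoc[symmetric] flip: of_real_mult del: of_nat_Suc)
    qed simp
    moreover have "?a * (sqrt (Suc (n j)) * A n l) = Suc (n j) * A n l"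
      using True by (simp add: mult.assoc[symmetric] flip: of_real_mult del: of_nat_Suc)
    ultimately show ?thesis
      using True by (simp add: algebra_simps)
  next
    case False
    then show ?thesis
      using fun_cong[OF create_A[OF m, of i], of l] by (simp add: fun_upd_twist mult_ac)
  qed
  finally show ?case
    by (simp del: of_nat_Suc fun_upd_apply)
qed

end

section \<open>Sums over lists with one marked entry, and the domains of creation and
  annihilation\<close>

lemma has_sum_Sigma_finite:
  fixes f :: "'a \<times> 'b \<Rightarrow> 'c::{topological_comm_monoid_add, t3_space}"
  assumes "(f has_sum S) (Sigma A B)" "\<And>x. x \<in> A \<Longrightarrow> finite (B x)"
  shows "((\<lambda>x. \<Sum>y\<in>B x. f (x, y)) has_sum S) A"
  by (rule has_sum_SigmaD[OF assms(1)]) (rule has_sum_finite[OF assms(2)])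

lemma summable_on_Sigma_finite_iff:
  fixes f :: "'a \<times> 'b \<Rightarrow> real"
  assumes "\<And>x. x \<in> A \<Longrightarrow> finite (B x)" "\<And>p. f p \<ge> 0"
  shows "f summable_on Sigma A B \<longleftrightarrow> (\<lambda>x. \<Sum>y\<in>B x. f (x, y)) summable_on A"
proof
  assume "f summable_on Sigma A B"
  then show "(\<lambda>x. \<Sum>y\<in>B x. f (x, y)) summable_on A"
    using has_sum_Sigma_finite[where f = f and A = A and B = B] assms(1) by (auto simp: summable_on_def)
next
  assume "(\<lambda>x. \<Sum>y\<in>B x. f (x, y)) summable_on A"
  then show "f summable_on Sigma A B"
    by (rule summable_on_SigmaI[rotated]) (auto intro: has_sum_finite assms)
qed

abbreviation pick_positions :: "'j \<Rightarrow> ('j list \<times> nat) set" where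
  "pick_positions s \<equiv> Sigma UNIV (\<lambda>q. {k. k < length q \<and> q ! k = s})"

lemma bij_betw_insert_pick:
  "bij_betw (\<lambda>(r, k). (take k r @ s # drop k r, k)) (Sigma UNIV (\<lambda>r. {..length r})) (pick_positions s)"
proof (rule bij_betw_byWitness[where f' = "\<lambda>(q, k). (take k q @ drop (Suc k) q, k)"])
  show "\<forall>a\<in>pick_positions s. (\<lambda>(r, k). (take k r @ s # drop k r, k)) ((\<lambda>(q, k). (take k q @ drop (Suc k) q, k)) a) = a"
    by (auto simp: min_def id_take_nth_drop[symmetric])
qed (auto simp: nth_append min_def)

lemma sum_picks_eq_sum:
  "sum_picks q (\<lambda>y r. if y = s then f r else 0) = (\<Sum>k | k < length q \<and> q ! k = s. f (take k q @ drop (Suc k) q))"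
  unfolding sum_picks_index by (rule sum.mono_neutral_cong_right) auto

text \<open>There are \<open>length r + 1\<close> positions at which \<open>s\<close> can be
  inserted, all giving the same value; this number is the ratio of the two factorials.\<close>

lemma sum_insert_pick:
  fixes F :: "'j list \<Rightarrow> 'j list \<Rightarrow> 'c::real_normed_field"
  assumes "\<And>q q' r. mset q = mset q' \<Longrightarrow> F q r = F q' r"
  shows "(\<Sum>k\<le>length r. F (take k r @ s # drop k r) r / fact (Suc (length r))) = F (s # r) r / fact (length r)"
proof -
  have "mset (take k r @ s # drop k r) = mset (s # r)" for k
  proof -
    have "mset (take k r) + mset (drop k r) = mset r"
      by (simp flip: mset_append)
    then show ?thesis by simp
  qed
  then have "F (take k r @ s # drop k r) r = F (s # r) r" for k
    by (rule assms)
  then show ?thesis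
    by (simp add: field_simps del: of_nat_Suc)
qed

lemma summable_on_picks_iff:
  fixes F :: "'j list \<Rightarrow> 'j list \<Rightarrow> real"
  assumes F: "\<And>q q' r. mset q = mset q' \<Longrightarrow> F q r = F q' r" and nonneg: "\<And>q r. F q r \<ge> 0"
  shows "(\<lambda>q. sum_picks q (\<lambda>y r. if y = s then F q r else 0) / fact (length q)) summable_on UNIV
    \<longleftrightarrow> (\<lambda>r. F (s # r) r / fact (length r)) summable_on UNIV"
proof -
  let ?G = "\<lambda>(q, k). F q (take k q @ drop (Suc k) q) / fact (length q)"
  let ?G' = "\<lambda>(r, k). F (take k r @ s # drop k r) r / fact (Suc (length r))"
  have "(\<lambda>q. sum_picks q (\<lambda>y r. if y = s then F q r else 0) / fact (length q)) summable_on UNIV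
      \<longleftrightarrow> ?G summable_on pick_positions s"
    by (subst summable_on_Sigma_finite_iff) (auto simp: nonneg sum_picks_eq_sum sum_divide_distrib)
  also have "\<dots> \<longleftrightarrow> (\<lambda>p. ?G ((\<lambda>(r, k). (take k r @ s # drop k r, k)) p)) summable_on Sigma UNIV (\<lambda>r. {..length r})"
    by (rule summable_on_reindex_bij_betw[OF bij_betw_insert_pick, symmetric])
  also have "\<dots> \<longleftrightarrow> ?G' summable_on Sigma UNIV (\<lambda>r. {..length r})"
    by (rule summable_on_cong) (auto simp: min_def)
  also have "\<dots> \<longleftrightarrow> (\<lambda>r. \<Sum>k\<le>length r. ?G' (r, k)) summable_on UNIV"
    by (rule summable_on_Sigma_finite_iff) (auto simp: nonneg)
  also have "\<dots> \<longleftrightarrow> (\<lambda>r. F (s # r) r / fact (length r)) summable_on UNIV"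
    by (simp only: prod.case sum_insert_pick[of F, OF F])
  finally show ?thesis .
qed

text \<open>Adjointness of creation and annihilation at the level of list sums: the lists with a
  marked \<open>s\<close> are grouped once by the full list and once by the list that is left when
  \<open>s\<close> is removed.\<close>

lemma has_sum_picks:
  fixes F :: "'j list \<Rightarrow> 'j list \<Rightarrow> complex"
  assumes F: "\<And>q q' r. mset q = mset q' \<Longrightarrow> F q r = F q' r"
    and sum: "(\<lambda>r. norm (F (s # r) r / fact (length r))) summable_on UNIV"
  shows "((\<lambda>q. sum_picks q (\<lambda>y r. if y = s then F q r else 0) / fact (length q))
    has_sum (\<Sum>\<^sub>\<infinity>r. F (s # r) r / fact (length r))) UNIV"
proof -
  let ?G = "\<lambda>(q, k). F q (take k q @ drop (Suc k) q) / fact (length q)"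
  let ?G' = "\<lambda>(r, k). F (take k r @ s # drop k r) r / fact (Suc (length r))"
  have nF: "norm (F q r) = norm (F q' r)" if "mset q = mset q'" for q q' r
    using F[OF that, of r] by simp
  have "(\<lambda>r. \<Sum>k\<le>length r. norm (?G' (r, k))) summable_on UNIV"
    using sum by (simp add: norm_divide sum_insert_pick[of "\<lambda>q r. norm (F q r)", OF nF] del: fact_Suc)
  then have "(\<lambda>p. norm (?G' p)) summable_on Sigma UNIV (\<lambda>r. {..length r})"
    by (subst summable_on_Sigma_finite_iff) auto
  then have "?G' summable_on Sigma UNIV (\<lambda>r. {..length r})"
    by (rule abs_summable_summable)
  then obtain S where S: "(?G' has_sum S) (Sigma UNIV (\<lambda>r. {..length r}))"
    by (auto simp: summable_on_def)
  have "((\<lambda>r. \<Sum>k\<le>length r. ?G' (r, k)) has_sum S) UNIV"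
    by (rule has_sum_Sigma_finite[OF S]) auto
  then have "((\<lambda>r. F (s # r) r / fact (length r)) has_sum S) UNIV"
    by (simp only: prod.case sum_insert_pick[of F, OF F])
  then have S': "S = (\<Sum>\<^sub>\<infinity>r. F (s # r) r / fact (length r))"
    by (simp add: infsumI)
  have "((\<lambda>p. ?G ((\<lambda>(r, k). (take k r @ s # drop k r, k)) p)) has_sum S) (Sigma UNIV (\<lambda>r. {..length r}))"
    by (rule has_sum_cong[THEN iffD1, OF _ S]) (auto simp: min_def)
  then have "(?G has_sum S) (pick_positions s)"
    by (rule has_sum_reindex_bij_betw[OF bij_betw_insert_pick, THEN iffD1])
  then have "((\<lambda>q. \<Sum>k | k < length q \<and> q ! k = s. ?G (q, k)) has_sum S) UNIV"
    by (rule has_sum_Sigma_finite) auto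
  then show ?thesis
    by (simp add: sum_picks_eq_sum sum_divide_distrib S')
qed

lemma sum_picks_count:
  fixes C :: "'c::semiring_1"
  shows "sum_picks q (\<lambda>y r. if y = s then C else 0) = of_nat (count (mset q) s) * C"
  by (induction q) (auto simp: distrib_right)

lemma sum_picks_pick_eq:
  fixes f :: "'j list \<Rightarrow> 'c::semiring_1"
  assumes "\<And>q q'. mset q = mset q' \<Longrightarrow> f q = f q'" "mset q = add_mset s (mset r0)"
  shows "sum_picks q (\<lambda>y r. if y = s then f r else 0) = of_nat (count (mset q) s) * f r0"
proof -
  have "sum_picks q (\<lambda>y r. if y = s then f r else 0) = sum_picks q (\<lambda>y r. if y = s then f r0 else 0)"
  proof (rule sum_picks_cong)
    fix y r assume "mset q = add_mset y (mset r)"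
    then have "y = s \<Longrightarrow> mset r = mset r0" using assms(2) by simp
    then show "(if y = s then f r else 0) = (if y = s then f r0 else 0)"
      using assms(1)[of r r0] by auto
  qed
  then show ?thesis by (simp add: sum_picks_count)
qed

lemma sum_picks_pick_notin:
  assumes "s \<notin> set q"
  shows "sum_picks q (\<lambda>y r. if y = s then f r else 0) = 0"
  unfolding sum_picks_eq_sum using assms by (intro sum.neutral) auto

text \<open>Finiteness of the Fock norm in terms of amplitudes; the factorial undoes the square of
  the root in \<open>amp\<close>.\<close>

definition fock_summable :: "('j list \<Rightarrow> complex) \<Rightarrow> bool" where
  "fock_summable \<alpha> \<longleftrightarrow> (\<lambda>q. (cmod (\<alpha> q))\<^sup>2 / fact (length q)) summable_on UNIV"

text \<open>The domain of creation lies in the domain of annihilation: in a fixed mode creation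
  multiplies squared coefficients by n + 1 and annihilation by n. The occupation of \<open>s\<close>
  appears as the count of \<open>s\<close> in the list.\<close>

lemma fock_summable_annihilate:
  assumes sym: "\<And>q q'. mset q = mset q' \<Longrightarrow> \<alpha> q = \<alpha> q'"
    and sum: "fock_summable (\<lambda>q. sum_picks q (\<lambda>y r. if y = s then \<alpha> r else 0))"
  shows "fock_summable (\<lambda>r. \<alpha> (s # r))"
proof -
  let ?n = "\<lambda>q. real (count (mset q) s)" and ?a = "\<lambda>q. (cmod (\<alpha> q))\<^sup>2"
  have eq: "(cmod (sum_picks q (\<lambda>y r. if y = s then \<alpha> r else 0)))\<^sup>2
      = sum_picks q (\<lambda>y r. if y = s then ?n q * ?a r else 0)" for q
  proof (cases "s \<in> set q")
    case True
    then obtain r0 where r0: "mset q = add_mset s (mset r0)"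
      by (metis in_multiset_in_set mset_add ex_mset)
    have "sum_picks q (\<lambda>y r. if y = s then \<alpha> r else 0) = ?n q * \<alpha> r0"
      by (subst sum_picks_pick_eq[OF sym r0]) auto
    moreover have "sum_picks q (\<lambda>y r. if y = s then ?n q * ?a r else 0) = ?n q * (?n q * ?a r0)"
      by (subst sum_picks_pick_eq[of "\<lambda>r. ?n q * ?a r", OF _ r0]) (auto dest: sym)
    ultimately show ?thesis
      by (simp add: norm_mult power_mult_distrib power2_eq_square mult_ac)
  next
    case False
    show ?thesis
      by (simp add: sum_picks_pick_notin[OF False])
  qed
  have "(\<lambda>q. sum_picks q (\<lambda>y r. if y = s then ?n q * ?a r else 0) / fact (length q)) summable_on UNIV"
    using sum unfolding fock_summable_def eq .
  then have "(\<lambda>r. ?n (s # r) * ?a r / fact (length r)) summable_on UNIV"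
    by (subst (asm) summable_on_picks_iff) auto
  \<comment> \<open>This is the inequality n <= n + 1 for the occupation of
    \<open>s\<close>.\<close>
  then have "(\<lambda>r. ?n r * ?a r / fact (length r)) summable_on UNIV"
    by (rule summable_on_comparison_test) (auto intro!: divide_right_mono mult_right_mono)
  then have "(\<lambda>q. sum_picks q (\<lambda>y r. if y = s then ?a q else 0) / fact (length q)) summable_on UNIV"
    by (simp add: sum_picks_count)
  then have "(\<lambda>r. ?a (s # r) / fact (length r)) summable_on UNIV"
    by (subst (asm) summable_on_picks_iff[of "\<lambda>q r. ?a q"]) (auto dest: sym)
  then show ?thesis
    unfolding fock_summable_def .
qed

lemma sqrt_fact_mult_self: "complex_of_real (sqrt (fact n)) * complex_of_real (sqrt (fact n)) = fact n"
  by (simp flip: of_real_mult)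

lemma abs_summable_fock_product:
  assumes "fock_summable \<alpha>" "fock_summable \<beta>"
  shows "(\<lambda>q. norm (\<alpha> q * \<beta> q / fact (length q))) summable_on UNIV"
proof -
  let ?s = "\<lambda>\<alpha> q. \<alpha> q / complex_of_real (sqrt (fact (length q)))"
  have sq: "norm (?s \<alpha> q * ?s \<alpha> q) = (cmod (\<alpha> q))\<^sup>2 / fact (length q)" for \<alpha> q
    unfolding norm_mult norm_divide by (simp add: power2_eq_square)
  have "?s \<alpha> q * ?s \<beta> q = \<alpha> q * \<beta> q / fact (length q)" for q
    unfolding times_divide_times_eq sqrt_fact_mult_self ..
  moreover have "(\<lambda>q. norm (?s \<alpha> q * ?s \<beta> q)) summable_on UNIV"
    by (rule abs_summable_product) (use assms in \<open>simp_all only: sq fock_summable_def\<close>)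
  ultimately show ?thesis by (simp only:)
qed

lemma fock_summable_cnj: "fock_summable \<alpha> \<Longrightarrow> fock_summable (\<lambda>q. cnj (\<alpha> q))"
  by (simp add: fock_summable_def)

text \<open>The creation acting on \<open>\<beta>\<close> is moved to \<open>\<alpha>\<close> as an
  annihilation. The rearrangement needs absolute convergence, which is why summability is required
  of the annihilated \<open>\<alpha>\<close>.\<close>

lemma has_sum_create_pairing:
  assumes \<alpha>: "\<And>q q'. mset q = mset q' \<Longrightarrow> \<alpha> q = \<alpha> q'"
    and "fock_summable (\<lambda>r. \<alpha> (s # r))" "fock_summable \<beta>"
  shows "((\<lambda>q. sum_picks q (\<lambda>y r. if y = s then \<beta> r else 0) * \<alpha> q / fact (length q))
    has_sum (\<Sum>\<^sub>\<infinity>r. \<beta> r * \<alpha> (s # r) / fact (length r))) UNIV"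
proof -
  have "sum_picks q (\<lambda>y r. if y = s then \<beta> r else 0) * \<alpha> q
      = sum_picks q (\<lambda>y r. if y = s then \<beta> r * \<alpha> q else 0)" for q
    unfolding mult.commute[of _ "\<alpha> q"] sum_picks_cmult[symmetric] by (simp add: mult_delta_right)
  moreover have "((\<lambda>q. sum_picks q (\<lambda>y r. if y = s then \<beta> r * \<alpha> q else 0) / fact (length q))
      has_sum (\<Sum>\<^sub>\<infinity>r. \<beta> r * \<alpha> (s # r) / fact (length r))) UNIV"
    by (rule has_sum_picks[of "\<lambda>q r. \<beta> r * \<alpha> q"])
       (use abs_summable_fock_product[OF assms(3,2)] in \<open>auto dest: \<alpha>\<close>)
  ultimately show ?thesis by simp
qed

section \<open>Amplitudes relative to an orthonormal basis of modes\<close>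

locale fock_basis =
  fixes e :: "'j \<Rightarrow> 'i ell2"
  assumes orthonormal: "orthonormal_family e" and total: "total_family e"
begin

lemma Parseval_amp:
  "((\<lambda>q. cnj (amp \<Psi> (map e q)) * amp \<Phi> (map e q) / fact (length q)) has_sum cinner \<Psi> \<Phi>) UNIV"
proof -
  let ?E = "\<lambda>q. product_state (map e q)"
  have "cinner \<Psi> (?E q) * cinner (?E q) \<Phi> = cnj (amp \<Psi> (map e q)) * amp \<Phi> (map e q) / fact (length q)" for q
    using sqrt_fact_mult_self[of "length q"]
    by (simp add: amp_def cinner_commute[of \<Psi> "?E q"] field_simps)
  then show ?thesis
    using Parseval[OF orthonormal_product_state[OF orthonormal] total_product_state[OF total], of \<Psi> \<Phi>]
    by simp
qed

lemma fock_summable_amp: "fock_summable (\<lambda>q. amp \<Psi> (map e q))"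
proof -
  have "((\<lambda>q. complex_of_real ((cmod (amp \<Psi> (map e q)))\<^sup>2 / fact (length q))) has_sum complex_of_real ((norm \<Psi>)\<^sup>2)) UNIV"
    using Parseval_amp[of \<Psi> \<Psi>] unfolding cnj_mult_self cinner_self_norm by simp
  then show ?thesis
    unfolding fock_summable_def has_sum_of_real_iff by (auto simp: summable_on_def)
qed

lemma amp_eqI:
  fixes \<Psi> \<Phi> :: "'i list ell2"
  assumes "\<And>fs. amp \<Psi> fs = amp \<Phi> fs"
  shows "\<Psi> = \<Phi>"
proof (rule total_familyD[OF total_product_state[OF total]])
  show "cinner (product_state (map e q)) \<Psi> = cinner (product_state (map e q)) \<Phi>" for q
    using assms[of "map e q"] by (simp add: amp_def)
qed

lemma amp_creation_basis:
  assumes "\<Psi> \<in> creation_domain (e s)"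
  shows "amp (creation (e s) \<Psi>) (map e q) = sum_picks q (\<lambda>y r. if y = s then amp \<Psi> (map e r) else 0)"
  unfolding amp_creation[OF assms] sum_picks_map
  by (rule sum_picks_cong) (simp add: orthonormal_familyD[OF orthonormal])

lemma amp_map_mset: "\<Psi> \<in> fock_space \<Longrightarrow> mset q = mset q' \<Longrightarrow> amp \<Psi> (map e q) = amp \<Psi> (map e q')"
  by (rule amp_mset) simp_all

lemma fock_summable_amp_Cons:
  assumes "\<Psi> \<in> creation_domain (e s)"
  shows "fock_summable (\<lambda>r. amp \<Psi> (e s # map e r))"
proof -
  have "\<Psi> \<in> fock_space"
    using assms by (simp add: creation_domain_def)
  then have "fock_summable (\<lambda>r. amp \<Psi> (map e (s # r)))"
    using fock_summable_amp[of "creation (e s) \<Psi>"]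
    by (intro fock_summable_annihilate) (auto simp only: amp_creation_basis[OF assms] intro: amp_map_mset)
  then show ?thesis by simp
qed

text \<open>The adjoint of creation is expressed through amplitudes with one more entry, so that no
  annihilated vector has to be constructed.\<close>

lemma creation_adjoint:
  assumes \<Psi>: "\<Psi> \<in> creation_domain (e s)" and \<Phi>: "\<Phi> \<in> creation_domain (e s)"
  shows "((\<lambda>r. cnj (amp \<Psi> (map e r)) * amp \<Phi> (e s # map e r) / fact (length r))
    has_sum cinner (creation (e s) \<Psi>) \<Phi>) UNIV"
proof -
  let ?f = "\<lambda>r. cnj (amp \<Psi> (map e r)) * amp \<Phi> (e s # map e r) / fact (length r)"
  have "\<Phi> \<in> fock_space"
    using \<Phi> by (simp add: creation_domain_def)
  have c: "cnj (amp (creation (e s) \<Psi>) (map e q)) = sum_picks q (\<lambda>y r. if y = s then cnj (amp \<Psi> (map e r)) else 0)" for q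
    unfolding amp_creation_basis[OF \<Psi>] cnj_sum_picks by (rule sum_picks_cong) simp
  have "((\<lambda>q. cnj (amp (creation (e s) \<Psi>) (map e q)) * amp \<Phi> (map e q) / fact (length q)) has_sum infsum ?f UNIV) UNIV"
    unfolding c list.map(2)[symmetric]
  proof (rule has_sum_create_pairing[of "\<lambda>q. amp \<Phi> (map e q)"])
    show "amp \<Phi> (map e q) = amp \<Phi> (map e q')" if "mset q = mset q'" for q q'
      using \<open>\<Phi> \<in> fock_space\<close> that by (rule amp_map_mset)
    show "fock_summable (\<lambda>r. amp \<Phi> (map e (s # r)))"
      using fock_summable_amp_Cons[OF \<Phi>] by simp
  qed (rule fock_summable_cnj[OF fock_summable_amp])
  then have eq: "infsum ?f UNIV = cinner (creation (e s) \<Psi>) \<Phi>"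
    by (rule has_sum_unique[OF _ Parseval_amp])
  have "(?f has_sum infsum ?f UNIV) UNIV"
    by (rule has_sum_infsum[OF abs_summable_summable[OF abs_summable_fock_product[OF
          fock_summable_cnj[OF fock_summable_amp] fock_summable_amp_Cons[OF \<Phi>]]]])
  then show ?thesis
    unfolding eq .
qed

end

context fock_basis
begin

text \<open>Orthonormality follows from the commutation relations alone: a creation on the left
  becomes an annihilation on the right, and the induction ends at the vacuum.
  \<open>\<gamma> i\<close> combines two basis modes because for the out-states the domain
  conditions concern the two components separately.\<close>

lemma orthonormal_creation_family:
  fixes \<Phi> :: "(nat \<Rightarrow> nat) \<Rightarrow> 'i list ell2" and \<gamma> :: "nat \<Rightarrow> 'i ell2" and u v :: "nat \<Rightarrow> 'j"
  assumes dom: "\<And>n i. n \<in> \<N> \<Longrightarrow> \<Phi> n \<in> creation_domain (e (u i))"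
      "\<And>n i. n \<in> \<N> \<Longrightarrow> \<Phi> n \<in> creation_domain (e (v i))"
    and \<gamma>: "\<And>i. \<gamma> i = a i *\<^sub>C e (u i) + b i *\<^sub>C e (v i)"
    and create: "\<And>n i fs. n \<in> \<N> \<Longrightarrow>
      sqrt (Suc (n i)) * amp (\<Phi> (n(i := Suc (n i)))) fs = sum_picks fs (\<lambda>y r. cinner y (\<gamma> i) * amp (\<Phi> n) r)"
    and annihilate: "\<And>n j fs. n \<in> \<N> \<Longrightarrow>
      amp (\<Phi> n) (\<gamma> j # fs) = sqrt (n j) * amp (\<Phi> (n(j := n j - 1))) fs"
    and vac: "norm (\<Phi> (\<lambda>_. 0)) = 1"
    and "n \<in> \<N>" "n' \<in> \<N>"
  shows "cinner (\<Phi> n) (\<Phi> n') = (if n = n' then 1 else 0)"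
proof -
  have key: "sqrt (Suc (n i)) * cinner (\<Phi> (n(i := Suc (n i)))) (\<Phi> n')
      = sqrt (n' i) * cinner (\<Phi> n) (\<Phi> (n'(i := n' i - 1)))"
    if n: "n \<in> \<N>" and n': "n' \<in> \<N>" for n n' i
  proof -
    have "complex_of_real (sqrt (Suc (n i))) *\<^sub>C \<Phi> (n(i := Suc (n i)))
        = a i *\<^sub>C creation (e (u i)) (\<Phi> n) + b i *\<^sub>C creation (e (v i)) (\<Phi> n)"
    proof (rule amp_eqI)
      fix fs
      show "amp (complex_of_real (sqrt (Suc (n i))) *\<^sub>C \<Phi> (n(i := Suc (n i)))) fs
          = amp (a i *\<^sub>C creation (e (u i)) (\<Phi> n) + b i *\<^sub>C creation (e (v i)) (\<Phi> n)) fs"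
        unfolding amp_scaleC amp_add create[OF n] amp_creation[OF dom(1)[OF n]] amp_creation[OF dom(2)[OF n]]
          sum_picks_cmult[symmetric] sum_picks_add[symmetric] \<gamma> cinner_add_right cinner_scaleC_right
        by (simp only: distrib_right mult.assoc)
    qed
    then have eq: "complex_of_real (sqrt (Suc (n i))) * cinner (\<Phi> (n(i := Suc (n i)))) (\<Phi> n')
        = cnj (a i) * cinner (creation (e (u i)) (\<Phi> n)) (\<Phi> n') + cnj (b i) * cinner (creation (e (v i)) (\<Phi> n)) (\<Phi> n')"
      by (metis cinner_scaleC_left cinner_add_left complex_cnj_complex_of_real)
    have "((\<lambda>r. cnj (amp (\<Phi> n) (map e r)) * amp (\<Phi> n') (\<gamma> i # map e r) / fact (length r)) has_sum
       cnj (a i) * cinner (creation (e (u i)) (\<Phi> n)) (\<Phi> n') + cnj (b i) * cinner (creation (e (v i)) (\<Phi> n)) (\<Phi> n')) UNIV"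
      using has_sum_add[OF has_sum_cmult_right[OF creation_adjoint[OF dom(1)[OF n] dom(1)[OF n']], of "cnj (a i)"]
        has_sum_cmult_right[OF creation_adjoint[OF dom(2)[OF n] dom(2)[OF n']], of "cnj (b i)"], of i i]
      unfolding \<gamma> amp_Cons_add amp_Cons_scaleC
      by (simp only: add_divide_distrib distrib_left mult.left_commute times_divide_eq_right)
    moreover have "((\<lambda>r. cnj (amp (\<Phi> n) (map e r)) * amp (\<Phi> n') (\<gamma> i # map e r) / fact (length r)) has_sum
        sqrt (n' i) * cinner (\<Phi> n) (\<Phi> (n'(i := n' i - 1)))) UNIV"
      using has_sum_cmult_right[OF Parseval_amp[of "\<Phi> n" "\<Phi> (n'(i := n' i - 1))"], of "sqrt (n' i)"]
      unfolding annihilate[OF n'] by (simp only: mult.left_commute times_divide_eq_right)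
    ultimately show ?thesis
      unfolding eq by (rule has_sum_unique)
  qed
  show ?thesis
    using assms(7,8)
  proof (induction arbitrary: n' rule: occupation_induct)
    case zero
    show ?case
    proof (cases "n' = (\<lambda>_. 0)")
      case True
      then show ?thesis
        by (simp add: cinner_self_norm vac)
    next
      case False
      then obtain j where j: "n' j \<noteq> 0" by auto
      let ?m = "n'(j := n' j - 1)"
      have m: "?m \<in> \<N>" "?m(j := Suc (?m j)) = n'"
        using zero.prems j by (auto intro: occupation_numbers_upd)
      have "complex_of_real (sqrt (Suc (?m j))) * cinner (\<Phi> n') (\<Phi> (\<lambda>_. 0)) = 0"
        using key[OF m(1) zero_occupation_numbers, of j] unfolding m(2) by simp
      then have "cinner (\<Phi> n') (\<Phi> (\<lambda>_. 0)) = 0"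
        by (simp del: of_nat_Suc)
      then have "cinner (\<Phi> (\<lambda>_. 0)) (\<Phi> n') = 0"
        unfolding cinner_commute[of "\<Phi> (\<lambda>_. 0)" "\<Phi> n'"] by simp
      then show ?thesis
        using False by simp
    qed
  next
    case (Suc n i)
    let ?m = "n'(i := n' i - 1)"
    have m: "?m \<in> \<N>"
      using Suc.prems by (rule occupation_numbers_upd)
    have eq: "complex_of_real (sqrt (Suc (n i))) * cinner (\<Phi> (n(i := Suc (n i)))) (\<Phi> n')
        = complex_of_real (sqrt (n' i)) * (if n = ?m then 1 else 0)"
      unfolding key[OF Suc.hyps(1) Suc.prems] Suc.IH[OF m] ..
    show ?case
    proof (cases "n(i := Suc (n i)) = n'")
      case True
      then have "n' i = Suc (n i)" "n = ?m" by auto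
      then show ?thesis
        using eq True by (simp del: of_nat_Suc fun_upd_apply)
    next
      case False
      \<comment> \<open>Because of truncated subtraction \<open>n = ?m\<close> can also hold with
        \<open>n' = n\<close> and mode \<open>i\<close> empty; the factor \<open>sqrt (n' i)\<close>
        disposes of that case.\<close>
      then have "n' i = 0 \<or> n \<noteq> ?m" by auto
      then have "complex_of_real (sqrt (Suc (n i))) * cinner (\<Phi> (n(i := Suc (n i)))) (\<Phi> n') = 0"
        unfolding eq by auto
      then show ?thesis
        using False by (simp del: of_nat_Suc fun_upd_apply)
    qed
  qed
qed

end

section \<open>The Fock space of a direct sum\<close>

text \<open>Well-definedness of \<open>fock_merge\<close> rests on the upper bound for this number;
  the exact value makes \<open>fock_merge\<close> isometric.\<close>

lemma card_lefts_rights: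
  "card {l. lefts l = xs \<and> rights l = ys} = (length xs + length ys) choose length xs"
proof -
  have "{l. lefts l = xs \<and> rights l = ys} = shuffles (map Inl xs) (map Inr ys)"
  proof (intro equalityI subsetI)
    fix l :: "('a + 'b) list"
    assume "l \<in> {l. lefts l = xs \<and> rights l = ys}"
    then have "map Inl xs = filter isl l" "map Inr ys = filter (\<lambda>s. \<not> isl s) l"
      by (auto simp: lefts_def rights_def o_def intro!: map_idI)
    then show "l \<in> shuffles (map Inl xs) (map Inr ys)"
      by (metis partition_in_shuffles)
  next
    fix l :: "('a + 'b) list"
    assume "l \<in> shuffles (map Inl xs) (map Inr ys)"
    then have "filter P l \<in> shuffles (filter P (map Inl xs)) (filter P (map Inr ys))" for P
      using filter_shuffles by blast
    from this[of isl] this[of "\<lambda>s. \<not> isl s"]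
    have "filter isl l = map Inl xs" "filter (\<lambda>s. \<not> isl s) l = map Inr ys"
      by (simp_all add: filter_map o_def)
    then show "l \<in> {l. lefts l = xs \<and> rights l = ys}"
      by (simp add: lefts_def rights_def o_def)
  qed
  then show ?thesis
    by (subst \<open>_ = _\<close>, subst card_disjoint_shuffles) auto
qed

abbreviation merges :: "(('a list \<times> 'b list) \<times> ('a + 'b) list) set" where
  "merges \<equiv> Sigma UNIV (\<lambda>p. {l. lefts l = fst p \<and> rights l = snd p})"

lemma bij_betw_merges: "bij_betw (\<lambda>l. ((lefts l, rights l), l)) UNIV merges"
  by (rule bij_betw_byWitness[where f' = snd]) auto

lemma card_merges:
  "card {l. lefts l = fst p \<and> rights l = snd p} = (length (fst p) + length (snd p)) choose length (fst p)"
  by (rule card_lefts_rights)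

text \<open>A pair of lists has \<open>?C p\<close> interleavings, and each carries the weight 1 /
  \<open>?C p\<close> in the inner product.\<close>

lemma cinner_fock_merge: "cinner (fock_merge f) (fock_merge g) = cinner f g"
proof -
  let ?h = "\<lambda>p. cnj (coord f p) * coord g p"
  let ?C = "\<lambda>p::'a list \<times> 'b list. (length (fst p) + length (snd p)) choose length (fst p)"
  let ?H = "\<lambda>(p, l::('a + 'b) list). ?h p / ?C p"
  have C: "?C p \<noteq> 0" for p by simp
  have fin: "finite {l. lefts l = fst p \<and> rights l = snd p}" for p :: "'a list \<times> 'b list"
    by (rule finite_lefts_rights)
  have "(\<lambda>p. norm (?h p)) summable_on UNIV"
    using summable_on_mult_square_summable[of "coord f" "coord g"]
    by (simp add: summable_on_iff_abs_summable_on_complex)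
  then have "(\<lambda>p. \<Sum>l | lefts l = fst p \<and> rights l = snd p. norm (?H (p, l))) summable_on UNIV"
    using C by (simp add: card_merges norm_divide del: binomial_eq_0_iff)
  then have "(\<lambda>p. norm (?H p)) summable_on merges"
    by (subst summable_on_Sigma_finite_iff[OF fin]) auto
  then obtain S where S: "(?H has_sum S) merges"
    using abs_summable_summable summable_on_def by blast
  have "((\<lambda>p. \<Sum>l | lefts l = fst p \<and> rights l = snd p. ?H (p, l)) has_sum S) UNIV"
    by (rule has_sum_Sigma_finite[OF S fin])
  then have "(?h has_sum S) UNIV"
    using C by (simp add: card_merges del: binomial_eq_0_iff)
  then have "S = cinner f g"
    using cinner_has_sum has_sum_unique by blast
  moreover have "((\<lambda>l. ?H ((lefts l, rights l), l)) has_sum S) UNIV"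
    using has_sum_reindex_bij_betw[OF bij_betw_merges, of ?H S] S by simp
  moreover have "?H ((lefts l, rights l), l) = cnj (coord (fock_merge f) l) * coord (fock_merge g) l" for l
  proof -
    have "complex_of_real (sqrt k) * complex_of_real (sqrt k) = k" if "k \<ge> 0" for k
      using that by (simp flip: of_real_mult)
    from this[of "real (length l choose length (lefts l))"] show ?thesis
      by (simp add: fock_merge.rep_eq length_lefts_rights)
  qed
  ultimately show ?thesis
    using cinner_has_sum[of "fock_merge f" "fock_merge g"] has_sum_unique by auto
qed

lemma fock_merge_scaleC: "fock_merge (c *\<^sub>C f) = c *\<^sub>C fock_merge f"
  by (simp add: ell2_eq_iff fock_merge.rep_eq scaleC.rep_eq)

lemma lefts_rights_append [simp]:
  "lefts (map Inl xs @ map Inr ys) = xs" "rights (map Inl xs @ map Inr ys) = ys"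
  by (simp_all add: lefts_def rights_def filter_map o_def)

lemma mset_lefts_rights: "mset (map Inl (lefts l) @ map Inr (rights l)) = mset l"
proof -
  have "map Inl (lefts l) = filter isl l" "map Inr (rights l) = filter (\<lambda>s. \<not> isl s) l"
    by (auto simp: lefts_def rights_def o_def intro!: map_idI)
  then show ?thesis
    by (metis mset_append mset_filter multiset_partition)
qed

text \<open>A symmetric vector is determined by its coordinates on the lists with all left entries
  in front, and these define the preimage.\<close>

lemma fock_merge_surj:
  fixes \<Psi> :: "('a + 'b) list ell2"
  assumes "\<Psi> \<in> fock_space"
  shows "\<exists>f. \<Psi> = fock_merge f"
proof -
  let ?C = "\<lambda>p::'a list \<times> 'b list. (length (fst p) + length (snd p)) choose length (fst p)"
  let ?J = "\<lambda>p::'a list \<times> 'b list. map Inl (fst p) @ map Inr (snd p)"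
  let ?f = "\<lambda>p. complex_of_real (sqrt (?C p)) * coord \<Psi> (?J p)"
  have fin: "finite {l. lefts l = fst p \<and> rights l = snd p}" for p :: "'a list \<times> 'b list"
    by (rule finite_lefts_rights)
  have eq: "coord \<Psi> (?J (lefts l, rights l)) = coord \<Psi> l" for l
    by (rule fock_space_coord_mset[OF assms]) (simp only: fst_conv snd_conv mset_lefts_rights)
  have "(\<lambda>l. (\<lambda>(p, l). (cmod (coord \<Psi> (?J p)))\<^sup>2) ((lefts l, rights l), l)) summable_on UNIV"
    using square_summable_coord[of \<Psi>] unfolding square_summable_def prod.case eq .
  then have "(\<lambda>(p, l). (cmod (coord \<Psi> (?J p)))\<^sup>2) summable_on merges"
    using summable_on_reindex_bij_betw[OF bij_betw_merges, of "\<lambda>(p, l). (cmod (coord \<Psi> (?J p)))\<^sup>2"] by simp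
  then have "(\<lambda>p. \<Sum>l | lefts l = fst p \<and> rights l = snd p. (cmod (coord \<Psi> (?J p)))\<^sup>2) summable_on UNIV"
    by (subst (asm) summable_on_Sigma_finite_iff[OF fin]) auto
  then have "square_summable ?f"
    unfolding square_summable_def by (simp add: card_merges norm_mult power_mult_distrib)
  then have f: "coord (Abs_ell2 ?f) = ?f"
    by (simp add: Abs_ell2_inverse)
  have "coord \<Psi> l = coord (fock_merge (Abs_ell2 ?f)) l" for l
  proof -
    have "length (lefts l) \<le> length l"
      using length_lefts_rights[of l] by linarith
    then have "length l choose length (lefts l) \<noteq> 0" by simp
    then show ?thesis
      unfolding fock_merge.rep_eq f using eq[of l] by (simp add: length_lefts_rights del: binomial_eq_0_iff)
  qed
  then have "\<Psi> = fock_merge (Abs_ell2 ?f)"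
    unfolding ell2_eq_iff by blast
  then show ?thesis
    by (rule exI)
qed

lemma coord_direct_sum [simp]:
  "coord (direct_sum f g) (Inl a) = coord f a" "coord (direct_sum f g) (Inr b) = coord g b"
  by (simp_all add: direct_sum.rep_eq)

lemma cinner_direct_sum: "cinner (direct_sum f g) (direct_sum f' g') = cinner f f' + cinner g g'"
proof -
  let ?F = "\<lambda>s. cnj (coord (direct_sum f g) s) * coord (direct_sum f' g') s"
  have "(?F has_sum cinner f f') (range Inl)" "(?F has_sum cinner g g') (range Inr)"
    using cinner_has_sum[of f f'] cinner_has_sum[of g g'] by (simp_all add: has_sum_reindex o_def)
  then have "(?F has_sum cinner f f' + cinner g g') (range Inl \<union> range Inr)"
    by (rule has_sum_Un_disjoint) auto
  then show ?thesis
    using cinner_has_sum has_sum_unique UNIV_sum by metis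
qed

lemma fock_basis_direct_sum:
  assumes "fock_basis e" "fock_basis h"
  shows "fock_basis (case_sum (\<lambda>i. direct_sum (e i) 0) (\<lambda>i. direct_sum 0 (h i)))"
proof
  interpret e: fock_basis e by fact
  interpret h: fock_basis h by fact
  let ?b = "case_sum (\<lambda>i. direct_sum (e i) 0) (\<lambda>i. direct_sum 0 (h i))"
  show "orthonormal_family ?b"
    unfolding orthonormal_family_def
    by (auto simp: cinner_direct_sum orthonormal_familyD[OF e.orthonormal]
        orthonormal_familyD[OF h.orthonormal] split: sum.splits)
  show "total_family ?b"
    unfolding total_family_def
  proof (intro allI impI)
    fix x
    assume x: "\<forall>j. cinner (?b j) x = 0"
    have sq: "square_summable (\<lambda>a. coord x (Inl a))" "square_summable (\<lambda>b. coord x (Inr b))"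
      by (rule square_summable_comp_inj[of "coord x" Inl UNIV], auto)
         (rule square_summable_comp_inj[of "coord x" Inr UNIV], auto)
    define f where "f = Abs_ell2 (\<lambda>a. coord x (Inl a))"
    define g where "g = Abs_ell2 (\<lambda>b. coord x (Inr b))"
    have "coord (direct_sum f g) s = coord x s" for s
      by (cases s) (simp_all add: f_def g_def Abs_ell2_inverse sq)
    then have fg: "x = direct_sum f g"
      by (simp add: ell2_eq_iff)
    have "cinner (e i) f = 0" for i
      using x[rule_format, of "Inl i"] by (simp add: fg cinner_direct_sum)
    moreover have "cinner (h i) g = 0" for i
      using x[rule_format, of "Inr i"] by (simp add: fg cinner_direct_sum)
    ultimately have "f = 0" "g = 0"
      using e.total h.total by (auto simp: total_family_def)
    then have "coord x s = 0" for s
      by (cases s) (simp_all add: fg zero_ell2.rep_eq)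
    then show "x = 0"
      by (simp add: ell2_eq_iff zero_ell2.rep_eq)
  qed
qed

lemma coord_product_state_Cons:
  "coord (product_state (f # fs)) l = (case l of [] \<Rightarrow> 0 | a # l' \<Rightarrow> coord f a * coord (product_state fs) l')"
  by (simp only: product_state.simps coord_tensor_one_particle)

lemma coord_product_state_direct_sum:
  "coord (product_state (map (\<lambda>f. direct_sum f 0) p @ map (\<lambda>g. direct_sum 0 g) q)) (map Inl xs @ map Inr ys)
    = coord (product_state p) xs * coord (product_state q) ys"
proof (induction p arbitrary: xs)
  case Nil
  have "coord (product_state (map (\<lambda>g. direct_sum 0 g) q)) (map Inr ys) = coord (product_state q) ys"
    by (induction q arbitrary: ys)
       (auto simp: vacuum_def ket.rep_eq coord_product_state_Cons simp del: product_state.simps(2) split: list.splits)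
  moreover have "coord (product_state (map (\<lambda>g. direct_sum 0 g) q)) (Inl a # l) = 0" for a :: 'a and l
    by (cases q) (auto simp: vacuum_def ket.rep_eq coord_product_state_Cons zero_ell2.rep_eq simp del: product_state.simps(2))
  ultimately show ?case
    by (cases xs) (auto simp: vacuum_def ket.rep_eq)
next
  case (Cons f p)
  show ?case
  proof (cases xs)
    case Nil
    then show ?thesis
      by (cases ys) (simp_all add: coord_product_state_Cons zero_ell2.rep_eq del: product_state.simps)
  next
    case (Cons x xs')
    then show ?thesis
      using Cons.IH[of xs'] by (simp add: coord_product_state_Cons del: product_state.simps)
  qed
qed

lemma coord_product_state_direct_sum_zero:
  assumes "l \<notin> range (\<lambda>(xs, ys). map Inl xs @ map Inr ys)"
  shows "coord (product_state (map (\<lambda>f. direct_sum f 0) p @ map (\<lambda>g. direct_sum 0 g) q)) l = 0"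
  using assms
proof (induction p arbitrary: l)
  case Nil
  have inr: "l \<in> range (map Inr)" if "coord (product_state (map (\<lambda>g. direct_sum 0 g) q)) l \<noteq> 0" for l :: "('a + 'b) list"
    using that
  proof (induction q arbitrary: l)
    case Nil
    then show ?case
      by (auto simp: vacuum_def ket.rep_eq image_iff split: if_splits)
  next
    case (Cons g q)
    then obtain s l' where l: "l = s # l'"
      by (cases l) (auto simp: coord_product_state_Cons simp del: product_state.simps)
    with Cons.prems have "coord (direct_sum 0 g) s \<noteq> 0" "coord (product_state (map (\<lambda>g. direct_sum 0 g) q)) l' \<noteq> 0"
      by (auto simp: coord_product_state_Cons simp del: product_state.simps)
    then obtain b ys where "s = Inr b" "l' = map Inr ys"
      using Cons.IH[of l'] by (cases s) (auto simp: zero_ell2.rep_eq)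
    then have "l = map Inr (b # ys)"
      by (simp add: l)
    then show ?case by blast
  qed
  show ?case
  proof (rule ccontr)
    assume "\<not> ?thesis"
    then obtain ys where "l = map Inr ys"
      using inr[of l] by auto
    then have "l = (\<lambda>(xs, ys). map Inl xs @ map Inr ys) ([], ys)" by simp
    then show False
      using Nil by blast
  qed
next
  case (Cons f p)
  show ?case
  proof (cases l)
    case Nil
    then show ?thesis
      by (simp add: coord_product_state_Cons del: product_state.simps)
  next
    case l: (Cons s l')
    show ?thesis
    proof (cases s)
      case (Inl a)
      have "l' \<notin> range (\<lambda>(xs, ys). map Inl xs @ map Inr ys)"
      proof
        assume "l' \<in> range (\<lambda>(xs, ys). map Inl xs @ map Inr ys)"
        then obtain xs ys where "l' = map Inl xs @ map Inr ys" by auto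
        then have "l = (\<lambda>(xs, ys). map Inl xs @ map Inr ys) (a # xs, ys)"
          using l Inl by simp
        then show False using Cons.prems by blast
      qed
      then show ?thesis
        using Cons.IH[of l'] l by (simp add: coord_product_state_Cons del: product_state.simps)
    next
      case (Inr b)
      then show ?thesis
        using l by (simp add: coord_product_state_Cons zero_ell2.rep_eq del: product_state.simps)
    qed
  qed
qed

text \<open>With the left factors in front, the product state is supported on lists whose left
  entries come first, so only one interleaving of each pair contributes and one binomial root is
  left over.\<close>

lemma cinner_product_state_fock_merge:
  "cinner (product_state (map (\<lambda>f. direct_sum f 0) p @ map (\<lambda>g. direct_sum 0 g) q)) (fock_merge f)
    = cinner (product_state q) (contract_fst (product_state p) f)
      / sqrt ((length p + length q) choose length p)"
proof -
  let ?P = "product_state (map (\<lambda>f. direct_sum f 0) p @ map (\<lambda>g. direct_sum 0 g) q)"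
  let ?J = "\<lambda>(xs, ys). map Inl xs @ map Inr ys :: ('a + 'b) list"
  let ?c = "complex_of_real (sqrt ((length p + length q) choose length p))"
  have inj: "inj ?J"
    by (rule inj_on_inverseI[where g = "\<lambda>l. (lefts l, rights l)"]) auto
  have "((\<lambda>l. cnj (coord ?P l) * coord (fock_merge f) l) has_sum cinner ?P (fock_merge f)) (range ?J)"
    using cinner_has_sum[of ?P "fock_merge f"]
    by (rule has_sum_cong_neutral[THEN iffD1, rotated -1]) (auto simp: coord_product_state_direct_sum_zero)
  then have "((\<lambda>p. cnj (coord ?P (?J p)) * coord (fock_merge f) (?J p)) has_sum cinner ?P (fock_merge f)) UNIV"
    by (subst (asm) has_sum_reindex[OF inj]) (simp add: o_def)
  moreover have "cnj (coord ?P (?J z)) * coord (fock_merge f) (?J z)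
      = cnj (coord (tensor_pair (product_state p) (product_state q)) z) * coord f z / ?c" for z
  proof -
    obtain xs ys where z: "z = (xs, ys)" by force
    show ?thesis
    proof (cases "length xs = length p \<and> length ys = length q")
      case True
      then show ?thesis
        by (simp add: z coord_product_state_direct_sum tensor_pair.rep_eq fock_merge.rep_eq)
    next
      case False
      then have "coord (product_state p) xs * coord (product_state q) ys = 0"
        by (auto simp: coord_product_state)
      then show ?thesis
        by (auto simp: z coord_product_state_direct_sum tensor_pair.rep_eq)
    qed
  qed
  ultimately have "((\<lambda>z. cnj (coord (tensor_pair (product_state p) (product_state q)) z) * coord f z / ?c)
      has_sum cinner ?P (fock_merge f)) UNIV"
    by (simp only:)
  moreover have "((\<lambda>z. cnj (coord (tensor_pair (product_state p) (product_state q)) z) * coord f z / ?c)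
      has_sum cinner (tensor_pair (product_state p) (product_state q)) f / ?c) UNIV"
    using has_sum_cmult_left[OF cinner_has_sum, of "tensor_pair (product_state p) (product_state q)" f "inverse ?c"]
    by (simp add: divide_inverse)
  ultimately have "cinner ?P (fock_merge f) = cinner (tensor_pair (product_state p) (product_state q)) f / ?c"
    by (rule has_sum_unique)
  then show ?thesis
    unfolding cinner_tensor_pair .
qed

text \<open>The binomial root cancels against the factorials in \<open>amp\<close>, so the
  amplitudes on the direct sum separate into a contraction at infinity and an amplitude on the
  horizon.\<close>

lemma amp_fock_merge:
  "amp (fock_merge f) (map (\<lambda>f. direct_sum f 0) p @ map (\<lambda>g. direct_sum 0 g) q)
    = sqrt (fact (length p)) * amp (contract_fst (product_state p) f) q"
proof -
  have "real ((length p + length q) choose length p) = fact (length p + length q) / (fact (length p) * fact (length q))"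
    by (simp add: binomial_fact)
  then have "sqrt (fact (length p + length q)) / sqrt ((length p + length q) choose length p)
      = sqrt (fact (length p)) * sqrt (fact (length q))"
    by (simp add: real_sqrt_divide real_sqrt_mult)
  then have "complex_of_real (sqrt (fact (length p + length q))) / complex_of_real (sqrt ((length p + length q) choose length p))
      = complex_of_real (sqrt (fact (length p))) * complex_of_real (sqrt (fact (length q)))"
    by (metis of_real_divide of_real_mult)
  note eq = this
  have "amp (fock_merge f) (map (\<lambda>f. direct_sum f 0) p @ map (\<lambda>g. direct_sum 0 g) q)
      = complex_of_real (sqrt (fact (length p + length q))) / complex_of_real (sqrt ((length p + length q) choose length p))
        * cinner (product_state q) (contract_fst (product_state p) f)"
    by (simp add: amp_def cinner_product_state_fock_merge)
  then show ?thesis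
    unfolding eq by (simp add: amp_def)
qed

text \<open>With the entries \<open>p\<close> at infinity fixed, these are up to a constant the
  amplitudes of one vector of the second Fock space, namely a contraction.\<close>

lemma (in fock_basis) fock_summable_amp_merge:
  assumes "\<Psi> \<in> fock_space"
  shows "fock_summable (\<lambda>q. amp \<Psi> (map (\<lambda>f. direct_sum f 0) p @ map (\<lambda>i. direct_sum 0 (e i)) q))"
proof -
  obtain f where f: "\<Psi> = fock_merge f"
    using fock_merge_surj[OF assms] by blast
  have "amp \<Psi> (map (\<lambda>f. direct_sum f 0) p @ map (\<lambda>i. direct_sum 0 (e i)) q)
      = amp (complex_of_real (sqrt (fact (length p))) *\<^sub>C contract_fst (product_state p) f) (map e q)" for q
    using amp_fock_merge[of f p "map e q"] by (simp add: f amp_scaleC o_def)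
  then show ?thesis
    using fock_summable_amp by simp
qed

section \<open>Weighted sums of rank-one operators\<close>

text \<open>An unnormalized density operator presented by an ensemble. The vectors need be neither
  orthogonal nor normalized, because a partial trace produces ensembles that are not.\<close>

definition mixture :: "('k \<Rightarrow> real) \<Rightarrow> ('k \<Rightarrow> 'i ell2) \<Rightarrow> 'k set \<Rightarrow> 'i ell2 \<Rightarrow> 'i ell2" where
  "mixture w u K \<psi> = (\<Sum>\<^sub>\<infinity>k\<in>K. (w k * cinner (u k) \<psi>) *\<^sub>C u k)"

locale trace_class_family =
  fixes w :: "'k \<Rightarrow> real" and u :: "'k \<Rightarrow> 'i ell2" and K :: "'k set"
  assumes weight_nonneg: "k \<in> K \<Longrightarrow> w k \<ge> 0"
    and summable_weights: "(\<lambda>k. w k * (norm (u k))\<^sup>2) summable_on K"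
begin

lemma abs_summable_mixture:
  "(\<lambda>k. norm ((w k * cinner (u k) \<psi>) *\<^sub>C u k)) summable_on K"
proof (rule summable_on_comparison_test)
  show "(\<lambda>k. w k * (norm (u k))\<^sup>2 * norm \<psi>) summable_on K"
    by (rule summable_on_cmult_left[OF summable_weights])
  fix k assume k: "k \<in> K"
  have "norm ((w k * cinner (u k) \<psi>) *\<^sub>C u k) = w k * cmod (cinner (u k) \<psi>) * norm (u k)"
    using weight_nonneg[OF k] by (simp add: norm_scaleC norm_mult)
  also have "\<dots> \<le> w k * (norm (u k) * norm \<psi>) * norm (u k)"
    using weight_nonneg[OF k] cinner_Cauchy_Schwarz[of "u k" \<psi>]
    by (intro mult_right_mono mult_left_mono) auto
  finally show "norm ((w k * cinner (u k) \<psi>) *\<^sub>C u k) \<le> w k * (norm (u k))\<^sup>2 * norm \<psi>"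
    by (simp add: power2_eq_square mult_ac)
qed simp

lemma has_sum_mixture: "((\<lambda>k. (w k * cinner (u k) \<psi>) *\<^sub>C u k) has_sum mixture w u K \<psi>) K"
  unfolding mixture_def by (rule has_sum_infsum[OF abs_summable_summable[OF abs_summable_mixture]])

lemma has_sum_cinner_mixture:
  "((\<lambda>k. w k * (cinner \<phi> (u k) * cinner (u k) \<psi>)) has_sum cinner \<phi> (mixture w u K \<psi>)) K"
  using has_sum_cinner_right[OF has_sum_mixture, of \<phi> \<psi>] by (simp add: cinner_scaleC_right mult_ac)

lemma mixture_hermitian: "cinner \<phi> (mixture w u K \<psi>) = cnj (cinner \<psi> (mixture w u K \<phi>))"
proof -
  have "((\<lambda>k. cnj (w k * (cinner \<psi> (u k) * cinner (u k) \<phi>))) has_sum cnj (cinner \<psi> (mixture w u K \<phi>))) K"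
    using has_sum_cinner_mixture[of \<psi> \<phi>] by (simp only: has_sum_cnj_iff)
  moreover have "cnj (w k * (cinner \<psi> (u k) * cinner (u k) \<phi>)) = w k * (cinner \<phi> (u k) * cinner (u k) \<psi>)" for k
    using cinner_commute[of \<psi> "u k"] cinner_commute[of "u k" \<phi>] by (simp add: mult_ac)
  ultimately show ?thesis
    using has_sum_unique[OF has_sum_cinner_mixture] by (simp only:)
qed

text \<open>The squared overlaps form a nonnegative double family, so the sum over the ensemble and
  the sum over the basis may be exchanged.\<close>

lemma trace_mixture:
  assumes "orthonormal_family v" "total_family v"
  shows "((\<lambda>j. cinner (v j) (mixture w u K (v j))) has_sum complex_of_real (\<Sum>\<^sub>\<infinity>k\<in>K. w k * (norm (u k))\<^sup>2)) UNIV"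
proof -
  let ?f = "\<lambda>k j. w k * (cmod (cinner (v j) (u k)))\<^sup>2"
  let ?Z = "\<Sum>\<^sub>\<infinity>k\<in>K. w k * (norm (u k))\<^sup>2"
  have inner: "((\<lambda>j. ?f k j) has_sum w k * (norm (u k))\<^sup>2) UNIV" for k
    by (rule has_sum_cmult_right[OF Parseval_norm[OF assms]])
  have "(\<lambda>(k, j). ?f k j) summable_on K \<times> UNIV"
    by (rule summable_on_SigmaI[OF _ summable_weights]) (use inner weight_nonneg in auto)
  then have "((\<lambda>(k, j). ?f k j) has_sum ?Z) (K \<times> UNIV)"
    using inner by (intro has_sum_SigmaI[OF _ has_sum_infsum[OF summable_weights]]) auto
  then have "((\<lambda>(j, k). ?f k j) has_sum ?Z) (UNIV \<times> K)"
    by (subst has_sum_swap) simp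
  then have "((\<lambda>(j, k). complex_of_real (?f k j)) has_sum complex_of_real ?Z) (UNIV \<times> K)"
    unfolding case_prod_unfold has_sum_of_real_iff .
  then show ?thesis
  proof (rule has_sum_SigmaD)
    fix j
    have "complex_of_real (?f k j) = w k * (cinner (v j) (u k) * cinner (u k) (v j))" for k
      unfolding of_real_mult cnj_mult_self[symmetric] cinner_commute[of "v j" "u k"] by (simp add: mult_ac)
    then show "((\<lambda>k. (\<lambda>(j, k). complex_of_real (?f k j)) (j, k)) has_sum cinner (v j) (mixture w u K (v j))) K"
      unfolding prod.case using has_sum_cinner_mixture by (simp only:)
  qed
qed

end

text \<open>Hermiticity transfers the operator from \<open>\<psi>\<close> to a basis vector, which
  replaces an argument by linearity and continuity.\<close>

lemma mixture_eqI:
  assumes "trace_class_family w u K" "trace_class_family w' u' K'" "total_family v"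
    and eq: "\<And>i j. cinner (v i) (mixture w u K (v j)) = cinner (v i) (mixture w' u' K' (v j))"
  shows "mixture w u K \<psi> = mixture w' u' K' \<psi>"
proof (rule total_familyD[OF assms(3)])
  fix j
  interpret a: trace_class_family w u K by fact
  interpret b: trace_class_family w' u' K' by fact
  have "mixture w u K (v j) = mixture w' u' K' (v j)"
    by (rule total_familyD[OF assms(3)]) (rule eq)
  then show "cinner (v j) (mixture w u K \<psi>) = cinner (v j) (mixture w' u' K' \<psi>)"
    using a.mixture_hermitian[of "v j" \<psi>] b.mixture_hermitian[of "v j" \<psi>] by simp
qed

lemma norm_slice_snd_le: "norm (slice_snd b g) \<le> norm g"
proof -
  have "(norm (slice_snd b g))\<^sup>2 \<le> (norm g)\<^sup>2"
    using finite_sum_le_has_sum[OF has_sum_norm_slice_snd[of g], of "{b}"] by simp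
  then show ?thesis
    by (simp add: power2_le_iff_abs_le)
qed

lemma slice_snd_scaleC: "slice_snd b (c *\<^sub>C x) = c *\<^sub>C slice_snd b x"
  by (simp add: ell2_eq_iff slice_snd.rep_eq scaleC.rep_eq)

lemma bounded_linear_slice_snd: "bounded_linear (slice_snd b)"
  by (rule bounded_linear_intro[where K = 1])
     (simp_all add: ell2_eq_iff slice_snd.rep_eq plus_ell2.rep_eq scaleR_ell2.rep_eq norm_slice_snd_le)

lemma cinner_tensor_pair_ket: "cinner g (tensor_pair \<psi> (ket b)) = cinner (slice_snd b g) \<psi>"
  using cinner_tensor_pair[of \<psi> "ket b" g] cinner_commute[of g "tensor_pair \<psi> (ket b)"]
    cinner_commute[of "slice_snd b g" \<psi>]
  by (simp add: cinner_ket coord_contract_fst)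

lemma trace_class_family_slices:
  assumes "trace_class_family w u K"
  shows "trace_class_family (\<lambda>(k, b). w k) (\<lambda>(k, b). slice_snd b (u k)) (K \<times> UNIV)"
    and "(\<Sum>\<^sub>\<infinity>p\<in>K \<times> UNIV. (\<lambda>(k, b). w k) p * (norm ((\<lambda>(k, b). slice_snd b (u k)) p))\<^sup>2)
      = (\<Sum>\<^sub>\<infinity>k\<in>K. w k * (norm (u k))\<^sup>2)"
proof -
  interpret trace_class_family w u K by fact
  have inner: "((\<lambda>b. w k * (norm (slice_snd b (u k)))\<^sup>2) has_sum w k * (norm (u k))\<^sup>2) UNIV" for k
    by (rule has_sum_cmult_right[OF has_sum_norm_slice_snd])
  have sum: "(\<lambda>(k, b). w k * (norm (slice_snd b (u k)))\<^sup>2) summable_on K \<times> UNIV"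
    by (rule summable_on_SigmaI[OF _ summable_weights]) (use inner weight_nonneg in auto)
  then show "trace_class_family (\<lambda>(k, b). w k) (\<lambda>(k, b). slice_snd b (u k)) (K \<times> UNIV)"
    by unfold_locales (auto simp: weight_nonneg case_prod_unfold)
  have "((\<lambda>(k, b). w k * (norm (slice_snd b (u k)))\<^sup>2) has_sum (\<Sum>\<^sub>\<infinity>k\<in>K. w k * (norm (u k))\<^sup>2)) (K \<times> UNIV)"
    using inner sum by (intro has_sum_SigmaI[OF _ has_sum_infsum[OF summable_weights]]) auto
  then show "(\<Sum>\<^sub>\<infinity>p\<in>K \<times> UNIV. (\<lambda>(k, b). w k) p * (norm ((\<lambda>(k, b). slice_snd b (u k)) p))\<^sup>2)
      = (\<Sum>\<^sub>\<infinity>k\<in>K. w k * (norm (u k))\<^sup>2)"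
    by (simp add: infsumI case_prod_unfold)
qed

text \<open>Each vector of the ensemble splits into its slices along the basis of the second factor,
  so the reduced operator is again a mixture, indexed by pairs.\<close>

lemma partial_trace_mixture:
  assumes "trace_class_family w u K"
  shows "partial_trace_snd (\<lambda>\<Phi>. c *\<^sub>C mixture w u K \<Phi>) \<psi>
    = c *\<^sub>C mixture (\<lambda>(k, b). w k) (\<lambda>(k, b). slice_snd b (u k)) (K \<times> UNIV) \<psi>"
proof -
  interpret trace_class_family w u K by fact
  interpret s: trace_class_family "\<lambda>(k, b). w k" "\<lambda>(k, b). slice_snd b (u k)" "K \<times> UNIV"
    by (rule trace_class_family_slices) fact
  let ?f = "\<lambda>k b. (w k * cinner (slice_snd b (u k)) \<psi>) *\<^sub>C slice_snd b (u k)"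
  let ?M = "mixture (\<lambda>(k, b). w k) (\<lambda>(k, b). slice_snd b (u k)) (K \<times> UNIV) \<psi>"
  have "((\<lambda>(k, b). ?f k b) has_sum ?M) (K \<times> UNIV)"
    using s.has_sum_mixture[of \<psi>] by (simp add: case_prod_unfold)
  then have "((\<lambda>(b, k). ?f k b) has_sum ?M) (UNIV \<times> K)"
    by (subst has_sum_swap) simp
  moreover have "((\<lambda>k. (\<lambda>(b, k). ?f k b) (b, k)) has_sum slice_snd b (mixture w u K (tensor_pair \<psi> (ket b)))) K" for b
    using has_sum_bounded_linear[OF bounded_linear_slice_snd has_sum_mixture, of b "tensor_pair \<psi> (ket b)"]
    by (simp add: o_def slice_snd_scaleC cinner_tensor_pair_ket)
  ultimately have "((\<lambda>b. slice_snd b (mixture w u K (tensor_pair \<psi> (ket b)))) has_sum ?M) UNIV"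
    by (rule has_sum_SigmaD)
  then have "((\<lambda>b. slice_snd b (c *\<^sub>C mixture w u K (tensor_pair \<psi> (ket b)))) has_sum c *\<^sub>C ?M) UNIV"
    unfolding slice_snd_scaleC by (rule has_sum_scaleC)
  then show ?thesis
    unfolding partial_trace_snd_def by (rule infsumI)
qed

section \<open>Isometries on closed spans\<close>

lemma closed_closed_cspan: "closed (closed_cspan B)"
  by (simp add: closed_cspan_def)

lemma closed_cspan_superset: "B \<subseteq> closed_cspan B"
  unfolding closed_cspan_def using complex_ell2.span_superset closure_subset by blast

lemma closed_cspan_add:
  assumes "x \<in> closed_cspan B" "y \<in> closed_cspan B"
  shows "x + y \<in> closed_cspan B"
proof -
  obtain f g where "\<And>n. f n \<in> complex_ell2.span B" "f \<longlonglongrightarrow> x" "\<And>n. g n \<in> complex_ell2.span B" "g \<longlonglongrightarrow> y"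
    using assms unfolding closed_cspan_def closure_sequential by blast
  then show ?thesis
    unfolding closed_cspan_def closure_sequential
    by (intro exI[of _ "\<lambda>n. f n + g n"]) (auto intro: complex_ell2.span_add tendsto_add)
qed

lemma closed_cspan_scaleC:
  assumes "x \<in> closed_cspan B"
  shows "c *\<^sub>C x \<in> closed_cspan B"
proof -
  obtain f where "\<And>n. f n \<in> complex_ell2.span B" "f \<longlonglongrightarrow> x"
    using assms unfolding closed_cspan_def closure_sequential by blast
  then show ?thesis
    unfolding closed_cspan_def closure_sequential
    by (intro exI[of _ "\<lambda>n. c *\<^sub>C f n"])
       (auto intro: complex_ell2.span_scale bounded_linear.tendsto[OF bounded_linear_scaleC])
qed

lemma zero_in_closed_cspan: "0 \<in> closed_cspan B"
  unfolding closed_cspan_def using complex_ell2.span_zero closure_subset by blast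

locale isometry_on =
  fixes F :: "'i ell2 set" and B :: "'i ell2 set" and S :: "'i ell2 \<Rightarrow> 'j ell2"
  assumes F: "F = closed_cspan B" and linear: "clinear_on F S"
    and isometric: "\<And>x. x \<in> F \<Longrightarrow> norm (S x) = norm x"
begin

lemma F_add: "x \<in> F \<Longrightarrow> y \<in> F \<Longrightarrow> x + y \<in> F"
  unfolding F by (rule closed_cspan_add)

lemma F_scaleC: "x \<in> F \<Longrightarrow> c *\<^sub>C x \<in> F"
  unfolding F by (rule closed_cspan_scaleC)

lemma F_zero: "0 \<in> F"
  unfolding F by (rule zero_in_closed_cspan)

lemma F_diff: "x \<in> F \<Longrightarrow> y \<in> F \<Longrightarrow> x - y \<in> F"
  unfolding minus_eq_scaleC by (intro F_add F_scaleC)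

lemma S_add: "x \<in> F \<Longrightarrow> y \<in> F \<Longrightarrow> S (x + y) = S x + S y"
  using linear by (simp add: clinear_on_def)

lemma S_scaleC: "x \<in> F \<Longrightarrow> S (c *\<^sub>C x) = c *\<^sub>C S x"
  using linear by (simp add: clinear_on_def)

lemma S_zero: "S 0 = 0"
  using S_scaleC[OF F_zero, of 0] by simp

lemma S_diff: "x \<in> F \<Longrightarrow> y \<in> F \<Longrightarrow> S (x - y) = S x - S y"
  unfolding minus_eq_scaleC by (simp only: S_add S_scaleC F_scaleC)

lemma S_sum: "(\<And>j. j \<in> A \<Longrightarrow> f j \<in> F) \<Longrightarrow> sum f A \<in> F \<and> S (sum f A) = (\<Sum>j\<in>A. S (f j))"
  by (induction A rule: infinite_finite_induct) (auto simp: F_zero S_zero F_add S_add)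

text \<open>\<open>S\<close> is linear and isometric on \<open>F\<close> only, so convergence has to
  take place inside \<open>F\<close>; there the distances to the limit are preserved.\<close>

lemma tendsto_S:
  assumes "(f \<longlongrightarrow> a) G" "eventually (\<lambda>x. f x \<in> F) G" "a \<in> F"
  shows "((\<lambda>x. S (f x)) \<longlongrightarrow> S a) G"
proof -
  have "((\<lambda>x. dist (f x) a) \<longlongrightarrow> 0) G"
    using assms(1) by (subst (asm) tendsto_dist_iff)
  moreover have "eventually (\<lambda>x. dist (S (f x)) (S a) = dist (f x) a) G"
    using assms(2)
  proof eventually_elim
    case (elim x)
    then show ?case
      using isometric[OF F_diff[OF elim assms(3)]] unfolding S_diff[OF elim assms(3)] by (simp add: dist_norm)
  qed
  ultimately have "((\<lambda>x. dist (S (f x)) (S a)) \<longlongrightarrow> 0) G"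
    by (subst tendsto_cong)
  then show ?thesis
    by (subst tendsto_dist_iff)
qed

lemma has_sum_S:
  assumes "(f has_sum a) A" "\<And>j. j \<in> A \<Longrightarrow> f j \<in> F"
  shows "a \<in> F" "((\<lambda>j. S (f j)) has_sum S a) A"
proof -
  have sums: "sum f X \<in> F \<and> S (sum f X) = (\<Sum>j\<in>X. S (f j))" if "X \<subseteq> A" for X
    using assms(2) that by (intro S_sum) auto
  have ev: "eventually (\<lambda>X. sum f X \<in> F) (finite_subsets_at_top A)"
    using sums by (auto intro: eventually_finite_subsets_at_top_weakI)
  have lim: "(sum f \<longlongrightarrow> a) (finite_subsets_at_top A)"
    using assms(1) by (simp add: has_sum_def)
  show "a \<in> F"
    using closed_closed_cspan[of B] ev finite_subsets_at_top_neq_bot[of A] lim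
    unfolding F by (rule Lim_in_closed_set)
  then have "((\<lambda>X. S (sum f X)) \<longlongrightarrow> S a) (finite_subsets_at_top A)"
    using tendsto_S[OF lim ev] by blast
  moreover have "eventually (\<lambda>X. S (sum f X) = (\<Sum>j\<in>X. S (f j))) (finite_subsets_at_top A)"
    using sums by (auto intro: eventually_finite_subsets_at_top_weakI)
  ultimately show "((\<lambda>j. S (f j)) has_sum S a) A"
    unfolding has_sum_def by (subst (asm) tendsto_cong)
qed

text \<open>Polarization. The imaginary part is, up to sign, the real part with
  \<open>\<i> *\<^sub>C y\<close> in place of \<open>y\<close>.\<close>

lemma cinner_S:
  assumes "x \<in> F" "y \<in> F"
  shows "cinner (S x) (S y) = cinner x y"
proof -
  have re: "Re (cinner (S x) (S y)) = Re (cinner x y)" if "x \<in> F" "y \<in> F" for x y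
  proof -
    have "(norm (S x + S y))\<^sup>2 = (norm (x + y))\<^sup>2"
      using that by (simp add: isometric F_add flip: S_add)
    then have "inner (S x) (S y) = inner x y"
      using that by (simp add: power2_norm_eq_inner inner_simps inner_commute isometric flip: norm_eq_sqrt_inner)
        (simp add: power2_norm_eq_inner[symmetric] isometric)
    then show ?thesis
      by (simp add: inner_ell2_def)
  qed
  have "Re (cinner (S x) (S (\<i> *\<^sub>C y))) = Re (cinner x (\<i> *\<^sub>C y))"
    using assms by (intro re F_scaleC)
  then have "Im (cinner (S x) (S y)) = Im (cinner x y)"
    using assms by (simp add: S_scaleC cinner_scaleC_right)
  then show ?thesis
    using re[OF assms] by (simp add: complex_eq_iff)
qed

end

text \<open>\<open>adjoint_on\<close> is a definite description, so existence must be established.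
  The candidate is the expansion in the vectors \<open>k n\<close> with the wanted coefficients,
  which converges by Bessel's inequality for the orthonormal images \<open>S (k n)\<close>.\<close>

lemma (in isometry_on) adjoint_on_orthonormal:
  assumes B: "B = k ` K" and k: "orthonormal_on K k"
  shows "adjoint_on F S \<Phi> \<in> F" "\<And>n. n \<in> K \<Longrightarrow> cinner (k n) (adjoint_on F S \<Phi>) = cinner (S (k n)) \<Phi>"
proof -
  have kF: "k n \<in> F" if "n \<in> K" for n
    unfolding F B using closed_cspan_superset[of "k ` K"] that by blast
  have Sk: "orthonormal_on K (\<lambda>n. S (k n))"
    using k kF by (simp add: orthonormal_on_def cinner_S)
  define y where "y = (\<Sum>\<^sub>\<infinity>n\<in>K. cinner (S (k n)) \<Phi> *\<^sub>C k n)"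
  have y: "((\<lambda>n. cinner (S (k n)) \<Phi> *\<^sub>C k n) has_sum y) K"
    unfolding y_def by (rule has_sum_infsum[OF summable_on_orthogonal[OF k Bessel_summable[OF Sk]]])
  have yF: "y \<in> F"
    using y by (rule has_sum_S(1)) (intro F_scaleC kF)
  have ky: "cinner (k n) y = cinner (S (k n)) \<Phi>" if n: "n \<in> K" for n
  proof -
    have "((\<lambda>j. cinner (k n) (cinner (S (k j)) \<Phi> *\<^sub>C k j)) has_sum cinner (S (k n)) \<Phi>) K"
      by (rule has_sum_finite_neutralI[of "{n}"]) (use n k in \<open>auto simp: cinner_scaleC_right orthonormal_on_def\<close>)
    then show ?thesis
      using has_sum_cinner_right[OF y, of "k n"] has_sum_unique by blast
  qed
  have span: "z \<in> F \<and> cinner y z = cinner \<Phi> (S z)" if "z \<in> complex_ell2.span (k ` K)" for z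
    using that
  proof (induction rule: complex_ell2.span_induct_alt)
    case base
    then show ?case by (simp add: F_zero S_zero)
  next
    case (step c x z)
    then obtain n where n: "n \<in> K" "x = k n" by auto
    have "cinner y x = cinner \<Phi> (S x)"
      using ky[OF n(1)] cinner_commute[of y x] cinner_commute[of \<Phi> "S x"] n(2) by simp
    then show ?case
      using step kF[OF n(1)] n(2)
      by (simp add: F_add F_scaleC S_add S_scaleC cinner_add_right cinner_scaleC_right)
  qed
  have adj: "cinner y z = cinner \<Phi> (S z)" if "z \<in> F" for z
  proof -
    obtain f where f: "\<And>n. f n \<in> complex_ell2.span (k ` K)" "f \<longlonglongrightarrow> z"
      using \<open>z \<in> F\<close> unfolding F B closed_cspan_def closure_sequential by blast
    have "(\<lambda>n. S (f n)) \<longlonglongrightarrow> S z"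
      by (rule tendsto_S[OF f(2) _ \<open>z \<in> F\<close>]) (use f(1) span in auto)
    then have "(\<lambda>n. cinner \<Phi> (S (f n))) \<longlonglongrightarrow> cinner \<Phi> (S z)"
      by (rule bounded_linear.tendsto[OF bounded_linear_cinner_right])
    moreover have "(\<lambda>n. cinner y (f n)) \<longlonglongrightarrow> cinner y z"
      by (rule bounded_linear.tendsto[OF bounded_linear_cinner_right f(2)])
    moreover have "cinner \<Phi> (S (f n)) = cinner y (f n)" for n
      using span f(1) by simp
    ultimately show ?thesis
      using LIMSEQ_unique by simp
  qed
  have "adjoint_on F S \<Phi> = y"
    unfolding adjoint_on_def
  proof (rule the_equality)
    show "y \<in> F \<and> (\<forall>z\<in>F. cinner y z = cinner \<Phi> (S z))"
      using yF adj by blast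
    fix x assume x: "x \<in> F \<and> (\<forall>z\<in>F. cinner x z = cinner \<Phi> (S z))"
    then have "cinner (x - y) (x - y) = 0"
      using adj F_diff[of x y] yF by (simp add: cinner_minus_left[of x y "x - y"])
    then show "x = y"
      by (simp add: cinner_self_norm)
  qed
  then show "adjoint_on F S \<Phi> \<in> F" "\<And>n. n \<in> K \<Longrightarrow> cinner (k n) (adjoint_on F S \<Phi>) = cinner (S (k n)) \<Phi>"
    using yF ky by auto
qed

section \<open>The KMS relation\<close>

lemma bij_betw_occupation_Suc:
  "bij_betw (\<lambda>n. n(i := Suc (n i))) \<N> {n \<in> \<N>. n i \<noteq> 0}"
  by (rule bij_betw_byWitness[where f' = "\<lambda>n. n(i := n i - 1)"]) (auto intro: occupation_numbers_upd)

lemma has_sum_occupation_Suc: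
  assumes "(f has_sum S) \<N>" "\<And>n. n \<in> \<N> \<Longrightarrow> n i = 0 \<Longrightarrow> f n = 0"
  shows "((\<lambda>n. f (n(i := Suc (n i)))) has_sum S) \<N>"
proof -
  have "(f has_sum S) {n \<in> \<N>. n i \<noteq> 0}"
    using assms(1) by (rule has_sum_cong_neutral[THEN iffD1, rotated -1]) (auto simp: assms(2))
  then show ?thesis
    by (subst has_sum_reindex_bij_betw[OF bij_betw_occupation_Suc])
qed

lemma has_sum_sum_picks:
  fixes g :: "'v \<Rightarrow> 'v list \<Rightarrow> 'b::topological_comm_monoid_add"
  assumes "\<And>y r. (f y r has_sum g y r) K"
  shows "((\<lambda>n. sum_picks l (\<lambda>y r. f y r n)) has_sum sum_picks l g) K"
  using assms by (induction l arbitrary: f g) (simp_all add: has_sum_add)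

text \<open>\<open>create\<close> for a basis mode \<open>s\<close>, whose overlaps are Kronecker
  deltas.\<close>

definition pick :: "'v \<Rightarrow> ('v list \<Rightarrow> 'b) \<Rightarrow> 'v list \<Rightarrow> 'b::comm_monoid_add" where
  "pick s F l = sum_picks l (\<lambda>y r. if y = s then F r else 0)"

lemma has_sum_pick:
  fixes g :: "'v list \<Rightarrow> 'b::topological_comm_monoid_add"
  assumes "\<And>r. ((\<lambda>n. f n r) has_sum g r) K"
  shows "((\<lambda>n. pick s (f n) l) has_sum pick s g l) K"
  unfolding pick_def by (rule has_sum_sum_picks) (simp add: assms)

lemma pick_cmult: "pick s (\<lambda>r. c * F r) l = c * pick s F l" for c :: "'b::semiring_0"
  unfolding pick_def sum_picks_cmult[symmetric] by (simp add: mult_delta_right)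

lemma pick_mult_right: "pick s (\<lambda>r. F r * c) l = pick s F l * c" for c :: "'b::comm_semiring_0"
  using pick_cmult[of s c F l] by (simp add: mult.commute)

lemma pick_divide: "pick s (\<lambda>r. F r / c) l = pick s F l / c" for c :: "'b::field"
  using pick_mult_right[of s F "inverse c" l] by (simp add: divide_inverse)

lemma cnj_pick: "cnj (pick s F l) = pick s (\<lambda>r. cnj (F r)) l"
  unfolding pick_def cnj_sum_picks by (simp add: if_distrib[of cnj] cong: if_cong)

abbreviation join :: "'a list \<Rightarrow> 'b list \<Rightarrow> ('a + 'b) list" where
  "join p q \<equiv> map Inl p @ map Inr q"

lemma pick_join:
  "pick (Inl i) F (join p q) = pick i (\<lambda>r. F (join r q)) p"
  "pick (Inr j) F (join p q) = pick j (\<lambda>r. F (join p r)) q"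
  by (simp_all add: pick_def sum_picks_append sum_picks_map sum_picks_zero)

text \<open>Each use of the relation removes one entry on the left and one on the right. If the left
  list is exhausted first, hermiticity exchanges the sides and the value is zero; if both end
  together, the vacuum element remains.\<close>

lemma KMS_unique:
  fixes G H :: "'v list \<Rightarrow> 'v list \<Rightarrow> complex"
  assumes G: "\<And>i p' p. G (i # p') p = x i * pick i (G p') p" "\<And>p' p. G p' p = cnj (G p p')"
    and H: "\<And>i p' p. H (i # p') p = x i * pick i (H p') p" "\<And>p' p. H p' p = cnj (H p p')"
    and one: "H [] [] = 1"
  shows "G p' p = G [] [] * H p' p"
proof (induction p' arbitrary: p)
  case Nil
  show ?case
  proof (cases p)
    case (Cons i q)
    have "G p [] = 0" "H p [] = 0"
      unfolding Cons G(1) H(1) by (simp_all add: pick_def)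
    then show ?thesis
      using G(2)[of "[]" p] H(2)[of "[]" p] by simp
  qed (simp add: one)
next
  case (Cons i p')
  have "G (i # p') p = x i * pick i (\<lambda>r. G [] [] * H p' r) p"
    unfolding G(1) Cons.IH ..
  then show ?case
    unfolding pick_cmult H(1) by simp
qed

(* A n l is the amplitude of the out-state S |n> on the out-modes l; the modes are Inl i for the
   i-th mode at infinity, and Inr (Inl i), Inr (Inr i) for the two i-th horizon modes. *)
locale KMS_amplitudes =
  fixes A :: "(nat \<Rightarrow> nat) \<Rightarrow> (nat + nat + nat) list \<Rightarrow> complex"
    and T R t r :: "nat \<Rightarrow> complex" and x :: "nat \<Rightarrow> real" and w :: "(nat \<Rightarrow> nat) \<Rightarrow> real"
  assumes A_mset: "n \<in> \<N> \<Longrightarrow> mset l = mset l' \<Longrightarrow> A n l = A n l'"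
    and fock_summable_A: "n \<in> \<N> \<Longrightarrow> fock_summable (\<lambda>q. A n (join p q))"
    and fock_summable_A_Cons: "n \<in> \<N> \<Longrightarrow> fock_summable (\<lambda>q. A n (Inr j # join p q))"
    and create: "n \<in> \<N> \<Longrightarrow>
      sqrt (Suc (n i)) * A (n(i := Suc (n i))) l = R i * pick (Inl i) (A n) l + T i * pick (Inr (Inl i)) (A n) l"
    and annihilate_\<gamma>: "n \<in> \<N> \<Longrightarrow>
      cnj (T i) * A n (Inr (Inl i) # l) + cnj (R i) * A n (Inl i # l) = sqrt (n i) * A (n(i := n i - 1)) l"
    and annihilate_\<Lambda>: "n \<in> \<N> \<Longrightarrow>
      cnj (t i) * A n (Inl i # l) + cnj (r i) * A n (Inr (Inl i) # l) = x i * pick (Inr (Inr i)) (A n) l"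
    and annihilate_\<tau>: "n \<in> \<N> \<Longrightarrow>
      A n (Inr (Inr i) # l) = x i * (t i * pick (Inl i) (A n) l + r i * pick (Inr (Inl i)) (A n) l)"
    and T_nonzero: "T i \<noteq> 0" and unit: "T i * cnj (T i) + R i * cnj (R i) = 1"
    and t_eq: "t i = T i" and r_eq: "r i = - cnj (R i) * T i / cnj (T i)"
    and w_Suc: "n \<in> \<N> \<Longrightarrow> w (n(i := Suc (n i))) = (x i)\<^sup>2 * w n"
begin

text \<open>The matrix element of the annihilator of the i-th \<open>\<sigma>\<close> in the
  out-state \<open>n\<close>, traced over the horizon. It is the unknown that the relations for
  \<open>\<gamma>\<close> and \<open>\<Lambda>\<close> share and that has to be eliminated.\<close>

definition C :: "nat \<Rightarrow> (nat \<Rightarrow> nat) \<Rightarrow> nat list \<Rightarrow> nat list \<Rightarrow> complex" where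
  "C i n p' p = (\<Sum>\<^sub>\<infinity>q. cnj (A n (join p q)) * A n (Inr (Inl i) # join p' q) / fact (length q))"

context
  fixes g :: "(nat \<Rightarrow> nat) \<Rightarrow> nat list \<Rightarrow> nat list \<Rightarrow> complex"
  assumes g: "\<And>n p' p. n \<in> \<N> \<Longrightarrow>
    ((\<lambda>q. cnj (A n (join p q)) * A n (join p' q) / fact (length q)) has_sum g n p' p) UNIV"
begin

lemma has_sum_D:
  assumes "n \<in> \<N>"
  shows "((\<lambda>q. cnj (pick (Inl i) (A n) (join p q)) * A n (join p' q) / fact (length q)) has_sum pick i (g n p') p) UNIV"
  unfolding pick_join cnj_pick pick_mult_right[symmetric] pick_divide[symmetric]
  by (rule has_sum_pick) (rule g[OF assms])

lemma has_sum_C: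
  assumes n: "n \<in> \<N>"
  shows "((\<lambda>q. cnj (A n (join p q)) * A n (Inr (Inl i) # join p' q) / fact (length q)) has_sum C i n p' p) UNIV"
  unfolding C_def
  by (rule has_sum_infsum[OF abs_summable_summable[OF abs_summable_fock_product[OF
        fock_summable_cnj[OF fock_summable_A[OF n]] fock_summable_A_Cons[OF n]]]])

text \<open>Cyclicity of the trace for one horizon mode: creating \<open>j\<close> in one factor
  becomes annihilating it in the other.\<close>

lemma has_sum_pairing:
  assumes n: "n \<in> \<N>" and \<beta>: "fock_summable \<beta>"
  shows "((\<lambda>q. pick j (\<lambda>r. \<beta> r) q * A n (join p' q) / fact (length q))
      has_sum (\<Sum>\<^sub>\<infinity>r. \<beta> r * A n (Inr j # join p' r) / fact (length r))) UNIV"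
proof -
  have eq: "A n (join p' (j # r)) = A n (Inr j # join p' r)" for r
    by (rule A_mset[OF n]) simp
  show ?thesis
    unfolding pick_def eq[symmetric]
  proof (rule has_sum_create_pairing[of "\<lambda>q. A n (join p' q)"])
    show "A n (join p' q) = A n (join p' q')" if "mset q = mset q'" for q q'
      using that by (intro A_mset[OF n]) simp
    show "fock_summable (\<lambda>r. A n (join p' (j # r)))"
      unfolding eq by (rule fock_summable_A_Cons[OF n])
  qed (rule \<beta>)
qed

lemma has_sum_C':
  assumes n: "n \<in> \<N>"
  shows "((\<lambda>q. cnj (pick (Inr (Inl i)) (A n) (join p q)) * A n (join p' q) / fact (length q)) has_sum C i n p' p) UNIV"
  using has_sum_pairing[OF n fock_summable_cnj[OF fock_summable_A[OF n]], of "Inl i" p p']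
  unfolding pick_join cnj_pick C_def .

text \<open>The matrix element between the out-states of \<open>n(i := Suc (n i))\<close> and
  \<open>n\<close> is computed in two ways: by annihilating \<open>\<gamma>\<close> in the raised
  state and by creating it, on the conjugate side, in the state \<open>n\<close>. If mode
  \<open>i\<close> is empty, the annihilation gives zero.\<close>

lemma gamma_relation:
  assumes n: "n \<in> \<N>"
  shows "n i = 0 \<Longrightarrow> cnj (T i) * C i n p' p + cnj (R i) * g n (i # p') p = 0"
    and "cnj (T i) * C i (n(i := Suc (n i))) p' p + cnj (R i) * g (n(i := Suc (n i))) (i # p') p
      = cnj (R i) * pick i (g n p') p + cnj (T i) * C i n p' p"
proof -
  have E: "((\<lambda>q. cnj (A n (join p q)) * (sqrt (n i) * A (n(i := n i - 1)) (join p' q)) / fact (length q))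
      has_sum cnj (T i) * C i n p' p + cnj (R i) * g n (i # p') p) UNIV"
    if n: "n \<in> \<N>" for n
    using has_sum_add[OF has_sum_cmult_right[OF has_sum_C[OF n], of "cnj (T i)" p i p']
        has_sum_cmult_right[OF g[OF n], of "cnj (R i)" p "i # p'"]]
    unfolding annihilate_\<gamma>[OF n, symmetric] by (simp add: algebra_simps add_divide_distrib)
  show "cnj (T i) * C i n p' p + cnj (R i) * g n (i # p') p = 0" if "n i = 0"
  proof (rule has_sum_unique)
    show "((\<lambda>q. 0) has_sum cnj (T i) * C i n p' p + cnj (R i) * g n (i # p') p) (UNIV :: (nat + nat) list set)"
      using E[OF n] that by simp
  qed (rule has_sum_0, simp)
  let ?n' = "n(i := Suc (n i))"
  have n': "?n' \<in> \<N>"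
    by (rule occupation_numbers_upd[OF n])
  have "((\<lambda>q. cnj (sqrt (Suc (n i)) * A ?n' (join p q)) * A n (join p' q) / fact (length q))
      has_sum cnj (R i) * pick i (g n p') p + cnj (T i) * C i n p' p) UNIV"
    using has_sum_add[OF has_sum_cmult_right[OF has_sum_D[OF n], of "cnj (R i)" i p p']
        has_sum_cmult_right[OF has_sum_C'[OF n], of "cnj (T i)" i p p']]
    unfolding create[OF n] by (simp add: algebra_simps add_divide_distrib)
  then show "cnj (T i) * C i ?n' p' p + cnj (R i) * g ?n' (i # p') p
      = cnj (R i) * pick i (g n p') p + cnj (T i) * C i n p' p"
  proof (rule has_sum_unique[rotated])
    show "((\<lambda>q. cnj (sqrt (Suc (n i)) * A ?n' (join p q)) * A n (join p' q) / fact (length q))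
      has_sum cnj (T i) * C i ?n' p' p + cnj (R i) * g ?n' (i # p') p) UNIV"
      using E[OF n'] by (simp add: mult_ac)
  qed
qed

text \<open>Annihilating \<open>\<Lambda>\<close> creates \<open>\<tau>\<close> with weight
  \<open>x i\<close>. Under the trace this becomes annihilating \<open>\<tau>\<close> on the
  conjugate side, which creates \<open>\<Lambda>\<close> there with a second factor
  \<open>x i\<close>. The occupation \<open>n\<close> never changes, so each out-state satisfies the
  relation by itself.\<close>

lemma Lambda_relation:
  assumes n: "n \<in> \<N>"
  shows "cnj (t i) * g n (i # p') p + cnj (r i) * C i n p' p
    = (x i)\<^sup>2 * (cnj (t i) * pick i (g n p') p + cnj (r i) * C i n p' p)"
proof -
  let ?L = "\<lambda>q. x i * (cnj (A n (join p q)) * pick (Inr (Inr i)) (A n) (join p' q) / fact (length q))"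
  have 1: "(?L has_sum cnj (t i) * g n (i # p') p + cnj (r i) * C i n p' p) UNIV"
  proof -
    have "?L q = cnj (t i) * (cnj (A n (join p q)) * A n (join (i # p') q) / fact (length q))
        + cnj (r i) * (cnj (A n (join p q)) * A n (Inr (Inl i) # join p' q) / fact (length q))" for q
    proof -
      have "?L q = cnj (A n (join p q)) * (x i * pick (Inr (Inr i)) (A n) (join p' q)) / fact (length q)"
        by (simp add: mult_ac)
      then show ?thesis
        unfolding annihilate_\<Lambda>[OF n, symmetric] by (simp add: algebra_simps add_divide_distrib)
    qed
    then show ?thesis
      using has_sum_add[OF has_sum_cmult_right[OF g[OF n], of "cnj (t i)" p "i # p'"]
          has_sum_cmult_right[OF has_sum_C[OF n], of "cnj (r i)" p i p']] by (simp only:)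
  qed
  have "((\<lambda>q. pick (Inr i) (\<lambda>r. A n (join p' r)) q * cnj (A n (join p q)) / fact (length q))
      has_sum (\<Sum>\<^sub>\<infinity>q. A n (join p' q) * cnj (A n (Inr (Inr i) # join p q)) / fact (length q))) UNIV"
  proof -
    \<comment> \<open>The created mode now sits in the factor without conjugation, so
      \<open>has_sum_pairing\<close> is applied to the complex conjugate.\<close>
    have "((\<lambda>q. cnj (pick (Inr i) (\<lambda>r. cnj (A n (join p' r))) q * A n (join p q) / fact (length q)))
      has_sum cnj (\<Sum>\<^sub>\<infinity>q. cnj (A n (join p' q)) * A n (Inr (Inr i) # join p q) / fact (length q))) UNIV"
      unfolding has_sum_cnj_iff by (rule has_sum_pairing[OF n fock_summable_cnj[OF fock_summable_A[OF n]]])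
    then show ?thesis
      by (simp add: cnj_pick flip: infsum_cnj)
  qed
  moreover have "((\<lambda>q. A n (join p' q) * cnj (A n (Inr (Inr i) # join p q)) / fact (length q))
      has_sum x i * (cnj (t i) * pick i (g n p') p + cnj (r i) * C i n p' p)) UNIV"
    using has_sum_cmult_right[OF has_sum_add[OF has_sum_cmult_right[OF has_sum_D[OF n], of "cnj (t i)" i p p']
        has_sum_cmult_right[OF has_sum_C'[OF n], of "cnj (r i)" i p p']], of "x i"]
    unfolding annihilate_\<tau>[OF n] by (simp add: algebra_simps add_divide_distrib)
  ultimately have "((\<lambda>q. pick (Inr i) (\<lambda>r. A n (join p' r)) q * cnj (A n (join p q)) / fact (length q))
      has_sum x i * (cnj (t i) * pick i (g n p') p + cnj (r i) * C i n p' p)) UNIV"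
    by (simp add: infsumI)
  from has_sum_cmult_right[OF this, of "x i"]
  have "(?L has_sum x i * (x i * (cnj (t i) * pick i (g n p') p + cnj (r i) * C i n p' p))) UNIV"
    by (simp add: pick_join mult_ac)
  with 1 have "cnj (t i) * g n (i # p') p + cnj (r i) * C i n p' p
      = x i * (x i * (cnj (t i) * pick i (g n p') p + cnj (r i) * C i n p' p))"
    by (rule has_sum_unique)
  then show ?thesis
    by (simp add: power2_eq_square)
qed

text \<open>\<open>Lambda_relation\<close> expresses \<open>C\<close> through the wanted difference
  for each \<open>n\<close>. Substituted into the weighted sum of \<open>gamma_relation\<close>,
  where the shift of \<open>n\<close> multiplies the weight by x^2, it leaves that difference times
  |T|^2 + |R|^2, which is 1.\<close>

lemma KMS_recursion:
  fixes G :: "nat list \<Rightarrow> nat list \<Rightarrow> complex"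
  assumes G: "\<And>p' p. ((\<lambda>n. w n * g n p' p) has_sum G p' p) \<N>"
  shows "G (i # p') p = (x i)\<^sup>2 * pick i (G p') p"
proof -
  let ?y = "complex_of_real ((x i)\<^sup>2)"
  let ?X = "G (i # p') p" and ?Y = "pick i (G p') p"
  have Y: "((\<lambda>n. w n * pick i (g n p') p) has_sum ?Y) \<N>"
    unfolding pick_cmult[symmetric] by (rule has_sum_pick) (rule G)
  have rel: "T i * (g n (i # p') p - ?y * pick i (g n p') p) = R i * (1 - ?y) * C i n p' p"
    if n: "n \<in> \<N>" for n
  proof -
    have "cnj (T i) * (T i * (g n (i # p') p - ?y * pick i (g n p') p)) = cnj (T i) * (R i * (1 - ?y) * C i n p' p)"
      using Lambda_relation[OF n, of i p' p] T_nonzero[of i] unfolding r_eq t_eq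
      by (simp add: field_simps)
    then show ?thesis
      using T_nonzero[of i] by simp
  qed
  show ?thesis
  proof (cases "?y = 1")
    \<comment> \<open>At \<open>?y = 1\<close> the contribution of \<open>C\<close> drops out of
      \<open>rel\<close>, and the recursion holds term by term; the elimination in the other case
      divides by \<open>1 - ?y\<close>.\<close>
    case True
    have "w n * g n (i # p') p = w n * pick i (g n p') p" if "n \<in> \<N>" for n
      using rel[OF that] T_nonzero[of i] True by simp
    then have "((\<lambda>n. w n * pick i (g n p') p) has_sum ?X) \<N>"
      by (rule has_sum_cong[THEN iffD1, OF _ G])
    then have "?X = ?Y"
      using Y by (rule has_sum_unique)
    then show ?thesis
      using True by simp
  next
    case False
    define k where "k n = R i * (1 - ?y) * C i n p' p" for n
    define V where "V = T i * (?X + (- ?y) * ?Y)"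
    have V: "((\<lambda>n. w n * k n) has_sum V) \<N>"
    proof (rule has_sum_cong[THEN iffD1])
      show "((\<lambda>n. T i * (w n * g n (i # p') p + (- ?y) * (w n * pick i (g n p') p))) has_sum V) \<N>"
        unfolding V_def by (intro has_sum_cmult_right has_sum_add G Y)
      show "T i * (w n * g n (i # p') p + (- ?y) * (w n * pick i (g n p') p)) = w n * k n"
        if "n \<in> \<N>" for n
        unfolding k_def rel[OF that, symmetric] by (simp add: algebra_simps)
    qed
    \<comment> \<open>The left side of \<open>gamma_relation\<close> scaled by
      \<open>R i * (1 - ?y)\<close>, the factor that turns \<open>C\<close> into \<open>k\<close>.
      It vanishes for \<open>n i = 0\<close>, so its weighted sum can be shifted by one
      quantum.\<close>
    define L where "L n = cnj (T i) * k n + R i * cnj (R i) * (1 - ?y) * g n (i # p') p" for n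
    have L_eq: "L n = R i * (1 - ?y) * (cnj (T i) * C i n p' p + cnj (R i) * g n (i # p') p)" for n
      by (simp add: L_def k_def algebra_simps)
    have "((\<lambda>n. cnj (T i) * (w n * k n) + R i * cnj (R i) * (1 - ?y) * (w n * g n (i # p') p)) has_sum
        cnj (T i) * V + R i * cnj (R i) * (1 - ?y) * ?X) \<N>"
      by (intro has_sum_add has_sum_cmult_right V G)
    then have "((\<lambda>n. w n * L n) has_sum cnj (T i) * V + R i * cnj (R i) * (1 - ?y) * ?X) \<N>"
      by (simp add: L_def algebra_simps)
    then have "((\<lambda>n. w (n(i := Suc (n i))) * L (n(i := Suc (n i)))) has_sum
        cnj (T i) * V + R i * cnj (R i) * (1 - ?y) * ?X) \<N>"
      by (rule has_sum_occupation_Suc) (simp add: L_eq gamma_relation(1))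
    moreover have "((\<lambda>n. w (n(i := Suc (n i))) * L (n(i := Suc (n i)))) has_sum
        ?y * (R i * cnj (R i) * (1 - ?y) * ?Y + cnj (T i) * V)) \<N>"
    proof (rule has_sum_cong[THEN iffD1])
      show "((\<lambda>n. ?y * (R i * cnj (R i) * (1 - ?y) * (w n * pick i (g n p') p) + cnj (T i) * (w n * k n))) has_sum
          ?y * (R i * cnj (R i) * (1 - ?y) * ?Y + cnj (T i) * V)) \<N>"
        by (intro has_sum_add has_sum_cmult_right V Y)
      show "?y * (R i * cnj (R i) * (1 - ?y) * (w n * pick i (g n p') p) + cnj (T i) * (w n * k n))
          = w (n(i := Suc (n i))) * L (n(i := Suc (n i)))" if "n \<in> \<N>" for n
        unfolding L_eq gamma_relation(2)[OF that] w_Suc[OF that] k_def by (simp add: algebra_simps)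
    qed
    ultimately have "cnj (T i) * V + R i * cnj (R i) * (1 - ?y) * ?X
        = ?y * (R i * cnj (R i) * (1 - ?y) * ?Y + cnj (T i) * V)"
      by (rule has_sum_unique)
    then have "(1 - ?y) * ((T i * cnj (T i) + R i * cnj (R i)) * (?X - ?y * ?Y)) = 0"
      unfolding V_def by (simp add: algebra_simps)
    then show ?thesis
      using False unit[of i] by simp
  qed
qed

end

end

section \<open>Matrix elements of mixtures and comparison by the KMS recursion\<close>

definition mixture_amp ::
  "('k \<Rightarrow> real) \<Rightarrow> ('k \<Rightarrow> 'i list ell2) \<Rightarrow> 'k set \<Rightarrow> 'i ell2 list \<Rightarrow> 'i ell2 list \<Rightarrow> complex" where
  "mixture_amp w u K fs gs = sqrt (fact (length fs)) * sqrt (fact (length gs))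
    * cinner (product_state fs) (mixture w u K (product_state gs))"

lemma mixture_amp_hermitian:
  assumes "trace_class_family w u K"
  shows "mixture_amp w u K fs gs = cnj (mixture_amp w u K gs fs)"
  unfolding mixture_amp_def
  using trace_class_family.mixture_hermitian[OF assms, of "product_state fs" "product_state gs"] by simp

lemma has_sum_mixture_amp:
  assumes "trace_class_family w u K"
  shows "((\<lambda>k. w k * (amp (u k) fs * cnj (amp (u k) gs))) has_sum mixture_amp w u K fs gs) K"
  using has_sum_cmult_right[OF trace_class_family.has_sum_cinner_mixture[OF assms, of "product_state fs" "product_state gs"],
      of "complex_of_real (sqrt (fact (length fs))) * complex_of_real (sqrt (fact (length gs)))"]
  by (simp add: mixture_amp_def amp_def mult_ac flip: cinner_commute[of "u _" "product_state gs"])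

lemma mixture_eq_if_recursive:
  assumes \<rho>: "fock_basis \<rho>" and a: "trace_class_family w u K" and b: "trace_class_family w' u' K'"
    and rec_a: "\<And>i p' p. mixture_amp w u K (map \<rho> (i # p')) (map \<rho> p) =
      y i * pick i (\<lambda>r. mixture_amp w u K (map \<rho> p') (map \<rho> r)) p"
    and rec_b: "\<And>i p' p. mixture_amp w' u' K' (map \<rho> (i # p')) (map \<rho> p) =
      y i * pick i (\<lambda>r. mixture_amp w' u' K' (map \<rho> p') (map \<rho> r)) p"
    and one: "mixture_amp w' u' K' [] [] = 1"
    and trace: "(\<Sum>\<^sub>\<infinity>k\<in>K. w k * (norm (u k))\<^sup>2) = Z" "(\<Sum>\<^sub>\<infinity>k\<in>K'. w' k * (norm (u' k))\<^sup>2) = Z" "Z \<noteq> 0"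
  shows "mixture w u K \<psi> = mixture w' u' K' \<psi>"
proof -
  interpret fock_basis \<rho> by fact
  define c where "c = mixture_amp w u K [] []"
  let ?E = "\<lambda>p. product_state (map \<rho> p)"
  have E: "orthonormal_family ?E" "total_family ?E"
    using orthonormal_product_state[OF orthonormal] total_product_state[OF total] by auto
  have "mixture_amp w u K (map \<rho> p') (map \<rho> p) = c * mixture_amp w' u' K' (map \<rho> p') (map \<rho> p)" for p' p
    unfolding c_def list.map(1)[of \<rho>, symmetric]
  proof (rule KMS_unique)
    show "mixture_amp w u K (map \<rho> p') (map \<rho> p) = cnj (mixture_amp w u K (map \<rho> p) (map \<rho> p'))" for p' p
      by (rule mixture_amp_hermitian[OF a])
    show "mixture_amp w' u' K' (map \<rho> p') (map \<rho> p) = cnj (mixture_amp w' u' K' (map \<rho> p) (map \<rho> p'))" for p' p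
      by (rule mixture_amp_hermitian[OF b])
  qed (use one in \<open>simp_all only: rec_a rec_b list.map(1)\<close>)
  then have eq: "cinner (?E p') (mixture w u K (?E p)) = c * cinner (?E p') (mixture w' u' K' (?E p))" for p' p
    by (simp add: mixture_amp_def)
  have "((\<lambda>p. c * cinner (?E p) (mixture w' u' K' (?E p))) has_sum complex_of_real Z) UNIV"
    using trace_class_family.trace_mixture[OF a E] unfolding eq trace .
  moreover have "((\<lambda>p. c * cinner (?E p) (mixture w' u' K' (?E p))) has_sum c * complex_of_real Z) UNIV"
    using trace_class_family.trace_mixture[OF b E] unfolding trace by (rule has_sum_cmult_right)
  ultimately have "complex_of_real Z = c * complex_of_real Z"
    by (rule has_sum_unique)
  then have "c = 1"
    using \<open>Z \<noteq> 0\<close> by simp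
  then show ?thesis
    using eq by (intro mixture_eqI[OF a b E(2)]) simp
qed

section \<open>Thermal mixtures of number states\<close>

lemma creation_family_number_state:
  "creation_family (\<lambda>n. amp (number_state \<phi> n)) (\<lambda>i y. cinner y (\<phi> i))"
proof
  fix n :: "nat \<Rightarrow> nat" and i
  assume n: "n \<in> \<N>" and i: "\<And>j. j < i \<Longrightarrow> n j = 0"
  show "create (\<lambda>y. cinner y (\<phi> i)) (amp (number_state \<phi> n))
      = (\<lambda>l. sqrt (Suc (n i)) * amp (number_state \<phi> (n(i := Suc (n i)))) l)"
  proof
    fix l
    have "create (\<lambda>y. cinner y (\<phi> i)) (amp (number_state \<phi> n)) l = amp (creation (\<phi> i) (number_state \<phi> n)) l"
      unfolding create_def by (rule amp_creation[symmetric]) (rule particle_state_creation(1)[OF particle_state_number_state])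
    also have "creation (\<phi> i) (number_state \<phi> n) = sqrt (Suc (n i)) *\<^sub>C number_state \<phi> (n(i := Suc (n i)))"
      using n i by (rule number_state_Suc)
    finally show "create (\<lambda>y. cinner y (\<phi> i)) (amp (number_state \<phi> n)) l
        = sqrt (Suc (n i)) * amp (number_state \<phi> (n(i := Suc (n i)))) l"
      unfolding amp_scaleC .
  qed
qed

locale occupation_weights =
  fixes w :: "(nat \<Rightarrow> nat) \<Rightarrow> real" and x :: "nat \<Rightarrow> real"
  assumes w_zero: "w (\<lambda>_. 0) = 1" and w_pos: "w n > 0"
    and w_Suc: "n \<in> \<N> \<Longrightarrow> w (n(i := Suc (n i))) = (x i)\<^sup>2 * w n"
    and w_summable: "w summable_on \<N>"
begin

lemma trace_class_orthonormal:
  assumes "orthonormal_on \<N> u"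
  shows "trace_class_family w u \<N>"
    and "(\<Sum>\<^sub>\<infinity>n\<in>\<N>. w n * (norm (u n))\<^sup>2) = infsum w \<N>"
proof -
  have norm: "w n * (norm (u n))\<^sup>2 = w n" if "n \<in> \<N>" for n
    using norm_eq_1I[of "u n"] assms that by (simp add: orthonormal_on_def)
  show "trace_class_family w u \<N>"
  proof
    show "w n \<ge> 0" for n using w_pos[of n] by simp
    show "(\<lambda>n. w n * (norm (u n))\<^sup>2) summable_on \<N>"
      using w_summable by (rule summable_on_cong[THEN iffD1, rotated]) (simp add: norm)
  qed
  show "(\<Sum>\<^sub>\<infinity>n\<in>\<N>. w n * (norm (u n))\<^sup>2) = infsum w \<N>"
    by (rule infsum_cong) (rule norm)
qed

lemma partition_nonzero: "infsum w \<N> \<noteq> 0"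
  using nonneg_infsum_le_0D[OF _ w_summable _ zero_occupation_numbers] w_pos w_zero
  by (metis less_le order_refl zero_neq_one)

end

lemma annihilate_number_state:
  assumes \<rho>: "orthonormal_family \<rho>" and n: "n \<in> \<N>"
  shows "amp (number_state \<rho> n) (\<rho> j # fs) = sqrt (n j) * amp (number_state \<rho> (n(j := n j - 1))) fs"
proof -
  interpret creation_family "\<lambda>n. amp (number_state \<rho> n)" "\<lambda>i y. cinner y (\<rho> i)"
    by (rule creation_family_number_state)
  show ?thesis
    by (rule annihilate_dual[OF n])
       (auto simp: orthonormal_familyD[OF \<rho>] number_state_zero amp_vacuum)
qed

lemma create_number_state:
  assumes n: "n \<in> \<N>"
  shows "sqrt (Suc (n i)) * amp (number_state \<rho> (n(i := Suc (n i)))) fs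
    = sum_picks fs (\<lambda>y r. cinner y (\<rho> i) * amp (number_state \<rho> n) r)"
proof -
  interpret creation_family "\<lambda>n. amp (number_state \<rho> n)" "\<lambda>i y. cinner y (\<rho> i)"
    by (rule creation_family_number_state)
  show ?thesis
    using fun_cong[OF create_A[OF n, of i], of fs] by (simp add: create_def)
qed

lemma (in fock_basis) sum_picks_basis:
  "sum_picks (map e l) (\<lambda>y r. cinner y (e s) * F r) = pick s (\<lambda>r. F (map e r)) l"
  unfolding sum_picks_map pick_def
  by (rule sum_picks_cong) (simp add: orthonormal_familyD[OF orthonormal])

lemma orthonormal_number_state:
  fixes \<rho> :: "nat \<Rightarrow> 'i ell2"
  assumes "fock_basis \<rho>"
  shows "orthonormal_on \<N> (number_state \<rho>)"
proof -
  interpret fock_basis \<rho> by fact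
  show ?thesis
    unfolding orthonormal_on_def
  proof (intro ballI)
    fix n n' assume nn': "n \<in> \<N>" "n' \<in> \<N>"
    have dom: "number_state \<rho> n \<in> creation_domain (\<rho> i)" for n i
      by (rule particle_state_creation(1)[OF particle_state_number_state])
    show "cinner (number_state \<rho> n) (number_state \<rho> n') = (if n = n' then 1 else 0)"
    proof (rule orthonormal_creation_family[where \<gamma> = \<rho> and u = "\<lambda>i. i" and v = "\<lambda>i. i" and a = "\<lambda>_. 1" and b = "\<lambda>_. 0"])
      show "norm (number_state \<rho> (\<lambda>_. 0)) = 1"
        unfolding number_state_zero by (rule norm_eq_1I) (simp add: vacuum_def cinner_ket ket.rep_eq)
    qed (use dom nn' create_number_state annihilate_number_state[OF orthonormal] in
        \<open>simp_all del: fun_upd_apply of_nat_Suc\<close>)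
  qed
qed

text \<open>Shifting \<open>n\<close> by one quantum of mode \<open>i\<close> extracts x^2 from the
  weight. The root produced by the annihilation is the one that turns the raised conjugate factor
  into a creation on \<open>n\<close>.\<close>

lemma (in occupation_weights) thermal_amp_recursion:
  assumes "fock_basis \<rho>"
  shows "mixture_amp w (number_state \<rho>) \<N> (map \<rho> (i # p')) (map \<rho> p) =
    complex_of_real ((x i)\<^sup>2) * pick i (\<lambda>r. mixture_amp w (number_state \<rho>) \<N> (map \<rho> p') (map \<rho> r)) p"
    and "mixture_amp w (number_state \<rho>) \<N> [] [] = 1"
proof -
  interpret fock_basis \<rho> by fact
  let ?A = "\<lambda>n p. amp (number_state \<rho> n) (map \<rho> p)"
  have tc: "trace_class_family w (number_state \<rho>) \<N>"
    by (rule trace_class_orthonormal(1)[OF orthonormal_number_state]) fact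
  note sum = has_sum_mixture_amp[OF tc]
  have "((\<lambda>n. w n * (?A n (i # p') * cnj (?A n p))) has_sum
      mixture_amp w (number_state \<rho>) \<N> (map \<rho> (i # p')) (map \<rho> p)) \<N>"
    by (rule sum)
  then have "((\<lambda>n. w (n(i := Suc (n i))) * (?A (n(i := Suc (n i))) (i # p') * cnj (?A (n(i := Suc (n i))) p))) has_sum
      mixture_amp w (number_state \<rho>) \<N> (map \<rho> (i # p')) (map \<rho> p)) \<N>"
    by (rule has_sum_occupation_Suc) (simp add: annihilate_number_state[OF orthonormal])
  moreover have "w (n(i := Suc (n i))) * (?A (n(i := Suc (n i))) (i # p') * cnj (?A (n(i := Suc (n i))) p))
      = complex_of_real ((x i)\<^sup>2) * pick i (\<lambda>r. w n * (?A n p' * cnj (?A n r))) p"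
    if n: "n \<in> \<N>" for n
  proof -
    let ?n = "n(i := Suc (n i))"
    have "?A ?n (i # p') = sqrt (Suc (n i)) * ?A n p'"
      using annihilate_number_state[OF orthonormal occupation_numbers_upd[OF n], of i "Suc (n i)" i "map \<rho> p'"] by simp
    then have "?A ?n (i # p') * cnj (?A ?n p) = ?A n p' * cnj (sqrt (Suc (n i)) * ?A ?n p)"
      by simp
    also have "\<dots> = ?A n p' * cnj (pick i (?A n) p)"
      unfolding create_number_state[OF n] sum_picks_basis ..
    finally show ?thesis
      unfolding w_Suc[OF n] cnj_pick pick_cmult by (simp add: mult_ac)
  qed
  ultimately have "((\<lambda>n. complex_of_real ((x i)\<^sup>2) * pick i (\<lambda>r. w n * (?A n p' * cnj (?A n r))) p) has_sum
      mixture_amp w (number_state \<rho>) \<N> (map \<rho> (i # p')) (map \<rho> p)) \<N>"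
    by (rule has_sum_cong[THEN iffD1, rotated])
  moreover have "((\<lambda>n. complex_of_real ((x i)\<^sup>2) * pick i (\<lambda>r. w n * (?A n p' * cnj (?A n r))) p) has_sum
      complex_of_real ((x i)\<^sup>2) * pick i (\<lambda>r. mixture_amp w (number_state \<rho>) \<N> (map \<rho> p') (map \<rho> r)) p)
      \<N>"
    by (intro has_sum_cmult_right has_sum_pick sum)
  ultimately show "mixture_amp w (number_state \<rho>) \<N> (map \<rho> (i # p')) (map \<rho> p) =
    complex_of_real ((x i)\<^sup>2) * pick i (\<lambda>r. mixture_amp w (number_state \<rho>) \<N> (map \<rho> p') (map \<rho> r)) p"
    by (rule has_sum_unique)
  have zero: "amp (number_state \<rho> n) [] = 0" if n: "n \<in> \<N>" "n \<noteq> (\<lambda>_. 0)" for n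
  proof -
    obtain j where j: "n j \<noteq> 0" using n(2) by auto
    let ?m = "n(j := n j - 1)"
    have "?m \<in> \<N>" "?m(j := Suc (?m j)) = n"
      using n(1) j by (auto intro: occupation_numbers_upd)
    then have "sqrt (Suc (?m j)) * amp (number_state \<rho> n) [] = 0"
      using create_number_state[of ?m j \<rho> "[]"] by (simp del: of_nat_Suc)
    then show ?thesis
      by (simp del: of_nat_Suc)
  qed
  have "((\<lambda>n. w n * (amp (number_state \<rho> n) [] * cnj (amp (number_state \<rho> n) []))) has_sum 1) \<N>"
    by (rule has_sum_finite_neutralI[of "{\<lambda>_. 0}"])
       (auto simp: zero zero_occupation_numbers number_state_zero amp_vacuum w_zero)
  then show "mixture_amp w (number_state \<rho>) \<N> [] [] = 1"
    using sum[of "[]" "[]"] has_sum_unique by blast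
qed

section \<open>Scattering by the black hole\<close>

lemma fock_space_add: "\<Psi> \<in> fock_space \<Longrightarrow> \<Phi> \<in> fock_space \<Longrightarrow> \<Psi> + \<Phi> \<in> fock_space"
  by (rule fock_spaceI) (simp add: plus_ell2.rep_eq, metis fock_space_coord_mset)

text \<open>The scattering operator enters only through its values \<open>s n\<close> on number
  states. Their orthonormality is a result of this locale and not an assumption; only the out-vacuum
  is required to be normalized.\<close>

locale scattering =
  fixes \<rho> :: "nat \<Rightarrow> 'a ell2" and \<sigma> \<tau> :: "nat \<Rightarrow> 'b ell2" and \<gamma> \<Lambda> :: "nat \<Rightarrow> ('a + 'b) ell2"
    and T R t r :: "nat \<Rightarrow> complex" and x :: "nat \<Rightarrow> real" and \<epsilon> :: "('a + 'b) list ell2" and N :: complex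
    and s :: "(nat \<Rightarrow> nat) \<Rightarrow> ('a list \<times> 'b list) ell2"
  assumes tr: "(cmod (t i))\<^sup>2 + (cmod (r i))\<^sup>2 = 1" and TR: "(cmod (T i))\<^sup>2 + (cmod (R i))\<^sup>2 = 1"
    and tT: "t i = T i" and rRT: "r i = - cnj (R i) * T i / cnj (T i)"
    and basis_\<rho>: "orthonormal_basis \<rho>" and basis_\<sigma>\<tau>: "orthonormal_basis (case_sum \<sigma> \<tau>)"
    and \<gamma>: "\<gamma> i = T i *\<^sub>C direct_sum 0 (\<sigma> i) + R i *\<^sub>C direct_sum (\<rho> i) 0"
    and \<Lambda>: "\<Lambda> i = t i *\<^sub>C direct_sum (\<rho> i) 0 + r i *\<^sub>C direct_sum 0 (\<sigma> i)"
    and \<epsilon>: "((\<lambda>i. (2 * x i) *\<^sub>C symmetrize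
            (tensor_product 1 (one_particle (\<Lambda> i)) (one_particle (direct_sum 0 (\<tau> i))))) has_sum \<epsilon>) UNIV"
    and vacuum: "((\<lambda>n. (N * sqrt (fact (2 * n)) / (2 ^ n * fact n)) *\<^sub>C symmetrize (two_particle_power \<epsilon> n))
          has_sum fock_merge (s (\<lambda>_. 0))) UNIV"
    and norm_vacuum: "norm (s (\<lambda>_. 0)) = 1"
    and dom_\<rho>: "n \<in> \<N> \<Longrightarrow> fock_merge (s n) \<in> creation_domain (direct_sum (\<rho> i) 0)"
    and dom_\<sigma>: "n \<in> \<N> \<Longrightarrow> fock_merge (s n) \<in> creation_domain (direct_sum 0 (\<sigma> i))"
    and create_least: "n \<in> \<N> \<Longrightarrow> (\<And>j. j < i \<Longrightarrow> n j = 0) \<Longrightarrow>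
      sqrt (Suc (n i)) *\<^sub>C fock_merge (s (n(i := Suc (n i)))) =
        R i *\<^sub>C creation (direct_sum (\<rho> i) 0) (fock_merge (s n))
        + T i *\<^sub>C creation (direct_sum 0 (\<sigma> i)) (fock_merge (s n))"
begin

abbreviation \<Phi> :: "(nat \<Rightarrow> nat) \<Rightarrow> ('a + 'b) list ell2" where "\<Phi> n \<equiv> fock_merge (s n)"

abbreviation h :: "nat + nat \<Rightarrow> 'b ell2" where "h \<equiv> case_sum \<sigma> \<tau>"

abbreviation b :: "nat + nat + nat \<Rightarrow> ('a + 'b) ell2" where
  "b \<equiv> case_sum (\<lambda>i. direct_sum (\<rho> i) 0) (\<lambda>j. direct_sum 0 (h j))"

lemma fock_basis_\<rho>: "fock_basis \<rho>"
  using basis_\<rho> orthonormal_basis_total unfolding fock_basis_def orthonormal_basis_def by blast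

lemma fock_basis_h: "fock_basis h"
  using basis_\<sigma>\<tau> orthonormal_basis_total unfolding fock_basis_def orthonormal_basis_def by blast

sublocale out: fock_basis b
  by (rule fock_basis_direct_sum[OF fock_basis_\<rho> fock_basis_h])

text \<open>For \<open>T i = 0\<close> the convention for division by zero gives
  \<open>r i = 0\<close> besides \<open>t i = 0\<close>, contradicting unitarity.\<close>

lemma T_nonzero: "T i \<noteq> 0"
proof
  assume "T i = 0"
  then have "t i = 0" "r i = 0"
    by (simp_all add: tT rRT)
  then show False
    using tr[of i] by simp
qed

lemma unit: "T i * cnj (T i) + R i * cnj (R i) = 1"
proof -
  have "complex_of_real ((cmod (T i))\<^sup>2 + (cmod (R i))\<^sup>2) = 1"
    by (simp only: TR of_real_1)
  then show ?thesis
    by (simp only: of_real_add complex_norm_square)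
qed

lemma unit': "t i * cnj (t i) + r i * cnj (r i) = 1"
proof -
  have "complex_of_real ((cmod (t i))\<^sup>2 + (cmod (r i))\<^sup>2) = 1"
    by (simp only: tr of_real_1)
  then show ?thesis
    by (simp only: of_real_add complex_norm_square)
qed

lemma \<gamma>_b: "\<gamma> i = R i *\<^sub>C b (Inl i) + T i *\<^sub>C b (Inr (Inl i))"
  by (simp add: \<gamma> add.commute)

lemma \<Lambda>_b: "\<Lambda> i = t i *\<^sub>C b (Inl i) + r i *\<^sub>C b (Inr (Inl i))"
  by (simp add: \<Lambda>)

text \<open>The prescribed value of \<open>r i\<close> is what makes \<open>\<Lambda> i\<close>
  orthogonal to \<open>\<gamma> i\<close>; the remaining products follow from the unitarity
  relations and the orthonormality of \<open>b\<close>.\<close>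

lemma cinner_modes:
  "cinner (\<gamma> i) (\<gamma> j) = (if i = j then 1 else 0)"
  "cinner (\<Lambda> i) (\<Lambda> j) = (if i = j then 1 else 0)"
  "cinner (\<gamma> i) (\<Lambda> j) = 0" "cinner (\<Lambda> i) (\<gamma> j) = 0"
  "cinner (\<gamma> i) (b (Inr (Inr j))) = 0" "cinner (b (Inr (Inr j))) (\<gamma> i) = 0"
  "cinner (\<Lambda> i) (b (Inr (Inr j))) = 0" "cinner (b (Inr (Inr j))) (\<Lambda> i) = 0"
  "cinner (b (Inr (Inr i))) (b (Inr (Inr j))) = (if i = j then 1 else 0)"
proof -
  note simps = \<gamma>_b \<Lambda>_b cinner_add_left cinner_add_right cinner_scaleC_left cinner_scaleC_right
    orthonormal_familyD[OF out.orthonormal]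
  show "cinner (\<gamma> i) (\<gamma> j) = (if i = j then 1 else 0)"
    using unit[of i] unfolding simps by (auto simp: algebra_simps)
  show "cinner (\<Lambda> i) (\<Lambda> j) = (if i = j then 1 else 0)"
    using unit'[of i] unfolding simps by (auto simp: algebra_simps)
  show *: "cinner (\<gamma> i) (\<Lambda> j) = 0" for i j
    using T_nonzero[of j] unfolding simps by (simp add: tT rRT)
  show "cinner (\<Lambda> i) (\<gamma> j) = 0"
    using *[of j i] cinner_commute[of "\<Lambda> i" "\<gamma> j"] by simp
qed (simp_all add: \<gamma>_b \<Lambda>_b cinner_add_left cinner_add_right cinner_scaleC_left cinner_scaleC_right
    orthonormal_familyD[OF out.orthonormal] del: sum.case)

lemma pair_amp_sum:
  "((\<lambda>i. x i * (cinner f (\<Lambda> i) * cinner g (b (Inr (Inr i))) + cinner g (\<Lambda> i) * cinner f (b (Inr (Inr i)))))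
    has_sum pair_amp \<epsilon> f g) UNIV"
  using has_sum_pair_amp[of "\<lambda>i. complex_of_real (x i)" \<Lambda> "\<lambda>i. direct_sum 0 (\<tau> i)" \<epsilon> f g] \<epsilon> by simp

text \<open>\<open>\<epsilon>\<close> pairs each \<open>\<Lambda> i\<close> with
  \<open>\<tau> i\<close> alone. That \<open>\<gamma> i\<close> has no partner means that its
  annihilator kills the out-vacuum.\<close>

lemma pair_amp_modes:
  "pair_amp \<epsilon> (\<Lambda> i) g = x i * cinner g (b (Inr (Inr i)))"
  "pair_amp \<epsilon> (b (Inr (Inr i))) g = x i * cinner g (\<Lambda> i)"
  "pair_amp \<epsilon> (\<gamma> i) g = 0"
proof -
  have "((\<lambda>j. x j * (cinner (\<Lambda> i) (\<Lambda> j) * cinner g (b (Inr (Inr j))) + cinner g (\<Lambda> j) * cinner (\<Lambda> i) (b (Inr (Inr j)))))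
      has_sum x i * cinner g (b (Inr (Inr i)))) UNIV"
    by (rule has_sum_finite_neutralI[of "{i}"]) (auto simp: cinner_modes simp del: sum.case)
  then show "pair_amp \<epsilon> (\<Lambda> i) g = x i * cinner g (b (Inr (Inr i)))"
    by (rule has_sum_unique[OF pair_amp_sum])
  have "((\<lambda>j. x j * (cinner (b (Inr (Inr i))) (\<Lambda> j) * cinner g (b (Inr (Inr j))) + cinner g (\<Lambda> j) * cinner (b (Inr (Inr i))) (b (Inr (Inr j)))))
      has_sum x i * cinner g (\<Lambda> i)) UNIV"
    by (rule has_sum_finite_neutralI[of "{i}"]) (auto simp: cinner_modes simp del: sum.case)
  then show "pair_amp \<epsilon> (b (Inr (Inr i))) g = x i * cinner g (\<Lambda> i)"
    by (rule has_sum_unique[OF pair_amp_sum])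
  have "((\<lambda>j. x j * (cinner (\<gamma> i) (\<Lambda> j) * cinner g (b (Inr (Inr j))) + cinner g (\<Lambda> j) * cinner (\<gamma> i) (b (Inr (Inr j)))))
      has_sum 0) UNIV"
    by (rule has_sum_0) (simp add: cinner_modes del: sum.case)
  then show "pair_amp \<epsilon> (\<gamma> i) g = 0"
    by (rule has_sum_unique[OF pair_amp_sum])
qed

lemma amp_vacuum_Cons: "amp (\<Phi> (\<lambda>_. 0)) (f # l) = sum_picks l (\<lambda>y r. pair_amp \<epsilon> f y * amp (\<Phi> (\<lambda>_. 0)) r)"
proof (rule amp_two_particle_exponential[OF vacuum])
  show "pair_amp \<epsilon> f g = pair_amp \<epsilon> g f" for f g
    by (rule pair_amp_commute[of "\<lambda>i. complex_of_real (x i)" \<Lambda> "\<lambda>i. direct_sum 0 (\<tau> i)"]) (use \<epsilon> in simp)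
qed

lemma \<Phi>_in_fock_space: "n \<in> \<N> \<Longrightarrow> \<Phi> n \<in> fock_space"
  using dom_\<rho>[of n 0] by (simp add: creation_domain_def)

sublocale creation_family "\<lambda>n. amp (\<Phi> n)" "\<lambda>i y. cinner y (\<gamma> i)"
proof
  fix n :: "nat \<Rightarrow> nat" and i
  assume n: "n \<in> \<N>" and i: "\<And>j. j < i \<Longrightarrow> n j = 0"
  have eq: "sqrt (Suc (n i)) *\<^sub>C \<Phi> (n(i := Suc (n i))) = R i *\<^sub>C creation (direct_sum (\<rho> i) 0) (\<Phi> n)
        + T i *\<^sub>C creation (direct_sum 0 (\<sigma> i)) (\<Phi> n)"
    using n i by (rule create_least)
  show "create (\<lambda>y. cinner y (\<gamma> i)) (amp (\<Phi> n)) = (\<lambda>l. sqrt (Suc (n i)) * amp (\<Phi> (n(i := Suc (n i)))) l)"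
  proof
    fix l
    have "amp (complex_of_real (sqrt (Suc (n i))) *\<^sub>C \<Phi> (n(i := Suc (n i)))) l
        = R i * sum_picks l (\<lambda>y r. cinner y (direct_sum (\<rho> i) 0) * amp (\<Phi> n) r)
        + T i * sum_picks l (\<lambda>y r. cinner y (direct_sum 0 (\<sigma> i)) * amp (\<Phi> n) r)"
      unfolding eq amp_add amp_scaleC amp_creation[OF dom_\<rho>[OF n]] amp_creation[OF dom_\<sigma>[OF n]] ..
    also have "\<dots> = create (\<lambda>y. cinner y (\<gamma> i)) (amp (\<Phi> n)) l"
      unfolding create_def sum_picks_cmult[symmetric] sum_picks_add[symmetric] \<gamma>_b cinner_add_right cinner_scaleC_right
      by (simp add: algebra_simps)
    finally show "create (\<lambda>y. cinner y (\<gamma> i)) (amp (\<Phi> n)) l = sqrt (Suc (n i)) * amp (\<Phi> (n(i := Suc (n i)))) l"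
      unfolding amp_scaleC by (rule sym)
  qed
qed

lemma annihilate_\<gamma>:
  "n \<in> \<N> \<Longrightarrow> amp (\<Phi> n) (\<gamma> j # fs) = sqrt (n j) * amp (\<Phi> (n(j := n j - 1))) fs"
  by (rule annihilate_dual) (simp_all add: cinner_modes amp_vacuum_Cons pair_amp_modes sum_picks_zero)

lemma annihilate_\<Lambda>:
  assumes "n \<in> \<N>"
  shows "amp (\<Phi> n) (\<Lambda> j # fs) = x j * create (\<lambda>y. cinner y (b (Inr (Inr j)))) (amp (\<Phi> n)) fs"
  using assms
proof (rule annihilate_orthogonal)
  show "amp (\<Phi> (\<lambda>_. 0)) (\<Lambda> j # l) = x j * create (\<lambda>y. cinner y (b (Inr (Inr j)))) (amp (\<Phi> (\<lambda>_. 0))) l" for l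
    unfolding amp_vacuum_Cons pair_amp_modes create_def sum_picks_cmult[symmetric] mult.assoc ..
qed (rule cinner_modes)

lemma annihilate_\<tau>:
  assumes "n \<in> \<N>"
  shows "amp (\<Phi> n) (b (Inr (Inr j)) # fs) = x j * create (\<lambda>y. cinner y (\<Lambda> j)) (amp (\<Phi> n)) fs"
  using assms
proof (rule annihilate_orthogonal)
  show "amp (\<Phi> (\<lambda>_. 0)) (b (Inr (Inr j)) # l) = x j * create (\<lambda>y. cinner y (\<Lambda> j)) (amp (\<Phi> (\<lambda>_. 0))) l" for l
    unfolding amp_vacuum_Cons pair_amp_modes create_def sum_picks_cmult[symmetric] mult.assoc ..
qed (rule cinner_modes)

text \<open>The commutation relations on the out-side and the normalized vacuum suffice. The
  isometry \<open>fock_merge\<close> transfers the result from the Fock space of the direct sum to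
  the tensor product.\<close>

lemma orthonormal_out: "orthonormal_on \<N> s"
  unfolding orthonormal_on_def
proof (intro ballI)
  fix n n' assume nn': "n \<in> \<N>" "n' \<in> \<N>"
  have "cinner (\<Phi> n) (\<Phi> n') = (if n = n' then 1 else 0)"
  proof (rule out.orthonormal_creation_family[where \<gamma> = \<gamma> and u = Inl and v = "\<lambda>i. Inr (Inl i)" and a = R and b = T])
    show "sqrt (Suc (n i)) * amp (\<Phi> (n(i := Suc (n i)))) fs = sum_picks fs (\<lambda>y r. cinner y (\<gamma> i) * amp (\<Phi> n) r)"
      if "n \<in> \<N>" for n i fs
      using fun_cong[OF create_A[OF that, of i], of fs] by (simp add: create_def)
    show "norm (\<Phi> (\<lambda>_. 0)) = 1"
      by (rule norm_eq_1I) (subst cinner_fock_merge, simp add: cinner_self_norm norm_vacuum)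
    show "\<gamma> i = R i *\<^sub>C b (Inl i) + T i *\<^sub>C b (Inr (Inl i))" for i
      by (rule \<gamma>_b)
  qed (use nn' dom_\<rho> dom_\<sigma> annihilate_\<gamma> in \<open>simp_all del: fun_upd_apply\<close>)
  then show "cinner (s n) (s n') = (if n = n' then 1 else 0)"
    by (simp add: cinner_fock_merge)
qed

definition A :: "(nat \<Rightarrow> nat) \<Rightarrow> (nat + nat + nat) list \<Rightarrow> complex" where
  "A n l = amp (\<Phi> n) (map b l)"

lemma create_eq_pick:
  "create (\<lambda>y. cinner y (b j)) (amp (\<Phi> n)) (map b l) = pick j (A n) l"
  unfolding create_def out.sum_picks_basis A_def ..

lemma create_add: "create (\<lambda>y. a * c y + a' * c' y) F l = a * create c F l + a' * create c' F l"
  unfolding create_def sum_picks_cmult[symmetric] sum_picks_add[symmetric] by (simp add: algebra_simps)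

lemma A_join: "A n (join p q) = sqrt (fact (length p)) * amp (contract_fst (product_state (map \<rho> p)) (s n)) (map h q)"
  using amp_fock_merge[of "s n" "map \<rho> p" "map h q"] by (simp add: A_def o_def)

lemma fock_summable_join:
  assumes "\<Psi> \<in> fock_space"
  shows "fock_summable (\<lambda>q. amp \<Psi> (map b (join p q)))"
  using fock_basis.fock_summable_amp_merge[OF fock_basis_h assms, of "map \<rho> p"] by (simp add: o_def)

lemma fock_summable_A_Cons:
  assumes n: "n \<in> \<N>"
  shows "fock_summable (\<lambda>q. A n (Inr j # join p q))"
proof (cases j)
  case (Inl i)
  have dom: "\<Phi> n \<in> creation_domain (b (Inr j))"
    using dom_\<sigma>[OF n] Inl by simp
  have "fock_summable (\<lambda>q. A n (join p (j # q)))"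
  proof (rule fock_summable_annihilate)
    show "A n (join p q) = A n (join p q')" if "mset q = mset q'" for q q'
      unfolding A_def using that by (intro out.amp_map_mset \<Phi>_in_fock_space n) simp
    have "amp (creation (b (Inr j)) (\<Phi> n)) (map b (join p q)) = sum_picks q (\<lambda>y r. if y = j then A n (join p r) else 0)" for q
      unfolding out.amp_creation_basis[OF dom] A_def[symmetric] pick_def[symmetric] pick_join ..
    then show "fock_summable (\<lambda>q. sum_picks q (\<lambda>y r. if y = j then A n (join p r) else 0))"
      using fock_summable_join[OF creation_in_fock_space[OF dom], of p] by simp
  qed
  moreover have "A n (join p (j # q)) = A n (Inr j # join p q)" for q
    unfolding A_def by (intro out.amp_map_mset \<Phi>_in_fock_space n) simp
  ultimately show ?thesis by simp
next
  case (Inr i)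
  \<comment> \<open>No domain condition is given for \<open>\<tau>\<close>. By
    \<open>annihilate_\<tau>\<close> its annihilation equals creation of \<open>x i\<close> times
    \<open>\<Lambda> i\<close>, a combination of creations of \<open>\<rho> i\<close> and
    \<open>\<sigma> i\<close>, for which the domains are given.\<close>
  let ?X = "(x i * t i) *\<^sub>C creation (direct_sum (\<rho> i) 0) (\<Phi> n) + (x i * r i) *\<^sub>C creation (direct_sum 0 (\<sigma> i)) (\<Phi> n)"
  have "?X \<in> fock_space"
    by (intro fock_space_add fock_space_scaleC creation_in_fock_space dom_\<rho> dom_\<sigma> n)
  then have "fock_summable (\<lambda>q. amp ?X (map b (join p q)))"
    by (rule fock_summable_join)
  moreover have "amp ?X l = amp (\<Phi> n) (b (Inr (Inr i)) # l)" for l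
    unfolding annihilate_\<tau>[OF n] amp_add amp_scaleC amp_creation[OF dom_\<rho>[OF n]] amp_creation[OF dom_\<sigma>[OF n]]
      create_def[symmetric] \<Lambda> cinner_add_right cinner_scaleC_right create_add
    by (simp add: algebra_simps)
  ultimately show ?thesis
    unfolding A_def Inr by simp
qed

lemma KMS_amplitudes:
  assumes "\<And>n i. n \<in> \<N> \<Longrightarrow> w (n(i := Suc (n i))) = (x i)\<^sup>2 * w n"
  shows "KMS_amplitudes A T R t r x w"
proof
  fix n :: "nat \<Rightarrow> nat" and i :: nat and j :: "nat + nat" and l l' :: "(nat + nat + nat) list" and p :: "nat list"
  assume n: "n \<in> \<N>"
  show "A n l = A n l'" if "mset l = mset l'"
    unfolding A_def using that by (intro out.amp_map_mset \<Phi>_in_fock_space n)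
  show "fock_summable (\<lambda>q. A n (join p q))"
    unfolding A_def by (rule fock_summable_join[OF \<Phi>_in_fock_space[OF n]])
  show "fock_summable (\<lambda>q. A n (Inr j # join p q))"
    by (rule fock_summable_A_Cons[OF n])
  show "sqrt (Suc (n i)) * A (n(i := Suc (n i))) l = R i * pick (Inl i) (A n) l + T i * pick (Inr (Inl i)) (A n) l"
    using fun_cong[OF create_A[OF n, of i], of "map b l"]
    unfolding A_def[symmetric] \<gamma>_b cinner_add_right cinner_scaleC_right create_add create_eq_pick by simp
  show "cnj (T i) * A n (Inr (Inl i) # l) + cnj (R i) * A n (Inl i # l) = sqrt (n i) * A (n(i := n i - 1)) l"
    using annihilate_\<gamma>[OF n, of i "map b l"]
    unfolding A_def[symmetric] \<gamma>_b amp_Cons_add amp_Cons_scaleC list.map(2)[symmetric] by (simp add: add.commute)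
  show "cnj (t i) * A n (Inl i # l) + cnj (r i) * A n (Inr (Inl i) # l) = x i * pick (Inr (Inr i)) (A n) l"
    using annihilate_\<Lambda>[OF n, of i "map b l"]
    unfolding A_def[symmetric] \<Lambda>_b amp_Cons_add amp_Cons_scaleC list.map(2)[symmetric] create_eq_pick by simp
  show "A n (Inr (Inr i) # l) = x i * (t i * pick (Inl i) (A n) l + r i * pick (Inr (Inl i)) (A n) l)"
    using annihilate_\<tau>[OF n, of i "map b l"]
    unfolding A_def[symmetric] \<Lambda>_b cinner_add_right cinner_scaleC_right create_add list.map(2)[symmetric] create_eq_pick .
  show "w (n(i := Suc (n i))) = (x i)\<^sup>2 * w n"
    by (rule assms[OF n])
qed (rule T_nonzero unit tT rRT)+

lemma partial_trace_thermal:
  assumes "occupation_weights w x"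
  shows "mixture (\<lambda>(n, b). w n) (\<lambda>(n, b). slice_snd b (s n)) (\<N> \<times> UNIV) \<psi>
    = mixture w (number_state \<rho>) \<N> \<psi>"
proof -
  interpret occupation_weights w x by fact
  interpret KMS: KMS_amplitudes A T R t r x w
    by (rule KMS_amplitudes) (rule w_Suc)
  let ?u = "\<lambda>(n, b). slice_snd b (s n)" and ?w = "\<lambda>(n, b::'b list). w n" and ?K = "\<N> \<times> (UNIV :: 'b list set)"
  let ?Z = "infsum w \<N>"
  let ?\<chi> = "\<lambda>n p. contract_fst (product_state (map \<rho> p)) (s n)"
  let ?f = "\<lambda>p. complex_of_real (sqrt (fact (length p)))"
  note out_tc = trace_class_orthonormal[OF orthonormal_out]
  note tc = trace_class_family_slices[OF out_tc(1)]
  \<comment> \<open>As an inner product of contracted vectors, \<open>g\<close> can be evaluated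
    both in the standard basis that defines the partial trace and in the basis of horizon modes in
    which the relations for \<open>A\<close> are stated.\<close>
  define g where "g n p' p = ?f p' * ?f p * cinner (?\<chi> n p) (?\<chi> n p')" for n p' p
  have g: "((\<lambda>q. cnj (A n (join p q)) * A n (join p' q) / fact (length q)) has_sum g n p' p) UNIV" for n p' p
    using has_sum_cmult_right[OF fock_basis.Parseval_amp[OF fock_basis_h, of "?\<chi> n p" "?\<chi> n p'"], of "?f p' * ?f p"]
    unfolding A_join g_def by (simp add: mult_ac)
  define G where "G p' p = mixture_amp ?w ?u ?K (map \<rho> p') (map \<rho> p)" for p' p
  have G: "((\<lambda>n. w n * g n p' p) has_sum G p' p) \<N>" for p' p
  proof (rule has_sum_SigmaD)
    show "((\<lambda>k. ?w k * (amp (?u k) (map \<rho> p') * cnj (amp (?u k) (map \<rho> p)))) has_sum G p' p) ?K"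
      unfolding G_def by (rule has_sum_mixture_amp[OF tc(1)])
    fix n
    have "((\<lambda>b. w n * ?f p' * ?f p * (cnj (coord (?\<chi> n p) b) * coord (?\<chi> n p') b)) has_sum
        w n * ?f p' * ?f p * cinner (?\<chi> n p) (?\<chi> n p')) UNIV"
      by (intro has_sum_cmult_right cinner_has_sum)
    then show "((\<lambda>b. ?w (n, b) * (amp (?u (n, b)) (map \<rho> p') * cnj (amp (?u (n, b)) (map \<rho> p)))) has_sum w n * g n p' p) UNIV"
      by (simp add: g_def amp_def coord_contract_fst mult_ac)
  qed
  show ?thesis
  proof (rule mixture_eq_if_recursive[OF fock_basis_\<rho> tc(1) trace_class_orthonormal(1)[OF orthonormal_number_state[OF fock_basis_\<rho>]]])
    show "mixture_amp ?w ?u ?K (map \<rho> (i # p')) (map \<rho> p)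
        = complex_of_real ((x i)\<^sup>2) * pick i (\<lambda>r. mixture_amp ?w ?u ?K (map \<rho> p') (map \<rho> r)) p" for i p' p
      using KMS.KMS_recursion[of g G, OF g G] unfolding G_def .
    show "mixture_amp w (number_state \<rho>) \<N> (map \<rho> (i # p')) (map \<rho> p)
        = complex_of_real ((x i)\<^sup>2) * pick i (\<lambda>r. mixture_amp w (number_state \<rho>) \<N> (map \<rho> p') (map \<rho> r)) p" for i p' p
      by (rule thermal_amp_recursion(1)[OF fock_basis_\<rho>])
    show "mixture_amp w (number_state \<rho>) \<N> [] [] = 1"
      by (rule thermal_amp_recursion(2)[OF fock_basis_\<rho>])
    show "(\<Sum>\<^sub>\<infinity>k\<in>?K. ?w k * (norm (?u k))\<^sup>2) = ?Z"
      unfolding tc(2) out_tc(2) ..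
    show "(\<Sum>\<^sub>\<infinity>k\<in>\<N>. w k * (norm (number_state \<rho> k))\<^sup>2) = ?Z"
      by (rule trace_class_orthonormal(2)[OF orthonormal_number_state[OF fock_basis_\<rho>]])
    show "?Z \<noteq> 0"
      by (rule partition_nonzero)
  qed
qed

end

section \<open>Boltzmann weights and conjugation of the thermal state by the scattering
  operator\<close>

lemma boltzmann_eq:
  assumes "finite B" "{i. n i \<noteq> 0} \<subseteq> B"
  shows "boltzmann \<beta> \<Omega> \<omega> m n = exp (- \<beta> * (\<Sum>i\<in>B. n i * (\<omega> i - \<Omega> * m i)))"
  unfolding boltzmann_def
  by (rule arg_cong[where f = "\<lambda>z. exp (- \<beta> * z)"]) (rule sum.mono_neutral_left, use assms in auto)

lemma boltzmann_Suc:
  assumes "n \<in> \<N>"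
  shows "boltzmann \<beta> \<Omega> \<omega> m (n(i := Suc (n i))) = exp (- \<beta> * (\<omega> i - \<Omega> * m i)) * boltzmann \<beta> \<Omega> \<omega> m n"
proof -
  let ?B = "insert i {i. n i \<noteq> 0}" and ?E = "\<lambda>i. \<omega> i - \<Omega> * m i"
  have fin: "finite ?B"
    using assms by (simp add: occupation_numbers_def)
  have "(\<Sum>j\<in>?B. (n(i := Suc (n i))) j * ?E j) = (\<Sum>j\<in>?B. n j * ?E j + (if j = i then ?E j else 0))"
    by (intro sum.cong refl) (auto simp: algebra_simps)
  also have "\<dots> = (\<Sum>j\<in>?B. n j * ?E j) + ?E i"
    unfolding sum.distrib using fin by simp
  finally have eq: "(\<Sum>j\<in>?B. (n(i := Suc (n i))) j * ?E j) = (\<Sum>j\<in>?B. n j * ?E j) + ?E i" .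
  have "boltzmann \<beta> \<Omega> \<omega> m (n(i := Suc (n i))) = exp (- \<beta> * (\<Sum>j\<in>?B. (n(i := Suc (n i))) j * ?E j))"
      by (rule boltzmann_eq[OF fin]) auto
  moreover have "boltzmann \<beta> \<Omega> \<omega> m n = exp (- \<beta> * (\<Sum>j\<in>?B. n j * ?E j))"
      by (rule boltzmann_eq[OF fin]) auto
  ultimately show ?thesis
    unfolding eq by (simp only: distrib_left exp_add mult.commute)
qed

lemma thermal_state_eq_mixture:
  "thermal_state \<beta> \<Omega> \<omega> m \<phi> \<Psi> = (1 / infsum (boltzmann \<beta> \<Omega> \<omega> m) \<N>)
    *\<^sub>C mixture (boltzmann \<beta> \<Omega> \<omega> m) (number_state \<phi>) \<N> \<Psi>"
  unfolding thermal_state_def partition_function_def mixture_def ..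

text \<open>A divergent \<open>infsum\<close> is 0 by convention, and so is
  \<open>1 / 0\<close>.\<close>

lemma thermal_state_not_summable:
  assumes "\<not> boltzmann \<beta> \<Omega> \<omega> m summable_on \<N>"
  shows "thermal_state \<beta> \<Omega> \<omega> m \<phi> \<Psi> = 0"
  unfolding thermal_state_eq_mixture infsum_not_exists[OF assms] by simp

theorem theorem3:
  fixes \<Omega> \<kappa> \<beta> :: real
    and \<omega> :: "nat \<Rightarrow> real" and m :: "nat \<Rightarrow> int" and x :: "nat \<Rightarrow> real"
    and t r T R :: "nat \<Rightarrow> complex"
    and \<rho> :: "nat \<Rightarrow> 'a ell2"
    and \<sigma> \<tau> :: "nat \<Rightarrow> 'b ell2"
    and \<gamma> \<Lambda> :: "nat \<Rightarrow> ('a + 'b) ell2"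
    and A :: "('a + 'b) ell2 \<Rightarrow> 'c ell2"
    and \<epsilon> :: "('a + 'b) list ell2"
    and N :: complex
    and F :: "'c list ell2 set"
    and S :: "'c list ell2 \<Rightarrow> ('a list \<times> 'b list) ell2"
  assumes "\<beta> = 2 * pi / \<kappa>"
    and "\<And>i. x i = exp (- pi * (\<omega> i - \<Omega> * m i) / \<kappa>)"
    and "\<And>i. (cmod (t i))\<^sup>2 + (cmod (r i))\<^sup>2 = 1"
    and "\<And>i. (cmod (T i))\<^sup>2 + (cmod (R i))\<^sup>2 = 1"
    and "\<And>i. t i = T i"
    and "\<And>i. r i = - cnj (R i) * T i / cnj (T i)"
    and "orthonormal_basis \<rho>"
    and "orthonormal_basis (case_sum \<sigma> \<tau>)"
    and "\<And>i. \<gamma> i = T i *\<^sub>C direct_sum 0 (\<sigma> i) + R i *\<^sub>C direct_sum (\<rho> i) 0"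
    and "\<And>i. \<Lambda> i = t i *\<^sub>C direct_sum (\<rho> i) 0 + r i *\<^sub>C direct_sum 0 (\<sigma> i)"
    and "clinear_on UNIV A" and "bounded_linear A"
    and "F = closed_cspan (number_state (\<lambda>i. A (\<gamma> i)) ` occupation_numbers)"
    and "((\<lambda>i. (2 * x i) *\<^sub>C symmetrize
            (tensor_product 1 (one_particle (\<Lambda> i)) (one_particle (direct_sum 0 (\<tau> i)))))
          has_sum \<epsilon>) UNIV"
    and "clinear_on F S"
    and "\<And>\<Psi>. \<Psi> \<in> F \<Longrightarrow> norm (S \<Psi>) = norm \<Psi>"
    and "\<And>\<Psi>. \<Psi> \<in> F \<Longrightarrow> fock_merge (S \<Psi>) \<in> fock_space"
    and "norm (S vacuum) = 1"
    and "((\<lambda>n. (N * sqrt (fact (2 * n)) / (2 ^ n * fact n)) *\<^sub>C symmetrize (two_particle_power \<epsilon> n))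
          has_sum fock_merge (S vacuum)) UNIV"
    and "\<And>i n. n \<in> occupation_numbers \<Longrightarrow>
          fock_merge (S (number_state (\<lambda>j. A (\<gamma> j)) n))
            \<in> creation_domain (direct_sum (\<rho> i) 0) \<inter> creation_domain (direct_sum 0 (\<sigma> i))"
    and "\<And>i n. n \<in> occupation_numbers \<Longrightarrow>
          fock_merge (S (creation (A (\<gamma> i)) (number_state (\<lambda>j. A (\<gamma> j)) n))) =
            R i *\<^sub>C creation (direct_sum (\<rho> i) 0) (fock_merge (S (number_state (\<lambda>j. A (\<gamma> j)) n)))
            + T i *\<^sub>C creation (direct_sum 0 (\<sigma> i)) (fock_merge (S (number_state (\<lambda>j. A (\<gamma> j)) n)))"
  shows "evolution_map F S (thermal_state \<beta> \<Omega> \<omega> m (\<lambda>i. A (\<gamma> i))) = thermal_state \<beta> \<Omega> \<omega> m \<rho>"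
proof -
  define k where "k = number_state (\<lambda>i. A (\<gamma> i))"
  define w where "w = boltzmann \<beta> \<Omega> \<omega> m"
  interpret iso: isometry_on F "k ` \<N>" S
    by unfold_locales (use assms(13,15,16) in \<open>simp_all add: k_def\<close>)
  have kF: "k n \<in> F" if "n \<in> \<N>" for n
    unfolding iso.F using closed_cspan_superset[of "k ` \<N>"] that by blast
  have k_zero: "k (\<lambda>_. 0) = vacuum"
    by (simp add: k_def number_state_zero)
  interpret sc: scattering \<rho> \<sigma> \<tau> \<gamma> \<Lambda> T R t r x \<epsilon> N "\<lambda>n. S (k n)"
  proof
    fix n :: "nat \<Rightarrow> nat" and i
    assume n: "n \<in> \<N>"
    show "fock_merge (S (k n)) \<in> creation_domain (direct_sum (\<rho> i) 0)"
      and "fock_merge (S (k n)) \<in> creation_domain (direct_sum 0 (\<sigma> i))"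
      using assms(20)[OF n, of i] by (simp_all add: k_def)
    assume i: "\<And>j. j < i \<Longrightarrow> n j = 0"
    have "creation (A (\<gamma> i)) (k n) = sqrt (Suc (n i)) *\<^sub>C k (n(i := Suc (n i)))"
      unfolding k_def using n i by (rule number_state_Suc)
    then have "fock_merge (S (creation (A (\<gamma> i)) (k n))) = sqrt (Suc (n i)) *\<^sub>C fock_merge (S (k (n(i := Suc (n i)))))"
      by (simp only: iso.S_scaleC[OF kF[OF occupation_numbers_upd[OF n]]] fock_merge_scaleC)
    then show "sqrt (Suc (n i)) *\<^sub>C fock_merge (S (k (n(i := Suc (n i)))))
        = R i *\<^sub>C creation (direct_sum (\<rho> i) 0) (fock_merge (S (k n)))
        + T i *\<^sub>C creation (direct_sum 0 (\<sigma> i)) (fock_merge (S (k n)))"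
      using assms(21)[OF n, of i] by (simp only: k_def)
  next
    show "norm (S (k (\<lambda>_. 0))) = 1"
      unfolding k_zero by (rule assms(18))
    show "((\<lambda>n. (N * sqrt (fact (2 * n)) / (2 ^ n * fact n)) *\<^sub>C symmetrize (two_particle_power \<epsilon> n))
        has_sum fock_merge (S (k (\<lambda>_. 0)))) UNIV"
      unfolding k_zero by (rule assms(19))
  qed (rule assms(3-10,14))+
  have "evolution_map F S (thermal_state \<beta> \<Omega> \<omega> m (\<lambda>i. A (\<gamma> i))) \<psi> = thermal_state \<beta> \<Omega> \<omega> m \<rho> \<psi>" for \<psi>
  proof (cases "w summable_on \<N>")
    case False
    \<comment> \<open>With a divergent partition function both thermal states are the zero operator
      by the conventions above, and the evolution map sends zero to zero.\<close>
    note zero = thermal_state_not_summable[OF False[unfolded w_def]]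
    show ?thesis
      by (simp add: zero evolution_map_def partial_trace_snd_def iso.S_zero linear_0 bounded_linear.linear[OF bounded_linear_slice_snd])
  next
    case True
    interpret occupation_weights w x
    proof
      show "w (n(i := Suc (n i))) = (x i)\<^sup>2 * w n" if n: "n \<in> \<N>" for n i
      proof -
        \<comment> \<open>The value 2 pi / kappa of the inverse temperature makes the Boltzmann
          factor of one quantum the square of \<open>x i\<close>.\<close>
        have "(x i)\<^sup>2 = exp (- \<beta> * (\<omega> i - \<Omega> * m i))"
          unfolding assms(1,2) by (simp add: power2_eq_square flip: exp_add)
        then show ?thesis
          unfolding w_def by (simp only: boltzmann_Suc[OF n])
      qed
    qed (simp_all add: True, simp_all add: w_def boltzmann_def)
    \<comment> \<open>\<open>A\<close> is not assumed isometric, so orthonormality of the in-states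
      is read off backwards from that of their images under the isometry \<open>S\<close>.\<close>
    have k: "orthonormal_on \<N> k"
      using sc.orthonormal_out by (simp add: orthonormal_on_def iso.cinner_S kF)
    let ?c = "1 / complex_of_real (infsum w \<N>)"
    \<comment> \<open>Conjugation by \<open>S\<close> sends an ensemble to the ensemble of images:
      the adjoint turns the coefficient of \<open>k n\<close> into that of \<open>S (k n)\<close>,
      and \<open>S\<close> passes through the convergent series inside \<open>F\<close>.\<close>
    have S: "S (thermal_state \<beta> \<Omega> \<omega> m (\<lambda>i. A (\<gamma> i)) (adjoint_on F S \<Phi>))
        = ?c *\<^sub>C mixture w (\<lambda>n. S (k n)) \<N> \<Phi>" for \<Phi>
    proof -
      let ?y = "adjoint_on F S \<Phi>"
      have sum: "((\<lambda>n. (w n * cinner (k n) ?y) *\<^sub>C k n) has_sum mixture w k \<N> ?y) \<N>"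
        by (rule trace_class_family.has_sum_mixture[OF trace_class_orthonormal(1)[OF k]])
      have terms: "(w n * cinner (k n) ?y) *\<^sub>C k n \<in> F" if "n \<in> \<N>" for n
        using that by (intro iso.F_scaleC kF)
      have "S ((w n * cinner (k n) ?y) *\<^sub>C k n) = (w n * cinner (S (k n)) \<Phi>) *\<^sub>C S (k n)"
        if "n \<in> \<N>" for n
        unfolding iso.S_scaleC[OF kF[OF that]] iso.adjoint_on_orthonormal(2)[OF refl k that] ..
      then have "((\<lambda>n. (w n * cinner (S (k n)) \<Phi>) *\<^sub>C S (k n)) has_sum S (mixture w k \<N> ?y)) \<N>"
        by (rule has_sum_cong[THEN iffD1, OF _ iso.has_sum_S(2)[OF sum terms]])
      then have "mixture w (\<lambda>n. S (k n)) \<N> \<Phi> = S (mixture w k \<N> ?y)"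
        unfolding mixture_def[of _ "\<lambda>n. S (k n)"] by (rule infsumI)
      then show ?thesis
        unfolding thermal_state_eq_mixture w_def[symmetric] k_def[symmetric] by (simp only: iso.S_scaleC[OF iso.has_sum_S(1)[OF sum terms]] of_real_divide of_real_1)
    qed
    have "evolution_map F S (thermal_state \<beta> \<Omega> \<omega> m (\<lambda>i. A (\<gamma> i))) \<psi>
        = ?c *\<^sub>C mixture (\<lambda>(n, b). w n) (\<lambda>(n, b). slice_snd b (S (k n))) (\<N> \<times> UNIV) \<psi>"
      unfolding evolution_map_def S
      by (rule partial_trace_mixture[OF trace_class_orthonormal(1)[OF sc.orthonormal_out]])
    also have "\<dots> = ?c *\<^sub>C mixture w (number_state \<rho>) \<N> \<psi>"
      unfolding sc.partial_trace_thermal[OF occupation_weights_axioms] ..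
    also have "\<dots> = thermal_state \<beta> \<Omega> \<omega> m \<rho> \<psi>"
      unfolding thermal_state_eq_mixture w_def[symmetric] by simp
    finally show ?thesis .
  qed
  then show ?thesis
    by (rule ext)
qed

end
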